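(* Let $\mathfrak H=\mathfrak H_1\oplus\mathfrak H_2$ be an orthogonal decomposition of the Hilbert space $\mathfrak H$ and let $$A^0=\begin{pmatrix} A_{11} & A_{12} \\ A_{21} & \ast \end{pmatrix}$$ be an incomplete block operator with respect to this decomposition, where $A_{11}=A_{11}^*\in[\mathfrak H_1]$ and $A_{21}=A_{12}^*\in[\mathfrak H_1,\mathfrak H_2]$ are bounded and the entry $\ast$ is unspecified. Let $J=\operatorname{sign}(A_{11})$ be the (unitary) signature operator of $A_{11}$ and, in addition, assume that there is a spectral gap $(-\delta,0)\subset\rho(A_{11})$, $\delta>0$. For a selfadjoint completion $A=(A_{ij})_{i,j=1}^2\in[\mathfrak H]$ of $A^0$ consider the condition (Max) there exists a subspace $\mathfrak M\subset\mathfrak H_1$ which is maximal uniformly $A$-negative. Then: (i) There exists a completion $A\in[\mathfrak H]$ of $A^0$ with some operator $A_{22}=A_{22}^*\in[\mathfrak H_2]$ satisfying (Max) if and only if $$\operatorname{ran}A_{12}\subset\operatorname{ran}|A_{11}|^{1/2}.$$ (ii) In this case the operator $S=|A_{11}|^{[-1/2]}A_{12}$ is well defined and $S\in[\mathfrak H_2,\mathfrak H_1]$. Moreover, $S^*JS$ is the smallest operator in the solution set $$\mathcal A:=\{A_{22}=A_{22}^*\in[\mathfrak H_2]:\ A=(A_{ij})_{i,j=1}^2\text{ satisfies (Max)}\}$$ and this solution set admits a description as the (semibounded) operator interval $$\mathcal A=\{A_{22}\in[\mathfrak H_2]:\ A_{22}=S^*JS+Y,\ Y=Y^*\ge0\}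.$$
   Context: $[\mathfrak H,\mathfrak K]$ denotes the bounded everywhere defined linear operators from the Hilbert space $\mathfrak H$ to the Hilbert space $\mathfrak K$, and $[\mathfrak H]=[\mathfrak H,\mathfrak H]$. A subspace $\mathfrak M\subset\mathfrak H$ is uniformly $A$-negative if there is a constant $\nu>0$ such that $(Af,f)\le-\nu\|f\|^2$ for all $f\in\mathfrak M$; it is maximal uniformly $A$-negative if it has no proper uniformly $A$-negative extension (in $\mathfrak H$). For a bounded selfadjoint $X$ with spectral family $E_t$: $|X|=(X^2)^{1/2}$, and $\operatorname{sign}(X)=\int_{\mathbb R}\operatorname{sign}(t)\,dE_t$ with $\operatorname{sign}(t)=1$ for $t\ge0$ and $-1$ for $t<0$; $\rho(X)$ is the resolvent set. $|X|^{[-1/2]}$ denotes the (generalized) Moore–Penrose inverse of $|X|^{1/2}$: it is defined on $\operatorname{ran}|X|^{1/2}\oplus\ker X$, equals the inverse of $|X|^{1/2}$ restricted to $(\ker X)^\perp$ on $\operatorname{ran}|X|^{1/2}$, and is zero on $\ker X$. *)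

theory Defs
  imports "HOL-Analysis.Analysis"
begin

text \<open>Complex Hilbert spaces; the inner product is linear in its \<^emph>\<open>first\<close> argument. The underlying
  real normed space structure is the library's, so completeness and boundedness are too.\<close>

class chilbert_space = banach +
  fixes scaleC :: "complex \<Rightarrow> 'a \<Rightarrow> 'a"  (infixr "*\<^sub>C" 75)
    and cinner :: "'a \<Rightarrow> 'a \<Rightarrow> complex"
  assumes scaleC_of_real: "complex_of_real r *\<^sub>C x = r *\<^sub>R x"
    and scaleC_add_right: "c *\<^sub>C (x + y) = c *\<^sub>C x + c *\<^sub>C y"
    and scaleC_add_left: "(c + d) *\<^sub>C x = c *\<^sub>C x + d *\<^sub>C x"
    and scaleC_scaleC: "c *\<^sub>C d *\<^sub>C x = (c * d) *\<^sub>C x"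
    and cinner_commute: "cinner x y = cnj (cinner y x)"
    and cinner_add_left: "cinner (x + y) z = cinner x z + cinner y z"
    and cinner_scaleC_left: "cinner (c *\<^sub>C x) y = c * cinner x y"
    and cinner_self: "cinner x x = complex_of_real ((norm x)\<^sup>2)"

text \<open>The orthogonal sum of two Hilbert spaces: the norm on a product type in
  HOL-Analysis is the Euclidean one.\<close>

instantiation prod :: (chilbert_space, chilbert_space) chilbert_space
begin

definition scaleC_prod_def: "c *\<^sub>C p = (c *\<^sub>C fst p, c *\<^sub>C snd p)"

definition cinner_prod_def: "cinner p q = cinner (fst p) (fst q) + cinner (snd p) (snd q)"

instance
proof
  fix r :: real and c d :: complex and x y z :: "'a \<times> 'b"
  show "complex_of_real r *\<^sub>C x = r *\<^sub>R x"
    by (simp add: scaleC_prod_def scaleC_of_real scaleR_prod_def)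
  show "c *\<^sub>C (x + y) = c *\<^sub>C x + c *\<^sub>C y"
    by (simp add: scaleC_prod_def scaleC_add_right)
  show "(c + d) *\<^sub>C x = c *\<^sub>C x + d *\<^sub>C x"
    by (simp add: scaleC_prod_def scaleC_add_left)
  show "c *\<^sub>C d *\<^sub>C x = (c * d) *\<^sub>C x"
    by (simp add: scaleC_prod_def scaleC_scaleC)
  show "cinner x y = cnj (cinner y x)"
    by (simp add: cinner_prod_def cinner_commute[of "fst x"] cinner_commute[of "snd x"])
  show "cinner (x + y) z = cinner x z + cinner y z"
    by (simp add: cinner_prod_def cinner_add_left)
  show "cinner (c *\<^sub>C x) y = c * cinner x y"
    by (simp add: cinner_prod_def scaleC_prod_def cinner_scaleC_left distrib_left)
  show "cinner x x = complex_of_real ((norm x)\<^sup>2)"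
    by (simp add: cinner_prod_def cinner_self norm_prod_def)
qed

end

definition bounded_clinear :: "('a::chilbert_space \<Rightarrow> 'b::chilbert_space) \<Rightarrow> bool" where
  "bounded_clinear T \<longleftrightarrow> bounded_linear T \<and> (\<forall>c x. T (c *\<^sub>C x) = c *\<^sub>C T x)"

definition csubspace :: "'a::chilbert_space set \<Rightarrow> bool" where
  "csubspace M \<longleftrightarrow> 0 \<in> M \<and> (\<forall>x\<in>M. \<forall>y\<in>M. x + y \<in> M) \<and> (\<forall>c. \<forall>x\<in>M. c *\<^sub>C x \<in> M)"

definition cadjoint :: "('a::chilbert_space \<Rightarrow> 'b::chilbert_space) \<Rightarrow> 'b \<Rightarrow> 'a" where
  "cadjoint T = (THE T'. \<forall>x y. cinner (T x) y = cinner x (T' y))"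

definition selfadjoint_op :: "('a::chilbert_space \<Rightarrow> 'a) \<Rightarrow> bool" where
  "selfadjoint_op T \<longleftrightarrow> bounded_clinear T \<and> cadjoint T = T"

text \<open>For selfadjoint operators the quadratic form is real, so only its real part matters.\<close>

definition op_le :: "('a::chilbert_space \<Rightarrow> 'a) \<Rightarrow> ('a \<Rightarrow> 'a) \<Rightarrow> bool" where
  "op_le S T \<longleftrightarrow> (\<forall>f. Re (cinner (S f) f) \<le> Re (cinner (T f) f))"

definition nonneg_op :: "('a::chilbert_space \<Rightarrow> 'a) \<Rightarrow> bool" where
  "nonneg_op T \<longleftrightarrow> selfadjoint_op T \<and> op_le (\<lambda>_. 0) T"

definition op_sqrt :: "('a::chilbert_space \<Rightarrow> 'a) \<Rightarrow> 'a \<Rightarrow> 'a" where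
  "op_sqrt P = (THE Q. nonneg_op Q \<and> Q \<circ> Q = P)"

definition abs_op :: "('a::chilbert_space \<Rightarrow> 'a) \<Rightarrow> 'a \<Rightarrow> 'a" where
  "abs_op X = op_sqrt (X \<circ> X)"

definition op_kernel :: "('a::chilbert_space \<Rightarrow> 'b::chilbert_space) \<Rightarrow> 'a set" where
  "op_kernel T = {x. T x = 0}"

definition ortho_compl :: "'a::chilbert_space set \<Rightarrow> 'a set" where
  "ortho_compl M = {x. \<forall>y\<in>M. cinner x y = 0}"

definition resolvent_set :: "('a::chilbert_space \<Rightarrow> 'a) \<Rightarrow> complex set" where
  "resolvent_set X = {z. \<exists>R. bounded_clinear R \<and>
     (\<forall>x. R (X x - z *\<^sub>C x) = x) \<and> (\<forall>x. X (R x) - z *\<^sub>C R x = x)}"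

text \<open>Resolutions of the identity, and integrals \<open>\<integral> \<phi>(t) dE\<^sub>t\<close> in the usual weak sense
  \<open>(Tf, f) = \<integral> \<phi>(t) d(E\<^sub>t f, f)\<close> for all \<open>f\<close>, where \<open>d(E\<^sub>t f, f)\<close> is the Lebesgue--Stieltjes measure.
  By polarization the quadratic form determines \<open>T\<close>.\<close>

definition orthogonal_projection :: "('a::chilbert_space \<Rightarrow> 'a) \<Rightarrow> bool" where
  "orthogonal_projection P \<longleftrightarrow> selfadjoint_op P \<and> P \<circ> P = P"

definition resolution_of_identity :: "(real \<Rightarrow> 'a::chilbert_space \<Rightarrow> 'a) \<Rightarrow> bool" where
  "resolution_of_identity E \<longleftrightarrow>
     (\<forall>t. orthogonal_projection (E t)) \<and>
     (\<forall>s t. s \<le> t \<longrightarrow> op_le (E s) (E t)) \<and>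
     (\<forall>t f. ((\<lambda>s. E s f) \<longlongrightarrow> E t f) (at_right t)) \<and>
     (\<forall>f. ((\<lambda>t. E t f) \<longlongrightarrow> 0) at_bot) \<and>
     (\<forall>f. ((\<lambda>t. E t f) \<longlongrightarrow> f) at_top)"

definition form_measure :: "(real \<Rightarrow> 'a::chilbert_space \<Rightarrow> 'a) \<Rightarrow> 'a \<Rightarrow> real measure" where
  "form_measure E f = interval_measure (\<lambda>t. Re (cinner (E t f) f))"

definition has_spectral_integral ::
  "(real \<Rightarrow> 'a::chilbert_space \<Rightarrow> 'a) \<Rightarrow> (real \<Rightarrow> real) \<Rightarrow> ('a \<Rightarrow> 'a) \<Rightarrow> bool" where
  "has_spectral_integral E \<phi> T \<longleftrightarrow> bounded_clinear T \<and>
     (\<forall>f. integrable (form_measure E f) \<phi> \<and>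
          cinner (T f) f = complex_of_real (LINT t|form_measure E f. \<phi> t))"

definition spectral_integral ::
  "(real \<Rightarrow> 'a::chilbert_space \<Rightarrow> 'a) \<Rightarrow> (real \<Rightarrow> real) \<Rightarrow> 'a \<Rightarrow> 'a" where
  "spectral_integral E \<phi> = (THE T. has_spectral_integral E \<phi> T)"

text \<open>The family \<open>E\<close> with \<open>X = \<integral> t dE\<^sub>t\<close>, which is unique by the spectral theorem.\<close>

definition spectral_family :: "('a::chilbert_space \<Rightarrow> 'a) \<Rightarrow> real \<Rightarrow> 'a \<Rightarrow> 'a" where
  "spectral_family X = (SOME E. resolution_of_identity E \<and> has_spectral_integral E (\<lambda>t. t) X)"

text \<open>Note that \<open>sign(0) = 1\<close> here, unlike for the library's \<^const>\<open>sgn\<close>.\<close>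

definition sign_op :: "('a::chilbert_space \<Rightarrow> 'a) \<Rightarrow> 'a \<Rightarrow> 'a" where
  "sign_op X = spectral_integral (spectral_family X) (\<lambda>t. if t \<ge> 0 then 1 else -1)"

text \<open>The Moore--Penrose inverse \<open>|X|\<^sup>[\<^sup>-\<^sup>1\<^sup>/\<^sup>2\<^sup>]\<close> is only partially defined; its value outside
  \<open>mp_inv_sqrt_abs_dom X\<close> is irrelevant.\<close>

definition mp_inv_sqrt_abs_dom :: "('a::chilbert_space \<Rightarrow> 'a) \<Rightarrow> 'a set" where
  "mp_inv_sqrt_abs_dom X = {op_sqrt (abs_op X) x + k | x k. k \<in> op_kernel X}"

definition mp_inv_sqrt_abs :: "('a::chilbert_space \<Rightarrow> 'a) \<Rightarrow> 'a \<Rightarrow> 'a" where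
  "mp_inv_sqrt_abs X y = (THE x. x \<in> ortho_compl (op_kernel X) \<and>
     (\<exists>k\<in>op_kernel X. y = op_sqrt (abs_op X) x + k))"

definition uniformly_negative :: "('a::chilbert_space \<Rightarrow> 'a) \<Rightarrow> 'a set \<Rightarrow> bool" where
  "uniformly_negative A M \<longleftrightarrow> csubspace M \<and>
     (\<exists>\<nu>>0. \<forall>f\<in>M. Re (cinner (A f) f) \<le> - \<nu> * (norm f)\<^sup>2)"

definition maximal_uniformly_negative :: "('a::chilbert_space \<Rightarrow> 'a) \<Rightarrow> 'a set \<Rightarrow> bool" where
  "maximal_uniformly_negative A M \<longleftrightarrow> uniformly_negative A M \<and>
     (\<forall>N. uniformly_negative A N \<and> M \<subseteq> N \<longrightarrow> N = M)"

definition block_op ::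
  "('a::chilbert_space \<Rightarrow> 'a) \<Rightarrow> ('b::chilbert_space \<Rightarrow> 'a) \<Rightarrow> ('a \<Rightarrow> 'b) \<Rightarrow> ('b \<Rightarrow> 'b) \<Rightarrow> 'a \<times> 'b \<Rightarrow> 'a \<times> 'b"
  where
  "block_op A11 A12 A21 A22 = (\<lambda>(x, y). (A11 x + A12 y, A21 x + A22 y))"

text \<open>The first summand is embedded in the orthogonal sum as the pairs \<open>(x, 0)\<close>.\<close>

definition condition_Max :: "('a::chilbert_space \<times> 'b::chilbert_space \<Rightarrow> 'a \<times> 'b) \<Rightarrow> bool" where
  "condition_Max A \<longleftrightarrow> (\<exists>M. M \<subseteq> UNIV \<times> {0} \<and> maximal_uniformly_negative A M)"

definition solution_set ::
  "('a::chilbert_space \<Rightarrow> 'a) \<Rightarrow> ('b::chilbert_space \<Rightarrow> 'a) \<Rightarrow> ('a \<Rightarrow> 'b) \<Rightarrow> ('b \<Rightarrow> 'b) set" where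
  "solution_set A11 A12 A21 =
     {A22. selfadjoint_op A22 \<and> condition_Max (block_op A11 A12 A21 A22)}"

end

theory Submission
  imports Defs "HOL-Probability.Distribution_Functions"
begin

text \<open>Let \<open>P\<close> be the spectral projection of \<open>A\<^sub>1\<^sub>1\<close> for the negative half-line. By the gap, \<open>J = I - 2P\<close> and
  \<open>A\<^sub>1\<^sub>1 = J R\<^sup>2\<close>, where \<open>R = |A\<^sub>1\<^sub>1|\<^bsup>1/2\<^esup>\<close> is bounded below on \<open>ran P\<close>. A uniformly negative subspace
  \<open>M\<close> is maximal exactly if the form of \<open>A\<close> is nonnegative on the \<open>A\<close>-orthogonal complement of \<open>M\<close>.
  If this holds for some \<open>M\<close> inside the first summand, then it holds for \<open>ran P\<close>, whose
  \<open>A\<close>-orthogonal complement is given by \<open>P(A\<^sub>1\<^sub>1 x + A\<^sub>1\<^sub>2 y) = 0\<close>.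
  Applied to \<open>(x + z, y)\<close> with \<open>x\<close> in \<open>ker P\<close> and \<open>z\<close> in \<open>ran P\<close>, this yields
  \<open>|(A\<^sub>1\<^sub>2 y, x)| \<le> C \<parallel>R x\<parallel>\<close>, hence \<open>A\<^sub>1\<^sub>2 y \<in> ran R\<close>. Once \<open>A\<^sub>1\<^sub>2 = R S\<close>, completing the square gives
  \<open>(A(x,y),(x,y)) = (J u, u) + ((A\<^sub>2\<^sub>2 - S\<^sup>*JS) y, y)\<close> with \<open>u = R x + J S y\<close>. On the complement above
  \<open>P u = 0\<close>, so the first term is nonnegative, and it can be made arbitrarily small.\<close>

subsection \<open>Complex Hilbert spaces\<close>

text \<open>Square root, modulus, spectral family and sign are given by \<open>THE\<close> or
  \<open>SOME\<close>, so existence has to be shown for each. The spectral family is then known only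
  through the two properties that select it, and the effect of the gap must be read off from these.
  The gap enters twice: the family is constant on it, so the sign is \<open>I - 2P\<close> with a
  single projection; and the form of \<open>A\<^sub>1\<^sub>1\<close> is at most
  \<open>-\<delta>/2\<close> on \<open>ran P\<close>, so every equation
  \<open>P(A\<^sub>1\<^sub>1 x + b) = 0\<close> has a solution in \<open>ran P\<close>. On
  \<open>ran P\<close> the operator \<open>R\<close> is thus boundedly invertible. On
  \<open>ker P\<close> its range need not be closed, and \<open>JSy\<close> lies only in the closure
  of \<open>ran R\<close>: this is why the first term of the square is made small instead of zero.
  The passage from an unknown \<open>M\<close> to \<open>ran P\<close> rests on one fact: a vector
  of the first summand that is \<open>A\<close>-orthogonal to \<open>ran P\<close> lies in
  \<open>ker P\<close>, where the form is nonnegative; hence no nonzero vector of \<open>M\<close>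
  is \<open>A\<close>-orthogonal to \<open>ran P\<close>.\<close>

lemma scaleC_zero_right [simp]: "c *\<^sub>C (0::'a::chilbert_space) = 0"
  using scaleC_add_right[of c 0 "0::'a"] by simp

lemma scaleC_zero_left [simp]: "0 *\<^sub>C (x::'a::chilbert_space) = 0"
  using scaleC_add_left[of 0 0 x] by simp

lemma scaleC_one [simp]: "1 *\<^sub>C (x::'a::chilbert_space) = x"
  using scaleC_of_real[of 1 x] by simp

lemma scaleC_minus_one: "(-1) *\<^sub>C (x::'a::chilbert_space) = - x"
  using scaleC_of_real[of "-1" x] by simp

lemma scaleC_minus_right: "c *\<^sub>C (- x) = - (c *\<^sub>C (x::'a::chilbert_space))"
proof -
  have "c *\<^sub>C (x + - x) = c *\<^sub>C x + c *\<^sub>C (- x)" by (rule scaleC_add_right)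
  then have "c *\<^sub>C x + c *\<^sub>C (- x) = 0" by simp
  then show ?thesis by (metis minus_unique)
qed

lemma scaleC_diff_right: "c *\<^sub>C (x - y) = c *\<^sub>C x - c *\<^sub>C (y::'a::chilbert_space)"
  using scaleC_add_right[of c x "- y"] by (simp add: scaleC_minus_right)

lemma scaleC_scaleR_commute: "c *\<^sub>C (r *\<^sub>R x) = r *\<^sub>R (c *\<^sub>C (x::'a::chilbert_space))"
  by (metis scaleC_of_real scaleC_scaleC mult.commute)

lemma cinner_add_right: "cinner x (y + z) = cinner x y + cinner x (z::'a::chilbert_space)"
  by (metis cinner_add_left cinner_commute complex_cnj_add)

lemma cinner_scaleC_right: "cinner x (c *\<^sub>C y) = cnj c * cinner x (y::'a::chilbert_space)"
  by (metis cinner_scaleC_left cinner_commute complex_cnj_mult)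

lemma cinner_scaleR_left: "cinner (r *\<^sub>R x) y = of_real r * cinner x (y::'a::chilbert_space)"
  by (metis cinner_scaleC_left scaleC_of_real)

lemma cinner_scaleR_right: "cinner x (r *\<^sub>R y) = of_real r * cinner x (y::'a::chilbert_space)"
  by (metis cinner_scaleC_right scaleC_of_real complex_cnj_complex_of_real)

lemma cinner_zero_left [simp]: "cinner 0 (y::'a::chilbert_space) = 0"
  using cinner_add_left[of 0 0 y] by simp

lemma cinner_zero_right [simp]: "cinner (x::'a::chilbert_space) 0 = 0"
  using cinner_add_right[of x 0 0] by simp

lemma cinner_minus_left: "cinner (- x) y = - cinner x (y::'a::chilbert_space)"
  by (metis scaleC_minus_one cinner_scaleC_left mult_minus1)

lemma cinner_minus_right: "cinner x (- y) = - cinner x (y::'a::chilbert_space)"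
  using cinner_scaleC_right[of x "-1" y] by (simp add: scaleC_minus_one)

lemma cinner_diff_left: "cinner (x - y) z = cinner x z - cinner y (z::'a::chilbert_space)"
  using cinner_add_left[of x "- y" z] by (simp add: cinner_minus_left)

lemma cinner_diff_right: "cinner x (y - z) = cinner x y - cinner x (z::'a::chilbert_space)"
  using cinner_add_right[of x y "- z"] by (simp add: cinner_minus_right)

lemmas cinner_simps = cinner_add_left cinner_add_right cinner_diff_left cinner_diff_right
  cinner_minus_left cinner_minus_right cinner_scaleC_left cinner_scaleC_right
  cinner_scaleR_left cinner_scaleR_right

lemma Re_cinner_commute: "Re (cinner x y) = Re (cinner y (x::'a::chilbert_space))"
  by (subst cinner_commute) simp

lemma norm_cinner_commute: "norm (cinner x y) = norm (cinner y (x::'a::chilbert_space))"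
  by (subst cinner_commute) simp

lemma cinner_eq_zero_commute: "cinner x y = 0 \<longleftrightarrow> cinner y (x::'a::chilbert_space) = 0"
  by (metis cinner_commute complex_cnj_zero)

lemma Re_cinner_self: "Re (cinner x x) = (norm (x::'a::chilbert_space))\<^sup>2"
  by (simp add: cinner_self)

lemma cinner_self_zero: "cinner x x = 0 \<longleftrightarrow> (x::'a::chilbert_space) = 0"
  by (simp add: cinner_self)

lemma cinner_eqI: "(\<And>z. cinner x z = cinner y z) \<Longrightarrow> (x::'a::chilbert_space) = y"
  by (metis cinner_diff_left cinner_self_zero eq_iff_diff_eq_0)

lemma cinner_eqI2: "(\<And>z. cinner z x = cinner z y) \<Longrightarrow> (x::'a::chilbert_space) = y"
  by (metis cinner_commute cinner_eqI)

lemma norm_scaleC: "norm (c *\<^sub>C x) = cmod c * norm (x::'a::chilbert_space)"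
proof -
  have "(norm (c *\<^sub>C x))\<^sup>2 = Re (c * cnj c * cinner x x)"
    by (simp add: Re_cinner_self[symmetric] cinner_simps mult_ac)
  also have "\<dots> = (cmod c * norm x)\<^sup>2"
    by (simp add: complex_norm_square[symmetric] cinner_self power_mult_distrib
        flip: of_real_power of_real_mult)
  finally show ?thesis by (simp add: power2_eq_iff_nonneg)
qed

lemma norm_add_sq: "(norm (x + y))\<^sup>2 = (norm x)\<^sup>2 + 2 * Re (cinner x y) + (norm (y::'a::chilbert_space))\<^sup>2"
  using Re_cinner_commute[of x y] by (simp add: Re_cinner_self[symmetric] cinner_simps)

lemma norm_diff_sq: "(norm (x - y))\<^sup>2 = (norm x)\<^sup>2 - 2 * Re (cinner x y) + (norm (y::'a::chilbert_space))\<^sup>2"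
  using Re_cinner_commute[of x y] by (simp add: Re_cinner_self[symmetric] cinner_simps)

text \<open>Variational arguments over real parameters only give identities of real parts. Applying
  them also to the \<i>-multiple of a vector supplies the second hypothesis.\<close>

lemma complex_eqI_Re_rotate:
  assumes "Re z = 0" and "Re (\<i> * z) = 0" shows "z = 0"
  using assms by (simp add: complex_eq_iff)

section \<open>Bounded complex-linear maps and complex subspaces\<close>

lemma bounded_clinear_imp: 
  assumes "bounded_clinear T"
  shows bounded_clinear_bounded: "bounded_linear T"
    and bounded_clinear_add: "T (x + y) = T x + T y"
    and bounded_clinear_diff: "T (x - y) = T x - T y"
    and bounded_clinear_minus: "T (- x) = - T x"
    and bounded_clinear_zero: "T 0 = 0"
    and bounded_clinear_scaleR: "T (r *\<^sub>R x) = r *\<^sub>R T x"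
    and bounded_clinear_scaleC: "T (c *\<^sub>C x) = c *\<^sub>C T x"
proof -
  show *: "bounded_linear T" using assms by (simp add: bounded_clinear_def)
  interpret bounded_linear T by (rule *)
  show "T (x + y) = T x + T y" "T (x - y) = T x - T y" "T (- x) = - T x" "T 0 = 0"
    "T (r *\<^sub>R x) = r *\<^sub>R T x"
    by (simp_all add: add diff neg zero scaleR)
  show "T (c *\<^sub>C x) = c *\<^sub>C T x" using assms by (simp add: bounded_clinear_def)
qed

lemma bounded_clinearI:
  assumes "\<And>x y. T (x + y) = T x + T y" "\<And>c x. T (c *\<^sub>C x) = c *\<^sub>C T x"
    "\<And>x. norm (T x) \<le> K * norm x"
  shows "bounded_clinear T"
  unfolding bounded_clinear_def
proof (intro conjI allI assms(2))
  show "bounded_linear T"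
  proof (rule bounded_linear_intro[where K = K])
    show "T (r *\<^sub>R x) = r *\<^sub>R T x" for r x
      by (metis assms(2) scaleC_of_real)
  qed (use assms in \<open>auto simp: mult.commute\<close>)
qed

lemma bounded_clinear_bound:
  assumes "bounded_clinear T" obtains K where "K > 0" "\<And>x. norm (T x) \<le> K * norm x"
  using bounded_linear.pos_bounded[OF bounded_clinear_bounded[OF assms]]
  by (metis mult.commute)

lemma bounded_clinear_id [simp]: "bounded_clinear (\<lambda>x. x)"
  by (simp add: bounded_clinear_def bounded_linear_ident)

lemma bounded_clinear_const_zero [simp]: "bounded_clinear (\<lambda>x. 0)"
  by (simp add: bounded_clinear_def)

lemma bounded_clinear_add_fun:
  "bounded_clinear S \<Longrightarrow> bounded_clinear T \<Longrightarrow> bounded_clinear (\<lambda>x. S x + T x)"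
  by (simp add: bounded_clinear_def bounded_linear_add scaleC_add_right)

lemma bounded_clinear_diff_fun:
  "bounded_clinear S \<Longrightarrow> bounded_clinear T \<Longrightarrow> bounded_clinear (\<lambda>x. S x - T x)"
  by (simp add: bounded_clinear_def bounded_linear_sub scaleC_diff_right)

lemma bounded_clinear_scaleR_fun:
  "bounded_clinear T \<Longrightarrow> bounded_clinear (\<lambda>x. r *\<^sub>R T x)"
  by (simp add: bounded_clinear_def bounded_linear_const_scaleR scaleC_scaleR_commute)

lemma bounded_clinear_scaleC_map: "bounded_clinear (\<lambda>x::'a::chilbert_space. c *\<^sub>C x)"
  by (rule bounded_clinearI[of _ "cmod c"])
    (auto simp: scaleC_add_right scaleC_scaleC mult.commute norm_scaleC)

lemma bounded_clinear_comp:
  "bounded_clinear S \<Longrightarrow> bounded_clinear T \<Longrightarrow> bounded_clinear (\<lambda>x. S (T x))"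
  by (simp add: bounded_clinear_def bounded_linear_compose)

lemma bounded_clinear_tendsto:
  "bounded_clinear T \<Longrightarrow> (f \<longlongrightarrow> l) F \<Longrightarrow> ((\<lambda>x. T (f x)) \<longlongrightarrow> T l) F"
  by (simp add: bounded_linear.tendsto bounded_clinear_bounded)

lemma csubspace_imp:
  assumes "csubspace M"
  shows csubspace_zero: "0 \<in> M"
    and csubspace_add: "x \<in> M \<Longrightarrow> y \<in> M \<Longrightarrow> x + y \<in> M"
    and csubspace_scaleC: "x \<in> M \<Longrightarrow> c *\<^sub>C x \<in> M"
    and csubspace_scaleR: "x \<in> M \<Longrightarrow> r *\<^sub>R x \<in> M"
    and csubspace_diff: "x \<in> M \<Longrightarrow> y \<in> M \<Longrightarrow> x - y \<in> M"
proof -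
  show *: "0 \<in> M" "x \<in> M \<Longrightarrow> y \<in> M \<Longrightarrow> x + y \<in> M" "x \<in> M \<Longrightarrow> c *\<^sub>C x \<in> M" for x y c
    using assms by (auto simp: csubspace_def)
  show "x \<in> M \<Longrightarrow> r *\<^sub>R x \<in> M" by (metis *(3) scaleC_of_real)
  show "x \<in> M \<Longrightarrow> y \<in> M \<Longrightarrow> x - y \<in> M"
    using *(2)[of x "- y"] *(3)[of y "-1"] by (simp add: scaleC_minus_one)
qed

lemma csubspace_range:
  assumes "bounded_clinear T" shows "csubspace (range T)"
  unfolding csubspace_def
  by (auto simp: image_iff) (metis assms bounded_clinear_zero bounded_clinear_add bounded_clinear_scaleC)+

lemma csubspace_UNIV [simp]: "csubspace UNIV"
  by (simp add: csubspace_def)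

lemma csubspace_kernel:
  assumes "bounded_clinear T" shows "csubspace (op_kernel T)"
  by (simp add: csubspace_def op_kernel_def assms bounded_clinear_imp)

lemma closed_kernel:
  assumes "bounded_clinear T" shows "closed (op_kernel T)"
proof -
  have "continuous_on UNIV T"
    by (simp add: assms bounded_clinear_bounded linear_continuous_on)
  then show ?thesis
    unfolding op_kernel_def by (intro closed_Collect_eq) auto
qed

text \<open>Discriminant argument: \<open>t = 1 / b\<close> minimises the quadratic, and for
  \<open>b = 0\<close> a large \<open>t\<close> forces \<open>k = 0\<close>. The extra factor
  \<open>k\<close> in the quadratic term is what appears when a complex vector is scaled by
  \<open>t\<close> times an inner product of squared modulus \<open>k\<close>.\<close>

lemma nonneg_quadratic_bound:
  fixes a b k :: real
  assumes a: "0 \<le> a" and b: "0 \<le> b" and k: "0 \<le> k"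
    and ineq: "\<And>t. 0 \<le> a - 2 * t * k + t\<^sup>2 * k * b"
  shows "k \<le> a * b"
proof (cases "b = 0")
  case True
  have "k = 0"
  proof (rule ccontr)
    assume "k \<noteq> 0"
    then show False
      using ineq[of "(a + 1) / (2 * k)"] True a by (simp add: field_simps)
  qed
  then show ?thesis using True by simp
next
  case False
  then show ?thesis
    using ineq[of "1 / b"] b by (simp add: field_simps power2_eq_square)
qed

text \<open>Positivity is tested at \<open>f - c *\<^sub>C g\<close> with \<open>c = t * w\<close>
  and \<open>w = cinner (T f) g\<close>; the factor \<open>w\<close> makes both cross terms real.
  The form may be degenerate, so one proof serves the inner product and all nonnegative
  operators.\<close>

lemma cauchy_schwarz_form:
  fixes T :: "'a::chilbert_space \<Rightarrow> 'a"
  assumes T: "bounded_clinear T" and sym: "\<And>x y. cinner (T x) y = cinner x (T y)"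
    and pos: "\<And>x. 0 \<le> Re (cinner (T x) x)"
  shows "(cmod (cinner (T f) g))\<^sup>2 \<le> Re (cinner (T f) f) * Re (cinner (T g) g)"
proof (rule nonneg_quadratic_bound)
  fix t :: real
  define w where "w = cinner (T f) g"
  have gf: "cinner (T g) f = cnj w"
    unfolding w_def by (metis cinner_commute sym)
  define c where "c = of_real t * w"
  have *: "Re (cinner (T g) g) = Re (cinner (T g) g)" "Im (cinner (T g) g) = 0"
    using sym[of g g] cinner_commute[of "T g" g] by (auto simp: complex_eq_iff)
  have "0 \<le> Re (cinner (T (f - c *\<^sub>C g)) (f - c *\<^sub>C g))" by (rule pos)
  also have "cinner (T (f - c *\<^sub>C g)) (f - c *\<^sub>C g) =
      cinner (T f) f - cnj c * w - c * cnj w + (c * cnj c) * cinner (T g) g"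
    by (simp add: T bounded_clinear_imp cinner_simps gf flip: w_def) (simp add: algebra_simps)
  also have "cnj c * w = of_real (t * (cmod w)\<^sup>2)"
    by (simp add: c_def mult.assoc mult.commute[of "cnj w"] complex_norm_square[symmetric])
  also have "c * cnj w = of_real (t * (cmod w)\<^sup>2)"
    by (simp add: c_def mult.assoc complex_norm_square[symmetric])
  also have "c * cnj c = of_real (t\<^sup>2 * (cmod w)\<^sup>2)"
    unfolding complex_norm_square[symmetric] by (simp add: c_def norm_mult power_mult_distrib)
  finally show "0 \<le> Re (cinner (T f) f) - 2 * t * (cmod (cinner (T f) g))\<^sup>2 +
      t\<^sup>2 * (cmod (cinner (T f) g))\<^sup>2 * Re (cinner (T g) g)"
    by (simp add: w_def)
qed (use pos in auto)

lemma cinner_cauchy_schwarz: "cmod (cinner x y) \<le> norm x * norm (y::'a::chilbert_space)"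
proof -
  have "(cmod (cinner x y))\<^sup>2 \<le> (norm x * norm y)\<^sup>2"
    using cauchy_schwarz_form[of "\<lambda>x. x" x y] by (simp add: Re_cinner_self power_mult_distrib)
  then show ?thesis by (simp add: power2_le_iff_abs_le)
qed

lemma cinner_cauchy_schwarz_right: "cmod (cinner x y) \<le> norm y * norm (x::'a::chilbert_space)"
  using cinner_cauchy_schwarz[of x y] by (simp add: mult.commute)

lemma bounded_bilinear_cinner: "bounded_bilinear (cinner :: 'a::chilbert_space \<Rightarrow> 'a \<Rightarrow> complex)"
  by (rule bounded_bilinear.intro)
    (auto simp: cinner_simps scaleR_conv_of_real intro!: exI[of _ 1] cinner_cauchy_schwarz)

lemmas tendsto_cinner = bounded_bilinear.tendsto[OF bounded_bilinear_cinner]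

text \<open>Baire category: the closed sets \<open>K n\<close> on which the whole family is bounded
  by \<open>n\<close> cover the space, so one of them contains a ball around some \<open>a\<close>.
  Writing \<open>f u = f (a + u) - f a\<close> for \<open>norm u = e\<close> moves the bound from
  this ball to the origin.\<close>

lemma uniform_boundedness:
  fixes F :: "('a::banach \<Rightarrow> 'b::real_normed_vector) set"
  assumes lin: "\<And>f. f \<in> F \<Longrightarrow> bounded_linear f"
    and pw: "\<And>x. \<exists>C. \<forall>f\<in>F. norm (f x) \<le> C"
  shows "\<exists>C. \<forall>f\<in>F. \<forall>x. norm (f x) \<le> C * norm x"
proof -
  define K where "K n = {x. \<forall>f\<in>F. norm (f x) \<le> real n}" for n
  have clK: "closed (K n)" for n
  proof -
    have "K n = (\<Inter>f\<in>F. {x. norm (f x) \<le> real n})" by (auto simp: K_def)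
    moreover have "closed {x. norm (f x) \<le> real n}" if "f \<in> F" for f
      using lin[OF that]
      by (intro closed_Collect_le continuous_intros linear_continuous_on) auto
    ultimately show ?thesis by auto
  qed
  have "\<Union>(range K) = UNIV"
  proof -
    have "x \<in> \<Union>(range K)" for x
    proof -
      obtain C where C: "\<forall>f\<in>F. norm (f x) \<le> C" using pw by blast
      obtain n where "C \<le> real n" using real_arch_simple by blast
      then have "x \<in> K n" using C by (fastforce simp: K_def)
      then show ?thesis by blast
    qed
    then show ?thesis by blast
  qed
  have "\<exists>n. interior (K n) \<noteq> {}"
  proof (rule ccontr)
    assume *: "\<nexists>n. interior (K n) \<noteq> {}"
    interpret Met_TC: Metric_space "UNIV :: 'a set" dist by (rule Met_TC.Metric_space_axioms)
    have "euclidean interior_of \<Union>(range K) = {}"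
      using Met_TC.metric_Baire_category_alt[of "range K"] clK *
      by (auto simp: mcomplete_iff_complete complete_UNIV)
    then show False using \<open>\<Union>(range K) = UNIV\<close> by simp
  qed
  then obtain n a e where e: "e > 0" "cball a e \<subseteq> K n"
    by (metis interior_subset ex_in_conv open_contains_cball open_interior subset_trans)
  show ?thesis
  proof (intro exI ballI allI)
    fix f x assume f: "f \<in> F"
    interpret bounded_linear f by (rule lin[OF f])
    show "norm (f x) \<le> 2 * real n / e * norm x"
    proof (cases "x = 0")
      case False
      define u where "u = (e / norm x) *\<^sub>R x"
      have nu: "norm u = e" using False e by (simp add: u_def)
      have "norm (f (a + u)) \<le> real n" "norm (f a) \<le> real n"
        using e nu f by (auto simp: K_def subset_iff dist_norm)
      moreover have "f u = f (a + u) - f a" by (simp add: add)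
      ultimately have "norm (f u) \<le> 2 * real n"
        using norm_triangle_ineq4[of "f (a + u)" "f a"] by simp
      then show ?thesis using False e by (simp add: u_def scaleR field_simps)
    qed (simp add: zero)
  qed
qed

subsection \<open>Riesz representation, adjoints and projections\<close>

text \<open>First variation: at \<open>t = - b / k\<close> with \<open>k > \<bar>c\<bar>\<close> the
  expression is \<open>(b / k)\<^sup>2 * (c - 2 * k)\<close>, which is negative unless
  \<open>b = 0\<close>.\<close>

lemma linear_quadratic_nonneg_imp_zero:
  fixes b c :: real
  assumes "\<And>t. 0 \<le> 2 * t * b + t\<^sup>2 * c"
  shows "b = 0"
proof -
  define k where "k = \<bar>c\<bar> + 1"
  have k: "k > 0" "c < k" by (auto simp: k_def)
  have "0 \<le> 2 * (- b / k) * b + (- b / k)\<^sup>2 * c" by (rule assms)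
  also have "\<dots> = (b / k)\<^sup>2 * (c - 2 * k)"
    using k by (simp add: field_simps power2_eq_square)
  finally have "0 \<le> (b / k)\<^sup>2 * (c - 2 * k)" .
  then have "(b / k)\<^sup>2 \<le> 0" using k
    by (smt (verit) mult_pos_neg)
  then show ?thesis using k by simp
qed

text \<open>Direct method: minimise \<open>F v = (G v, v) - 2 Re (\<phi> v)\<close> over
  \<open>V\<close>. Coercivity is required on \<open>V\<close> only and \<open>V\<close> need not be
  closed, so the representing vector is found in the closure. The uses are \<open>G = I\<close>
  (Riesz), minus the given operator on \<open>ran P\<close>, and minus the block operator on
  subspaces of a maximal negative subspace, where these forms are definite.\<close>

lemma riesz_form:
  fixes G :: "'a::chilbert_space \<Rightarrow> 'a"
  assumes V: "csubspace V" and G: "bounded_clinear G"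
    and sym: "\<And>x y. cinner (G x) y = cinner x (G y)"
    and \<nu>: "\<nu> > 0" and coercive: "\<And>v. v \<in> V \<Longrightarrow> \<nu> * (norm v)\<^sup>2 \<le> Re (cinner (G v) v)"
    and \<phi>_add: "\<And>u v. u \<in> V \<Longrightarrow> v \<in> V \<Longrightarrow> \<phi> (u + v) = \<phi> u + \<phi> v"
    and \<phi>_scale: "\<And>c v. v \<in> V \<Longrightarrow> \<phi> (c *\<^sub>C v) = c * \<phi> v"
    and \<phi>_bound: "\<And>v. v \<in> V \<Longrightarrow> cmod (\<phi> v) \<le> C * norm v"
  shows "\<exists>s\<in>closure V. \<forall>v\<in>V. \<phi> v = cinner v (G s)"
proof -
  define F where "F v = Re (cinner (G v) v) - 2 * Re (\<phi> v)" for v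
  define m where "m = Inf (F ` V)"
  have \<phi>R: "\<phi> (r *\<^sub>R v) = of_real r * \<phi> v" if "v \<in> V" for r v
    using \<phi>_scale[OF that, of "of_real r"] by (simp add: scaleC_of_real)
  have V0: "0 \<in> V" by (rule csubspace_zero[OF V])
  have lower: "- C\<^sup>2 / \<nu> \<le> F v" if "v \<in> V" for v
  proof -
    have "Re (\<phi> v) \<le> C * norm v"
      using \<phi>_bound[OF that] complex_Re_le_cmod order_trans by blast
    then have "\<nu> * (norm v)\<^sup>2 - 2 * (C * norm v) \<le> F v"
      using coercive[OF that] by (simp add: F_def)
    moreover have "0 \<le> (\<nu> * norm v - C)\<^sup>2 / \<nu>" using \<nu> by simp
    then have "- C\<^sup>2 / \<nu> \<le> \<nu> * (norm v)\<^sup>2 - 2 * (C * norm v)"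
      using \<nu> by (simp add: field_simps power2_eq_square)
    ultimately show ?thesis by simp
  qed
  have bdd: "bdd_below (F ` V)" by (rule bdd_belowI2) (rule lower)
  have m_le: "m \<le> F v" if "v \<in> V" for v
    unfolding m_def using bdd that by (intro cInf_lower) auto
  have "\<exists>u\<in>V. F u < m + e" if "e > 0" for e
    using cInf_lessD[of "F ` V" "m + e"] V0 that by (force simp: m_def)
  then have "\<forall>n. \<exists>u. u \<in> V \<and> F u < m + 1 / real (Suc n)"
    by (metis divide_pos_pos of_nat_0_less_iff zero_less_Suc zero_less_one)
  then obtain u where uV: "\<And>n. u n \<in> V" and uF: "\<And>n. F (u n) < m + 1 / real (Suc n)"
    by metis
  \<comment> \<open>The midpoint of two points of \<open>V\<close> is in \<open>V\<close>, so
    \<open>F\<close> is at least \<open>m\<close> there. The parallelogram law for \<open>G\<close>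
    then turns closeness to the infimum into closeness in norm.\<close>
  have par: "\<nu> * (norm (x - y))\<^sup>2 \<le> 2 * (F x - m) + 2 * (F y - m)" if "x \<in> V" "y \<in> V" for x y
  proof -
    define w where "w = (1/2) *\<^sub>R (x + y)"
    have wV: "w \<in> V" unfolding w_def using that V by (intro csubspace_scaleR csubspace_add)
    have "\<phi> w = (\<phi> x + \<phi> y) / 2"
      using that V by (simp add: w_def \<phi>R csubspace_add \<phi>_add)
    then have "Re (\<phi> w) = (Re (\<phi> x) + Re (\<phi> y)) / 2"
      by (simp only: Re_divide_numeral plus_complex.sel)
    moreover have "Re (cinner (G (x - y)) (x - y)) =
        2 * Re (cinner (G x) x) + 2 * Re (cinner (G y) y) - 4 * Re (cinner (G w) w)"
      unfolding w_def using G by (simp add: bounded_clinear_imp cinner_simps algebra_simps)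
    ultimately have "Re (cinner (G (x - y)) (x - y)) = 2 * F x + 2 * F y - 4 * F w"
      by (simp add: F_def)
    moreover have "\<nu> * (norm (x - y))\<^sup>2 \<le> Re (cinner (G (x - y)) (x - y))"
      using that V by (intro coercive csubspace_diff)
    ultimately show ?thesis using m_le[OF wV] by simp
  qed
  have "Cauchy u"
  proof (rule metric_CauchyI)
    fix e :: real assume e: "e > 0"
    \<comment> \<open>With both excesses over \<open>m\<close> below
      \<open>\<nu> * e\<^sup>2 / 4\<close>, the right-hand side of \<open>par\<close> stays below
      \<open>\<nu> * e\<^sup>2\<close>.\<close>
    obtain N :: nat where N: "4 / (\<nu> * e\<^sup>2) < real N" using reals_Archimedean2 by blast
    have "dist (u i) (u j) < e" if ij: "N \<le> i" "N \<le> j" for i j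
    proof -
      have *: "1 / real (Suc k) < \<nu> * e\<^sup>2 / 4" if "N \<le> k" for k
      proof -
        have "4 / (\<nu> * e\<^sup>2) < real (Suc k)" using N that by simp
        then show ?thesis using \<nu> e by (simp add: field_simps)
      qed
      have "\<nu> * (norm (u i - u j))\<^sup>2 < \<nu> * e\<^sup>2"
        using par[OF uV uV, of i j] uF[of i] uF[of j] *[OF ij(1)] *[OF ij(2)] by simp
      then have "(norm (u i - u j))\<^sup>2 < e\<^sup>2" using \<nu> by simp
      then show ?thesis using e by (simp add: dist_norm power_less_imp_less_base)
    qed
    then show "\<exists>N. \<forall>i\<ge>N. \<forall>j\<ge>N. dist (u i) (u j) < e" by blast
  qed
  then obtain s where s: "u \<longlonglongrightarrow> s" using Cauchy_convergent convergent_def by blast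
  have sV: "s \<in> closure V" using s uV closure_sequential by blast
  have Fu: "(\<lambda>n. F (u n)) \<longlonglongrightarrow> m"
  proof (rule tendsto_sandwich[OF _ _ tendsto_const])
    show "(\<lambda>n. m + 1 / real (Suc n)) \<longlonglongrightarrow> m"
      using LIMSEQ_inverse_real_of_nat_add[of m] by (simp add: divide_inverse)
    show "\<forall>\<^sub>F n in sequentially. F (u n) \<le> m + 1 / real (Suc n)"
      by (intro always_eventually allI less_imp_le uF)
  qed (use m_le uV in auto)
  have Re_eq: "Re (\<phi> v) = Re (cinner v (G s))" if v: "v \<in> V" for v
  proof -
    \<comment> \<open>The limit \<open>s\<close> may lie outside \<open>V\<close>, where
      \<open>\<phi>\<close> is not controlled. The variation is therefore made at
      \<open>u n\<close>, and only the resulting inequality is passed to the limit.\<close>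
    have "0 \<le> 2 * t * (Re (cinner (G s) v) - Re (\<phi> v)) + t\<^sup>2 * Re (cinner (G v) v)" for t
    proof -
      have exp: "F (u n + t *\<^sub>R v) =
          F (u n) + 2 * t * (Re (cinner (G (u n)) v) - Re (\<phi> v)) + t\<^sup>2 * Re (cinner (G v) v)" for n
        using G sym[of v "u n"] Re_cinner_commute[of v "G (u n)"]
        by (simp add: F_def \<phi>_add[OF uV] \<phi>R v csubspace_scaleR[OF V] bounded_clinear_imp cinner_simps
            algebra_simps power2_eq_square)
      have "m \<le> F (u n) + 2 * t * (Re (cinner (G (u n)) v) - Re (\<phi> v)) + t\<^sup>2 * Re (cinner (G v) v)" for n
        using exp m_le csubspace_add[OF V uV csubspace_scaleR[OF V v]] by metis
      moreover have "(\<lambda>n. F (u n) + 2 * t * (Re (cinner (G (u n)) v) - Re (\<phi> v)) + t\<^sup>2 * Re (cinner (G v) v))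
          \<longlonglongrightarrow> m + 2 * t * (Re (cinner (G s) v) - Re (\<phi> v)) + t\<^sup>2 * Re (cinner (G v) v)"
        by (intro tendsto_intros Fu tendsto_cinner bounded_clinear_tendsto[OF G] s)
      ultimately have "m \<le> m + 2 * t * (Re (cinner (G s) v) - Re (\<phi> v)) + t\<^sup>2 * Re (cinner (G v) v)"
        by (meson LIMSEQ_le_const)
      then show ?thesis by simp
    qed
    then have "Re (cinner (G s) v) - Re (\<phi> v) = 0"
      by (rule linear_quadratic_nonneg_imp_zero)
    then show ?thesis using Re_cinner_commute[of v "G s"] by simp
  qed
  have "\<phi> v = cinner v (G s)" if v: "v \<in> V" for v
  proof -
    have "Re (\<phi> v - cinner v (G s)) = 0" using Re_eq[OF v] by simp
    moreover have "Re (\<i> * (\<phi> v - cinner v (G s))) = 0"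
      using Re_eq[OF csubspace_scaleC[OF V v, of \<i>]] by (simp add: \<phi>_scale v cinner_simps)
    ultimately have "\<phi> v - cinner v (G s) = 0" by (rule complex_eqI_Re_rotate)
    then show ?thesis by simp
  qed
  with sV show ?thesis by blast
qed

lemma riesz_subspace:
  fixes V :: "'a::chilbert_space set"
  assumes "csubspace V"
    and "\<And>u v. u \<in> V \<Longrightarrow> v \<in> V \<Longrightarrow> \<phi> (u + v) = \<phi> u + \<phi> v"
    and "\<And>c v. v \<in> V \<Longrightarrow> \<phi> (c *\<^sub>C v) = c * \<phi> v"
    and "\<And>v. v \<in> V \<Longrightarrow> cmod (\<phi> v) \<le> C * norm v"
  shows "\<exists>s\<in>closure V. \<forall>v\<in>V. \<phi> v = cinner v s"
  by (rule riesz_form[where G = "\<lambda>x. x" and \<nu> = 1, OF assms(1)])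
    (use assms in \<open>auto simp: Re_cinner_self\<close>)

lemma cadjoint_ex:
  fixes T :: "'a::chilbert_space \<Rightarrow> 'b::chilbert_space"
  assumes T: "bounded_clinear T"
  shows "\<exists>T'. \<forall>x y. cinner (T x) y = cinner x (T' y)"
proof -
  obtain K where K: "\<And>x. norm (T x) \<le> K * norm x" using bounded_clinear_bound[OF T] by blast
  have "\<exists>s. \<forall>x. cinner (T x) y = cinner x s" for y
  proof -
    have "cmod (cinner (T x) y) \<le> (K * norm y) * norm x" for x
    proof -
      have "cmod (cinner (T x) y) \<le> norm (T x) * norm y" by (rule cinner_cauchy_schwarz)
      also have "\<dots> \<le> K * norm x * norm y" by (intro mult_right_mono K) auto
      finally show ?thesis by (simp add: mult_ac)
    qed
    then show ?thesis
      using riesz_subspace[of UNIV "\<lambda>x. cinner (T x) y" "K * norm y"] T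
      by (auto simp: bounded_clinear_imp cinner_simps)
  qed
  then show ?thesis by metis
qed

lemma cadjoint_unique:
  fixes T :: "'a::chilbert_space \<Rightarrow> 'b::chilbert_space"
  assumes "\<And>x y. cinner (T x) y = cinner x (T' y)"
  shows "cadjoint T = T'"
  unfolding cadjoint_def
proof (rule the_equality)
  fix T'' assume "\<forall>x y. cinner (T x) y = cinner x (T'' y)"
  then have "cinner x (T'' y) = cinner x (T' y)" for x y using assms[of x y] by simp
  then show "T'' = T'" by (intro ext cinner_eqI2)
qed (use assms in blast)

lemma cadjoint_cinner:
  assumes "bounded_clinear T"
  shows "cinner (T x) y = cinner x (cadjoint T y)"
  using cadjoint_ex[OF assms] cadjoint_unique[of T] by metis

lemma cadjoint_cinner_right:
  assumes "bounded_clinear T"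
  shows "cinner y (T x) = cinner (cadjoint T y) x"
  using cadjoint_cinner[OF assms, of x y] cinner_commute by metis

lemma bounded_clinear_cadjoint:
  assumes T: "bounded_clinear T"
  shows "bounded_clinear (cadjoint T)"
proof -
  obtain K where K: "K > 0" "\<And>x. norm (T x) \<le> K * norm x" using bounded_clinear_bound[OF T] by blast
  note adj = cadjoint_cinner[OF T, symmetric]
  show ?thesis
  proof (rule bounded_clinearI)
    show "cadjoint T (x + y) = cadjoint T x + cadjoint T y" for x y
      by (rule cinner_eqI2) (simp add: cinner_simps adj)
    show "cadjoint T (c *\<^sub>C x) = c *\<^sub>C cadjoint T x" for c x
      by (rule cinner_eqI2) (simp add: cinner_simps adj)
    show "norm (cadjoint T x) \<le> K * norm x" for x
    proof -
      have "(norm (cadjoint T x))\<^sup>2 = cmod (cinner (T (cadjoint T x)) x)"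
        by (simp add: adj[symmetric] cinner_self norm_power)
      also have "\<dots> \<le> norm (T (cadjoint T x)) * norm x" by (rule cinner_cauchy_schwarz)
      also have "\<dots> \<le> K * norm (cadjoint T x) * norm x" by (intro mult_right_mono K) auto
      finally have "norm (cadjoint T x) * norm (cadjoint T x) \<le> norm (cadjoint T x) * (K * norm x)"
        by (simp add: power2_eq_square mult_ac)
      then show ?thesis
        using K by (cases "norm (cadjoint T x) = 0") auto
    qed
  qed
qed

lemma selfadjoint_op_iff:
  "selfadjoint_op T \<longleftrightarrow> bounded_clinear T \<and> (\<forall>x y. cinner (T x) y = cinner x (T y))"
proof
  assume "selfadjoint_op T"
  then have T: "bounded_clinear T" and eq: "cadjoint T = T" by (auto simp: selfadjoint_op_def)
  show "bounded_clinear T \<and> (\<forall>x y. cinner (T x) y = cinner x (T y))"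
    using T cadjoint_cinner[OF T] unfolding eq by blast
next
  assume *: "bounded_clinear T \<and> (\<forall>x y. cinner (T x) y = cinner x (T y))"
  then have "cadjoint T = T" by (intro cadjoint_unique) blast
  with * show "selfadjoint_op T" by (simp add: selfadjoint_op_def)
qed

lemma nonneg_op_iff:
  "nonneg_op T \<longleftrightarrow> bounded_clinear T \<and> (\<forall>x y. cinner (T x) y = cinner x (T y)) \<and>
     (\<forall>x. 0 \<le> Re (cinner (T x) x))"
  unfolding nonneg_op_def selfadjoint_op_iff op_le_def by simp

lemma nonneg_opD:
  assumes "nonneg_op T"
  shows nonneg_op_bounded: "bounded_clinear T"
    and nonneg_op_sym: "cinner (T x) y = cinner x (T y)"
    and nonneg_op_pos: "0 \<le> Re (cinner (T x) x)"
  using assms by (auto simp: nonneg_op_iff)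

lemma nonneg_op_cauchy_schwarz:
  assumes "nonneg_op T"
  shows "(cmod (cinner (T f) g))\<^sup>2 \<le> Re (cinner (T f) f) * Re (cinner (T g) g)"
  by (rule cauchy_schwarz_form[OF nonneg_op_bounded[OF assms] nonneg_op_sym[OF assms] nonneg_op_pos[OF assms]])

text \<open>Cauchy-Schwarz for the form of \<open>T\<close>, with \<open>T x\<close> as second
  vector.\<close>

lemma nonneg_op_zero_form:
  assumes "nonneg_op T" "Re (cinner (T x) x) = 0" shows "T x = 0"
proof -
  have "(cmod (cinner (T x) (T x)))\<^sup>2 \<le> Re (cinner (T x) x) * Re (cinner (T (T x)) (T x))"
    by (rule nonneg_op_cauchy_schwarz[OF assms(1)])
  then show ?thesis using assms by (simp add: cinner_self)
qed

text \<open>Again the form Cauchy-Schwarz inequality with second vector \<open>T x\<close>: the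
  fourth power of \<open>norm (T x)\<close> is at most \<open>c\<^sup>2\<close> times the squares of
  \<open>norm x\<close> and \<open>norm (T x)\<close>. This converts spectral bounds, which are
  bounds on forms, into norm bounds.\<close>

lemma nonneg_op_norm_bound:
  assumes T: "nonneg_op T" and le: "\<And>x. Re (cinner (T x) x) \<le> c * (norm x)\<^sup>2"
  shows "norm (T x) \<le> c * norm x"
proof (cases "T x = 0")
  case True
  have "0 \<le> c * norm x"
  proof (cases "x = 0")
    case False
    have "0 \<le> c * (norm x)\<^sup>2" using le[of x] nonneg_op_pos[OF T, of x] by simp
    then show ?thesis using False by (simp add: zero_le_mult_iff)
  qed simp
  then show ?thesis using True by simp
next
  case False
  have "0 \<le> c * (norm (T x))\<^sup>2"
    using le[of "T x"] nonneg_op_pos[OF T, of "T x"] by (rule order_trans[rotated])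
  then have c: "0 \<le> c" using False by (simp add: zero_le_mult_iff)
  have "((norm (T x))\<^sup>2)\<^sup>2 = (cmod (cinner (T x) (T x)))\<^sup>2"
    by (simp add: cinner_self norm_power)
  also have "\<dots> \<le> Re (cinner (T x) x) * Re (cinner (T (T x)) (T x))"
    by (rule nonneg_op_cauchy_schwarz[OF T])
  also have "\<dots> \<le> (c * (norm x)\<^sup>2) * (c * (norm (T x))\<^sup>2)"
    using c by (intro mult_mono le nonneg_op_pos[OF T]) auto
  also have "\<dots> = (c * norm x * norm (T x))\<^sup>2" by (simp add: power2_eq_square mult_ac)
  finally have "(norm (T x))\<^sup>2 \<le> c * norm x * norm (T x)"
    by (rule power2_le_imp_le) (use c in simp)
  then have "norm (T x) * norm (T x) \<le> (c * norm x) * norm (T x)" by (simp only: power2_eq_square)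
  then show ?thesis using False by (meson mult_right_le_imp_le zero_less_norm_iff)
qed

lemma csubspace_ortho_compl: "csubspace (ortho_compl (M :: 'a::chilbert_space set))"
  by (auto simp: csubspace_def ortho_compl_def cinner_simps)

lemma ortho_compl_disjoint:
  "x \<in> M \<Longrightarrow> x \<in> ortho_compl M \<Longrightarrow> (x::'a::chilbert_space) = 0"
  by (auto simp: ortho_compl_def cinner_self_zero)

lemma projection_ex:
  fixes L :: "'a::chilbert_space set"
  assumes L: "csubspace L" and cl: "closed L"
  shows "\<exists>p\<in>L. x - p \<in> ortho_compl L"
proof -
  have "\<exists>s\<in>closure L. \<forall>v\<in>L. cinner v x = cinner v s"
    by (rule riesz_subspace[OF L, where C = "norm x"]) (simp_all add: cinner_simps cinner_cauchy_schwarz_right)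
  then obtain s where "s \<in> L" "\<forall>v\<in>L. cinner v x = cinner v s" using cl by auto
  then have "x - s \<in> ortho_compl L"
    by (simp add: ortho_compl_def cinner_eq_zero_commute[of "x - s"] cinner_diff_right)
  then show ?thesis using \<open>s \<in> L\<close> by blast
qed

definition orth_proj :: "'a::chilbert_space set \<Rightarrow> 'a \<Rightarrow> 'a" where
  "orth_proj L x = (THE p. p \<in> L \<and> x - p \<in> ortho_compl L)"

context
  fixes L :: "'a::chilbert_space set"
  assumes L: "csubspace L" and cl: "closed L"
begin

lemma orth_proj_eqI: "p \<in> L \<Longrightarrow> x - p \<in> ortho_compl L \<Longrightarrow> orth_proj L x = p"
  unfolding orth_proj_def
proof (rule the_equality)
  fix q assume p: "p \<in> L" "x - p \<in> ortho_compl L" and q: "q \<in> L \<and> x - q \<in> ortho_compl L"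
  have "p - q \<in> L" using p q L by (intro csubspace_diff) auto
  moreover have "(x - q) - (x - p) \<in> ortho_compl L"
    by (rule csubspace_diff[OF csubspace_ortho_compl]) (use p q in auto)
  ultimately show "q = p" using ortho_compl_disjoint[of "p - q" L] by simp
qed auto

lemma orth_proj_in: "orth_proj L x \<in> L"
  and orth_proj_compl: "x - orth_proj L x \<in> ortho_compl L"
  using projection_ex[OF L cl, of x] orth_proj_eqI by force+

lemma orth_proj_fixed: "x \<in> L \<Longrightarrow> orth_proj L x = x"
  by (rule orth_proj_eqI) (auto simp: csubspace_zero[OF csubspace_ortho_compl])

lemma orth_proj_orthogonal: "y \<in> L \<Longrightarrow> cinner (x - orth_proj L x) y = 0"
  using orth_proj_compl[of x] by (auto simp: ortho_compl_def)

text \<open>Symmetry is proved first; additivity and homogeneity then follow by moving the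
  projection to the other argument of the inner product.\<close>

lemma orthogonal_projection_orth_proj: "orthogonal_projection (orth_proj L)"
proof -
  have sym: "cinner (orth_proj L x) y = cinner x (orth_proj L y)" for x y
  proof -
    have "cinner (orth_proj L x) (y - orth_proj L y) = 0"
      by (subst cinner_eq_zero_commute) (rule orth_proj_orthogonal[OF orth_proj_in])
    moreover have "cinner (x - orth_proj L x) (orth_proj L y) = 0"
      by (rule orth_proj_orthogonal[OF orth_proj_in])
    ultimately show ?thesis by (simp add: cinner_simps)
  qed
  have "bounded_clinear (orth_proj L)"
  proof (rule bounded_clinearI)
    show "orth_proj L (x + y) = orth_proj L x + orth_proj L y" for x y
      by (rule cinner_eqI) (simp add: cinner_simps sym)
    show "orth_proj L (c *\<^sub>C x) = c *\<^sub>C orth_proj L x" for c x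
      by (rule cinner_eqI) (simp add: cinner_simps sym)
    show "norm (orth_proj L x) \<le> 1 * norm x" for x
    proof -
      have "(norm x)\<^sup>2 = (norm (x - orth_proj L x + orth_proj L x))\<^sup>2" by simp
      also have "\<dots> = (norm (x - orth_proj L x))\<^sup>2 + (norm (orth_proj L x))\<^sup>2"
        by (subst norm_add_sq) (simp add: orth_proj_orthogonal[OF orth_proj_in])
      finally have "(norm (orth_proj L x))\<^sup>2 \<le> (norm x)\<^sup>2" by simp
      then show ?thesis by (simp add: power2_le_iff_abs_le)
    qed
  qed
  then show ?thesis
    using sym by (auto simp: orthogonal_projection_def selfadjoint_op_iff fun_eq_iff
        orth_proj_fixed orth_proj_in)
qed

end

text \<open>Let \<open>s\<close> in the closure of the range represent the functional of
  \<open>z\<close> there. Then \<open>z - s\<close> is in the kernel, hence orthogonal to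
  \<open>s\<close>, which is a limit of vectors \<open>R x\<close>, and to \<open>z\<close> by
  assumption. So it is orthogonal to itself.\<close>

lemma closure_range_eq_ortho_compl_kernel:
  assumes R: "selfadjoint_op R" and z: "z \<in> ortho_compl (op_kernel R)"
  shows "z \<in> closure (range R)"
proof -
  have R': "bounded_clinear R" and sym: "\<And>x y. cinner (R x) y = cinner x (R y)"
    using R by (auto simp: selfadjoint_op_iff)
  have "\<exists>s\<in>closure (range R). \<forall>v\<in>range R. cinner v z = cinner v s"
    by (rule riesz_subspace[OF csubspace_range[OF R'], where C = "norm z"])
      (simp_all add: cinner_simps cinner_cauchy_schwarz_right)
  then obtain s where s: "s \<in> closure (range R)" and eq: "\<And>x. cinner (R x) z = cinner (R x) s"
    by auto
  have "R z = R s"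
    by (rule cinner_eqI2) (simp add: sym[symmetric] eq)
  then have k: "z - s \<in> op_kernel R" using R' by (simp add: op_kernel_def bounded_clinear_imp)
  have "R (z - s) = 0" using k by (simp add: op_kernel_def)
  obtain x where x: "(\<lambda>n. R (x n)) \<longlonglongrightarrow> s"
  proof -
    obtain w where "\<forall>n. w n \<in> range R" and w: "w \<longlonglongrightarrow> s"
      using s unfolding closure_sequential by blast
    then have "\<forall>n. \<exists>x. w n = R x" by blast
    then obtain x where "\<forall>n. w n = R (x n)" by metis
    then show thesis using w by (intro that[of x]) (simp flip: fun_eq_iff)
  qed
  have "(\<lambda>n. cinner (R (x n)) (z - s)) \<longlonglongrightarrow> cinner s (z - s)"
    by (intro tendsto_cinner x tendsto_const)
  moreover have "cinner (R (x n)) (z - s) = 0" for n using sym \<open>R (z - s) = 0\<close> by simp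
  ultimately have "cinner s (z - s) = 0" by (simp add: LIMSEQ_const_iff)
  moreover have "cinner z (z - s) = 0" using z k by (simp add: ortho_compl_def)
  ultimately have "cinner (z - s) (z - s) = 0" by (simp add: cinner_diff_left)
  then have "z = s" by (simp add: cinner_self_zero)
  then show ?thesis using s by simp
qed

text \<open>The bound makes the functional sending \<open>R x\<close> to \<open>cinner x b\<close>
  well defined and continuous on the range; a Riesz representative \<open>s\<close> of it satisfies
  \<open>R s = b\<close>. In the definition of \<open>\<phi>\<close>, \<open>inv R\<close> picks
  some preimage, and the bound kills the difference of two preimages.\<close>

lemma range_if_form_bounded:
  assumes R: "selfadjoint_op R" and bound: "\<And>x. cmod (cinner x b) \<le> C * norm (R x)"
  shows "b \<in> range R"
proof -
  have R': "bounded_clinear R" and sym: "\<And>x y. cinner (R x) y = cinner x (R y)"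
    using R by (auto simp: selfadjoint_op_iff)
  define \<phi> where "\<phi> v = cinner (inv R v) b" for v
  have \<phi>R: "\<phi> (R x) = cinner x b" for x
  proof -
    have "R (inv R (R x)) = R x" by (simp add: f_inv_into_f)
    then have "norm (R (inv R (R x) - x)) = 0" using R' by (simp add: bounded_clinear_imp)
    then have "cmod (cinner (inv R (R x) - x) b) \<le> 0" using bound by (metis mult_zero_right)
    then show ?thesis by (simp add: \<phi>_def cinner_diff_left)
  qed
  have "\<exists>s\<in>closure (range R). \<forall>v\<in>range R. \<phi> v = cinner v s"
  proof (rule riesz_subspace[OF csubspace_range[OF R'], where C = C])
    show "\<phi> (u + v) = \<phi> u + \<phi> v" if "u \<in> range R" "v \<in> range R" for u v
      using that by (auto simp flip: bounded_clinear_add[OF R'] simp: \<phi>R cinner_simps)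
    show "\<phi> (c *\<^sub>C v) = c * \<phi> v" if "v \<in> range R" for c v
      using that by (auto simp flip: bounded_clinear_scaleC[OF R'] simp: \<phi>R cinner_simps)
  qed (use bound \<phi>R in auto)
  then obtain s where "\<And>x. cinner x b = cinner (R x) s" using \<phi>R by auto
  then have "b = R s" by (intro cinner_eqI2) (simp add: sym)
  then show ?thesis by blast
qed

subsection \<open>Square roots of nonnegative operators\<close>

text \<open>For \<open>A = I - P\<close> a limit \<open>Y\<close> of this iteration satisfies
  \<open>2 Y = A + Y\<^sup>2\<close>, that is \<open>(I - Y)\<^sup>2 = P\<close>. Each iterate is a
  polynomial in \<open>A\<close>, so it is symmetric and commutes with everything that commutes with
  \<open>P\<close>.\<close>

primrec sqrt_iter :: "('a::chilbert_space \<Rightarrow> 'a) \<Rightarrow> nat \<Rightarrow> 'a \<Rightarrow> 'a" where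
  "sqrt_iter A 0 = (\<lambda>x. 0)"
| "sqrt_iter A (Suc n) = (\<lambda>x. (1/2) *\<^sub>R (A x + sqrt_iter A n (sqrt_iter A n x)))"

primrec sqrt_iter_bound :: "nat \<Rightarrow> real" where
  "sqrt_iter_bound 0 = 0"
| "sqrt_iter_bound (Suc n) = (1 + (sqrt_iter_bound n)\<^sup>2) / 2"

lemma sqrt_iter_bound_range: "0 \<le> sqrt_iter_bound n" "sqrt_iter_bound n \<le> 1"
  by (induction n) (auto simp: power_le_one)

lemma sqrt_iter_bound_mono: "sqrt_iter_bound n \<le> sqrt_iter_bound (Suc n)"
proof -
  have "0 \<le> (1 - sqrt_iter_bound n)\<^sup>2" by simp
  then show ?thesis by (simp add: power2_eq_square algebra_simps)
qed

lemma convergent_sqrt_iter_bound: "convergent sqrt_iter_bound"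
proof (rule Bseq_mono_convergent)
  show "Bseq sqrt_iter_bound"
    using sqrt_iter_bound_range by (intro BseqI'[of _ 1]) auto
  show "\<forall>m n. m \<le> n \<longrightarrow> sqrt_iter_bound m \<le> sqrt_iter_bound n"
    using lift_Suc_mono_le[of sqrt_iter_bound] sqrt_iter_bound_mono by blast
qed

lemma bounded_clinear_sqrt_iter:
  assumes "bounded_clinear A" shows "bounded_clinear (sqrt_iter A n)"
proof (induction n)
  case (Suc n)
  show ?case unfolding sqrt_iter.simps
    by (rule bounded_clinear_scaleR_fun[OF bounded_clinear_add_fun[OF assms bounded_clinear_comp[OF Suc Suc]]])
qed simp

lemma sqrt_iter_sym:
  assumes "\<And>x y. cinner (A x) y = cinner x (A y)"
  shows "cinner (sqrt_iter A n x) y = cinner x (sqrt_iter A n y)"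
  by (induction n arbitrary: x y) (simp_all add: cinner_simps assms)

lemma sqrt_iter_commute:
  assumes "bounded_clinear B" "\<And>x. B (A x) = A (B x)"
  shows "B (sqrt_iter A n x) = sqrt_iter A n (B x)"
  by (induction n arbitrary: x) (simp_all add: assms bounded_clinear_imp[OF assms(1)])

lemma sqrt_iter_norm:
  assumes A: "\<And>x. norm (A x) \<le> norm x"
  shows "norm (sqrt_iter A n x) \<le> sqrt_iter_bound n * norm x"
proof (induction n arbitrary: x)
  case (Suc n)
  have "norm (sqrt_iter A n (sqrt_iter A n x)) \<le> sqrt_iter_bound n * (sqrt_iter_bound n * norm x)"
    by (rule order_trans[OF Suc mult_left_mono[OF Suc]]) (rule sqrt_iter_bound_range)
  then have "norm (A x + sqrt_iter A n (sqrt_iter A n x)) \<le> norm x + (sqrt_iter_bound n)\<^sup>2 * norm x"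
    using norm_triangle_ineq[of "A x" "sqrt_iter A n (sqrt_iter A n x)"] A[of x]
    by (simp add: power2_eq_square mult_ac)
  moreover have "norm (sqrt_iter A (Suc n) x) = norm (A x + sqrt_iter A n (sqrt_iter A n x)) / 2"
    by (simp only: sqrt_iter.simps norm_scaleR)
  ultimately show ?case by (simp add: algebra_simps)
qed simp

text \<open>The operator increments are dominated by those of the scalar iteration started at the norm
  bound \<open>1\<close>, so the iteration converges in operator norm.\<close>

lemma sqrt_iter_step:
  assumes bl: "bounded_clinear A" and A: "\<And>x. norm (A x) \<le> norm x"
  shows "norm (sqrt_iter A (Suc n) x - sqrt_iter A n x) \<le>
    (sqrt_iter_bound (Suc n) - sqrt_iter_bound n) * norm x"
proof (induction n arbitrary: x)
  case 0
  then show ?case using A[of x] by simp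
next
  case (Suc n)
  define Y Z where "Y = sqrt_iter A (Suc n)" and "Z = sqrt_iter A n"
  have alg: "1/2 * (b * ((b - c) * N) + (b - c) * (c * N)) = (b\<^sup>2 / 2 - c\<^sup>2 / 2) * N" for b c N :: real
    by (simp add: power2_eq_square field_simps)
  let ?b = "sqrt_iter_bound (Suc n)" and ?c = "sqrt_iter_bound n"
  have Y: "bounded_clinear Y" unfolding Y_def by (rule bounded_clinear_sqrt_iter[OF bl])
  have Yx: "Y x = (1/2) *\<^sub>R (A x + Z (Z x))" by (simp only: Y_def Z_def sqrt_iter.simps)
  have "sqrt_iter A (Suc (Suc n)) x - Y x = (1/2) *\<^sub>R (A x + Y (Y x)) - Y x"
    by (simp only: Y_def sqrt_iter.simps(2)[of A "Suc n"])
  also have "\<dots> = (1/2) *\<^sub>R (A x + Y (Y x)) - (1/2) *\<^sub>R (A x + Z (Z x))"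
    by (rule arg_cong[OF Yx])
  \<comment> \<open>\<open>Y Y - Z Z = Y (Y - Z) + (Y - Z) Z\<close>: the induction hypothesis is
    used at \<open>x\<close> in the first term and at \<open>Z x\<close> in the second.\<close>
  also have "\<dots> = (1/2) *\<^sub>R (Y (Y x - Z x) + (Y (Z x) - Z (Z x)))"
    unfolding bounded_clinear_diff[OF Y] scaleR_diff_right[symmetric] by simp
  also have "norm \<dots> \<le> 1/2 * (norm (Y (Y x - Z x)) + norm (Y (Z x) - Z (Z x)))"
    unfolding norm_scaleR by (simp add: norm_triangle_ineq)
  also have "\<dots> \<le> 1/2 * (?b * ((?b - ?c) * norm x) + (?b - ?c) * (?c * norm x))"
  proof (intro mult_left_mono add_mono)
    show "norm (Y (Y x - Z x)) \<le> ?b * ((?b - ?c) * norm x)"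
      unfolding Y_def Z_def
      by (rule order_trans[OF sqrt_iter_norm[OF A] mult_left_mono[OF Suc]]) (rule sqrt_iter_bound_range)
    show "norm (Y (Z x) - Z (Z x)) \<le> (?b - ?c) * (?c * norm x)"
      unfolding Y_def Z_def
      by (rule order_trans[OF Suc mult_left_mono[OF sqrt_iter_norm[OF A]]])
        (use sqrt_iter_bound_mono[of n] in simp)
  qed simp
  also have "\<dots> = (?b\<^sup>2 / 2 - ?c\<^sup>2 / 2) * norm x"
    by (rule alg)
  also have "?b\<^sup>2 / 2 - ?c\<^sup>2 / 2 = sqrt_iter_bound (Suc (Suc n)) - ?b"
    by (simp add: add_divide_distrib)
  finally show ?case by (simp only: Y_def)
qed

lemma sqrt_iter_diff:
  assumes bl: "bounded_clinear A" and A: "\<And>x. norm (A x) \<le> norm x" and "m \<le> n"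
  shows "norm (sqrt_iter A n x - sqrt_iter A m x) \<le> (sqrt_iter_bound n - sqrt_iter_bound m) * norm x"
  using \<open>m \<le> n\<close>
proof (induction n rule: dec_induct)
  case (step n)
  have "norm (sqrt_iter A (Suc n) x - sqrt_iter A m x) \<le>
      norm (sqrt_iter A (Suc n) x - sqrt_iter A n x) + norm (sqrt_iter A n x - sqrt_iter A m x)"
    by (rule order_trans[OF _ norm_triangle_ineq]) simp
  also have "\<dots> \<le> (sqrt_iter_bound (Suc n) - sqrt_iter_bound n) * norm x +
      (sqrt_iter_bound n - sqrt_iter_bound m) * norm x"
    by (intro add_mono sqrt_iter_step[OF bl A] step.IH)
  finally show ?case by (simp only: algebra_simps)
qed simp

lemma sqrt_iter_convergent:
  assumes bl: "bounded_clinear A" and A: "\<And>x. norm (A x) \<le> norm x"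
  shows "convergent (\<lambda>n. sqrt_iter A n x)"
proof -
  have "Cauchy (\<lambda>n. sqrt_iter A n x)"
  proof (rule metric_CauchyI)
    fix e :: real assume e: "e > 0"
    have "Cauchy sqrt_iter_bound" using convergent_sqrt_iter_bound by (simp add: Cauchy_convergent_iff)
    then obtain N where N: "\<And>i j. i \<ge> N \<Longrightarrow> j \<ge> N \<Longrightarrow>
        dist (sqrt_iter_bound i) (sqrt_iter_bound j) < e / (norm x + 1)"
      using e by (meson metric_CauchyD add_nonneg_pos divide_pos_pos norm_ge_zero zero_less_one)
    have *: "dist (sqrt_iter A i x) (sqrt_iter A j x) < e" if "N \<le> j" "j \<le> i" for i j
    proof -
      have "dist (sqrt_iter A i x) (sqrt_iter A j x) \<le> (sqrt_iter_bound i - sqrt_iter_bound j) * norm x"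
        unfolding dist_norm by (rule sqrt_iter_diff[OF bl A that(2)])
      also have "\<dots> \<le> e / (norm x + 1) * norm x"
        using N[of i j] that by (intro mult_right_mono) (auto simp: dist_real_def)
      also have "\<dots> < e"
      proof -
        have "norm x + 1 > 0" by (simp add: add_nonneg_pos)
        then show ?thesis using e by (simp add: field_simps)
      qed
      finally show ?thesis .
    qed
    show "\<exists>M. \<forall>m\<ge>M. \<forall>n\<ge>M. dist (sqrt_iter A m x) (sqrt_iter A n x) < e"
    proof (intro exI[of _ N] allI impI)
      fix m n assume "N \<le> m" "N \<le> n"
      then show "dist (sqrt_iter A m x) (sqrt_iter A n x) < e"
        using *[of m n] *[of n m] by (cases "m \<le> n") (auto simp: dist_commute)
    qed
  qed
  then show ?thesis by (rule Cauchy_convergent)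
qed

text \<open>The root is \<open>I - Y\<close> with \<open>Y\<close> the limit of the iteration for
  \<open>I - P\<close>. The commutation clause is carried along because uniqueness of the root
  depends on it, as does the commutation of spectral projections later.\<close>

lemma contraction_sqrt_ex:
  assumes P: "nonneg_op P" and P1: "\<And>x. Re (cinner (P x) x) \<le> (norm x)\<^sup>2"
  shows "\<exists>Q. nonneg_op Q \<and> (\<forall>x. Q (Q x) = P x) \<and>
    (\<forall>B. bounded_clinear B \<longrightarrow> (\<forall>x. B (P x) = P (B x)) \<longrightarrow> (\<forall>x. B (Q x) = Q (B x)))"
proof -
  define A where "A x = x - P x" for x
  have Anon: "nonneg_op A"
    unfolding nonneg_op_iff A_def
    using nonneg_op_bounded[OF P] nonneg_op_sym[OF P] P1
    by (auto intro: bounded_clinear_diff_fun simp: cinner_simps Re_cinner_self)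
  note bl = nonneg_op_bounded[OF Anon]
  have A1: "norm (A x) \<le> norm x" for x
    using nonneg_op_norm_bound[OF Anon, of 1 x] nonneg_op_pos[OF P]
    by (simp add: A_def cinner_simps Re_cinner_self)
  define Y where "Y x = lim (\<lambda>n. sqrt_iter A n x)" for x
  have Y: "(\<lambda>n. sqrt_iter A n x) \<longlonglongrightarrow> Y x" for x
    unfolding Y_def using sqrt_iter_convergent[OF bl A1] by (simp add: convergent_LIMSEQ_iff)
  note it = bounded_clinear_sqrt_iter[OF bl]
  have Y1: "norm (Y x) \<le> 1 * norm x" for x
  proof (rule LIMSEQ_le_const2[OF tendsto_norm[OF Y]])
    have "norm (sqrt_iter A n x) \<le> 1 * norm x" for n
      by (rule order_trans[OF sqrt_iter_norm[OF A1]]) (intro mult_right_mono sqrt_iter_bound_range, simp)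
    then show "\<exists>N. \<forall>n\<ge>N. norm (sqrt_iter A n x) \<le> 1 * norm x" by blast
  qed
  have Ybl: "bounded_clinear Y"
  proof (rule bounded_clinearI[OF _ _ Y1])
    show "Y (x + y) = Y x + Y y" for x y
      using LIMSEQ_unique[OF Y[of "x + y"]] tendsto_add[OF Y[of x] Y[of y]]
      by (simp add: bounded_clinear_add[OF it])
    show "Y (c *\<^sub>C x) = c *\<^sub>C Y x" for c x
      using LIMSEQ_unique[OF Y[of "c *\<^sub>C x"]] bounded_clinear_tendsto[OF bounded_clinear_scaleC_map[of c] Y[of x]]
      by (simp add: bounded_clinear_scaleC[OF it])
  qed
  have Ysym: "cinner (Y x) y = cinner x (Y y)" for x y
  proof -
    have "(\<lambda>n. cinner (sqrt_iter A n x) y) \<longlonglongrightarrow> cinner (Y x) y"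
      by (intro tendsto_cinner Y tendsto_const)
    moreover have "(\<lambda>n. cinner x (sqrt_iter A n y)) \<longlonglongrightarrow> cinner x (Y y)"
      by (intro tendsto_cinner Y tendsto_const)
    moreover have "cinner (sqrt_iter A n x) y = cinner x (sqrt_iter A n y)" for n
      by (rule sqrt_iter_sym) (rule nonneg_op_sym[OF Anon])
    ultimately show ?thesis by (simp add: LIMSEQ_unique)
  qed
  have YY: "(\<lambda>n. sqrt_iter A n (sqrt_iter A n x)) \<longlonglongrightarrow> Y (Y x)" for x
  proof -
    \<comment> \<open>Pointwise limits do not compose by themselves; here all iterates are
      contractions, so replacing the inner iterate by \<open>Y x\<close> costs at most
      \<open>norm (sqrt_iter A n x - Y x)\<close>.\<close>
    have "(\<lambda>n. sqrt_iter A n (sqrt_iter A n x - Y x)) \<longlonglongrightarrow> 0"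
    proof (rule Lim_null_comparison)
      show "\<forall>\<^sub>F n in sequentially. norm (sqrt_iter A n (sqrt_iter A n x - Y x)) \<le> norm (sqrt_iter A n x - Y x)"
      proof (intro always_eventually allI)
        fix n
        show "norm (sqrt_iter A n (sqrt_iter A n x - Y x)) \<le> norm (sqrt_iter A n x - Y x)"
          using order_trans[OF sqrt_iter_norm[OF A1] mult_right_mono[OF sqrt_iter_bound_range(2)]]
          by simp
      qed
      show "(\<lambda>n. norm (sqrt_iter A n x - Y x)) \<longlonglongrightarrow> 0"
        using Y[of x] by (simp add: LIM_zero tendsto_norm_zero)
    qed
    from tendsto_add[OF this Y[of "Y x"]] show ?thesis
      by (simp add: bounded_clinear_diff[OF it])
  qed
  have Yeq: "2 *\<^sub>R Y x = A x + Y (Y x)" for x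
  proof -
    have "(\<lambda>n. (1/2) *\<^sub>R (A x + sqrt_iter A n (sqrt_iter A n x))) \<longlonglongrightarrow> (1/2) *\<^sub>R (A x + Y (Y x))"
      by (intro tendsto_intros YY)
    moreover have "(\<lambda>n. (1/2) *\<^sub>R (A x + sqrt_iter A n (sqrt_iter A n x))) \<longlonglongrightarrow> Y x"
      using LIMSEQ_Suc[OF Y[of x]] by simp
    ultimately have "Y x = (1/2) *\<^sub>R (A x + Y (Y x))" by (rule LIMSEQ_unique[rotated])
    then have "2 *\<^sub>R Y x = 2 *\<^sub>R ((1/2) *\<^sub>R (A x + Y (Y x)))" by (rule arg_cong)
    also have "\<dots> = A x + Y (Y x)" by (simp only: scaleR_scaleR) simp
    finally show ?thesis .
  qed
  define Q where "Q x = x - Y x" for x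
  have "nonneg_op Q"
    unfolding nonneg_op_iff
  proof (intro conjI allI)
    show "bounded_clinear Q" unfolding Q_def by (intro bounded_clinear_diff_fun Ybl) simp
    show "cinner (Q x) y = cinner x (Q y)" for x y by (simp add: Q_def cinner_simps Ysym)
    show "0 \<le> Re (cinner (Q x) x)" for x
    proof -
      have "Re (cinner (Y x) x) \<le> cmod (cinner (Y x) x)" by (rule complex_Re_le_cmod)
      also have "\<dots> \<le> norm (Y x) * norm x" by (rule cinner_cauchy_schwarz)
      also have "\<dots> \<le> norm x * norm x" using Y1[of x] by (intro mult_right_mono) auto
      finally show ?thesis by (simp add: Q_def cinner_simps Re_cinner_self power2_eq_square)
    qed
  qed
  moreover have "Q (Q x) = P x" for x
  proof -
    have "Q (Q x) = x - 2 *\<^sub>R Y x + Y (Y x)"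
      by (simp add: Q_def bounded_clinear_diff[OF Ybl] scaleR_2)
    also have "\<dots> = P x" by (simp add: Yeq A_def)
    finally show ?thesis .
  qed
  moreover have "B (Q x) = Q (B x)" if B: "bounded_clinear B" and BP: "\<forall>x. B (P x) = P (B x)" for B x
  proof -
    have "B (A x) = A (B x)" for x using B BP by (simp add: A_def bounded_clinear_diff)
    then have "B (sqrt_iter A n x) = sqrt_iter A n (B x)" for n
      by (rule sqrt_iter_commute[OF B])
    then have "B (Y x) = Y (B x)"
      using LIMSEQ_unique[OF bounded_clinear_tendsto[OF B Y[of x]]] Y[of "B x"] by simp
    then show ?thesis using B by (simp add: Q_def bounded_clinear_diff)
  qed
  ultimately show ?thesis by blast
qed

lemma nonneg_sqrt_ex:
  assumes P: "nonneg_op P"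
  shows "\<exists>Q. nonneg_op Q \<and> (\<forall>x. Q (Q x) = P x) \<and>
    (\<forall>B. bounded_clinear B \<longrightarrow> (\<forall>x. B (P x) = P (B x)) \<longrightarrow> (\<forall>x. B (Q x) = Q (B x)))"
proof -
  note bl = nonneg_op_bounded[OF P]
  obtain K where K: "K > 0" "\<And>x. norm (P x) \<le> K * norm x" using bounded_clinear_bound[OF bl] by blast
  define P' where "P' x = (1 / K) *\<^sub>R P x" for x
  have "nonneg_op P'"
    unfolding nonneg_op_iff P'_def using K bl nonneg_op_sym[OF P] nonneg_op_pos[OF P]
    by (auto intro: bounded_clinear_scaleR_fun simp: cinner_simps)
  moreover have "Re (cinner (P' x) x) \<le> (norm x)\<^sup>2" for x
  proof -
    have "Re (cinner (P x) x) \<le> norm (P x) * norm x"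
      using complex_Re_le_cmod cinner_cauchy_schwarz order_trans by blast
    also have "\<dots> \<le> K * norm x * norm x" by (intro mult_right_mono K) simp
    finally show ?thesis using K by (simp add: P'_def cinner_simps field_simps power2_eq_square)
  qed
  ultimately obtain Q where Q: "nonneg_op Q" "\<And>x. Q (Q x) = P' x"
    and comm: "\<And>B. bounded_clinear B \<Longrightarrow> (\<forall>x. B (P' x) = P' (B x)) \<Longrightarrow> (\<forall>x. B (Q x) = Q (B x))"
    using contraction_sqrt_ex[of P'] by blast
  note Qbl = nonneg_op_bounded[OF Q(1)]
  show ?thesis
  proof (intro exI[of _ "\<lambda>x. sqrt K *\<^sub>R Q x"] conjI allI impI)
    show "nonneg_op (\<lambda>x. sqrt K *\<^sub>R Q x)"
      unfolding nonneg_op_iff using K Qbl nonneg_op_sym[OF Q(1)] nonneg_op_pos[OF Q(1)]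
      by (auto intro: bounded_clinear_scaleR_fun simp: cinner_simps)
    show "sqrt K *\<^sub>R Q (sqrt K *\<^sub>R Q x) = P x" for x
      using K by (simp add: bounded_clinear_scaleR[OF Qbl] Q P'_def)
    fix B x assume B: "bounded_clinear B" "\<forall>x. B (P x) = P (B x)"
    then have "B (Q x) = Q (B x)"
      using comm[of B] by (simp add: P'_def bounded_clinear_scaleR)
    then show "B (sqrt K *\<^sub>R Q x) = sqrt K *\<^sub>R Q (B x)" using B by (simp add: bounded_clinear_scaleR)
  qed
qed

text \<open>For \<open>g = Q x - R x\<close> commutation gives \<open>(Q + R) g = 0\<close>. Both
  forms are nonnegative, so both vanish at \<open>g\<close>, hence \<open>Q g = R g = 0\<close>, and
  symmetry yields \<open>cinner g g = 0\<close>.\<close>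

lemma nonneg_sqrt_unique:
  assumes Q: "nonneg_op Q" and R: "nonneg_op R" and QR: "\<And>x. Q (Q x) = R (R x)"
    and comm: "\<And>x. Q (R x) = R (Q x)"
  shows "Q x = R x"
proof -
  note Qb = nonneg_op_bounded[OF Q] and Rb = nonneg_op_bounded[OF R]
  define g where "g = Q x - R x"
  have "Q g + R g = 0"
    by (simp add: g_def bounded_clinear_diff[OF Qb] bounded_clinear_diff[OF Rb] QR comm)
  then have "Re (cinner (Q g) g) + Re (cinner (R g) g) = 0"
    by (metis cinner_add_left cinner_zero_left plus_complex.sel(1) zero_complex.sel(1))
  then have "Re (cinner (Q g) g) = 0" "Re (cinner (R g) g) = 0"
    using nonneg_op_pos[OF Q, of g] nonneg_op_pos[OF R, of g] by auto
  then have "Q g = 0" "R g = 0" using nonneg_op_zero_form Q R by blast+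
  then have "cinner (Q x - R x) g = 0"
    by (simp add: cinner_diff_left nonneg_op_sym[OF Q] nonneg_op_sym[OF R])
  then show ?thesis by (simp add: g_def cinner_self_zero)
qed

text \<open>Any root \<open>Q\<close> commutes with its square \<open>P\<close>, hence with the
  constructed root; thus the uniqueness lemma for commuting roots applies to it.\<close>

lemma op_sqrt_ex1:
  assumes P: "nonneg_op P"
  shows "\<exists>!Q. nonneg_op Q \<and> Q \<circ> Q = P"
proof -
  obtain R where R: "nonneg_op R" "\<And>x. R (R x) = P x"
    and comm: "\<And>B x. bounded_clinear B \<Longrightarrow> \<forall>x. B (P x) = P (B x) \<Longrightarrow> B (R x) = R (B x)"
    using nonneg_sqrt_ex[OF P] by blast
  show ?thesis
  proof (rule ex1I[of _ R])
    fix Q assume Q: "nonneg_op Q \<and> Q \<circ> Q = P"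
    then have QQ: "Q (Q x) = P x" for x by (metis comp_apply)
    have Qn: "nonneg_op Q" using Q ..
    have "Q (R x) = R (Q x)" for x
      by (rule comm[OF nonneg_op_bounded[OF Qn]]) (simp flip: QQ)
    then show "Q = R" by (intro ext nonneg_sqrt_unique[OF Qn R(1)]) (simp_all only: QQ R(2))
  qed (use R in auto)
qed

lemma op_sqrt_eqI: "nonneg_op Q \<Longrightarrow> (\<And>x. Q (Q x) = P x) \<Longrightarrow> nonneg_op P \<Longrightarrow> op_sqrt P = Q"
  unfolding op_sqrt_def by (intro the1_equality op_sqrt_ex1) auto

lemma
  assumes "nonneg_op P"
  shows nonneg_op_sqrt: "nonneg_op (op_sqrt P)" and op_sqrt_square: "op_sqrt P (op_sqrt P x) = P x"
proof -
  have "nonneg_op (op_sqrt P) \<and> op_sqrt P \<circ> op_sqrt P = P"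
    unfolding op_sqrt_def by (rule theI'[OF op_sqrt_ex1[OF assms]])
  then show "nonneg_op (op_sqrt P)" "op_sqrt P (op_sqrt P x) = P x" by (auto simp: fun_eq_iff)
qed

lemma op_sqrt_commute:
  assumes P: "nonneg_op P" and B: "bounded_clinear B" "\<And>x. B (P x) = P (B x)"
  shows "B (op_sqrt P x) = op_sqrt P (B x)"
proof -
  obtain R where R: "nonneg_op R" "\<And>x. R (R x) = P x"
    and comm: "\<And>B x. bounded_clinear B \<Longrightarrow> \<forall>x. B (P x) = P (B x) \<Longrightarrow> B (R x) = R (B x)"
    using nonneg_sqrt_ex[OF P] by blast
  have "op_sqrt P = R" using R P by (intro op_sqrt_eqI)
  then show ?thesis using comm B by blast
qed

lemma nonneg_op_square:
  assumes "selfadjoint_op X" shows "nonneg_op (X \<circ> X)"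
proof -
  have X: "bounded_clinear X" and sym: "\<And>x y. cinner (X x) y = cinner x (X y)"
    using assms by (auto simp: selfadjoint_op_iff)
  have "0 \<le> Re (cinner (X (X x)) x)" for x
    by (subst sym) (simp add: Re_cinner_self)
  then show ?thesis
    unfolding nonneg_op_iff comp_def using X by (simp add: bounded_clinear_comp sym)
qed

lemma
  assumes X: "selfadjoint_op X"
  shows nonneg_abs_op: "nonneg_op (abs_op X)"
    and abs_op_square: "abs_op X (abs_op X x) = X (X x)"
    and abs_op_commute: "bounded_clinear B \<Longrightarrow> (\<And>x. B (X x) = X (B x)) \<Longrightarrow> B (abs_op X x) = abs_op X (B x)"
    and abs_op_eqI: "nonneg_op Q \<Longrightarrow> (\<And>x. Q (Q x) = X (X x)) \<Longrightarrow> abs_op X = Q"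
  unfolding abs_op_def
  using nonneg_op_sqrt[OF nonneg_op_square[OF X]] op_sqrt_square[OF nonneg_op_square[OF X]]
    op_sqrt_commute[OF nonneg_op_square[OF X]] op_sqrt_eqI[of Q "X \<circ> X"] nonneg_op_square[OF X]
  by auto

subsection \<open>Spectral projections\<close>

lemma orthogonal_projectionD:
  assumes "orthogonal_projection P"
  shows orthogonal_projection_bounded: "bounded_clinear P"
    and orthogonal_projection_sym: "cinner (P x) y = cinner x (P y)"
    and orthogonal_projection_idem: "P (P x) = P x"
  using assms by (auto simp: orthogonal_projection_def selfadjoint_op_iff fun_eq_iff)

lemma orthogonal_projection_selfadjoint: "orthogonal_projection P \<Longrightarrow> selfadjoint_op P"
  by (simp add: orthogonal_projection_def)

lemma orthogonal_projection_cinner: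
  assumes "orthogonal_projection P" shows "cinner (P x) x = of_real ((norm (P x))\<^sup>2)"
  by (metis assms cinner_self orthogonal_projection_idem orthogonal_projection_sym)

lemma orthogonal_projection_norm_split:
  assumes P: "orthogonal_projection P"
  shows "(norm x)\<^sup>2 = (norm (P x))\<^sup>2 + (norm (x - P x))\<^sup>2"
  using norm_diff_sq[of x "P x"] Re_cinner_commute[of x "P x"]
  by (simp add: orthogonal_projection_cinner[OF P])

lemma orthogonal_projection_norm_le:
  assumes P: "orthogonal_projection P" shows "norm (P x) \<le> norm x"
  using orthogonal_projection_norm_split[OF P, of x] by (simp add: power2_le_imp_le)

text \<open>The form inequality is tested at \<open>x - Q x\<close>, which \<open>Q\<close>
  annihilates.\<close>

lemma orthogonal_projection_le_imp:
  assumes P: "orthogonal_projection P" and Q: "orthogonal_projection Q" and le: "op_le P Q"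
  shows "P (Q x) = P x" and "Q (P x) = P x"
proof -
  have PQ: "P (Q x) = P x" for x
  proof -
    have "Q (x - Q x) = 0"
      by (simp add: bounded_clinear_diff[OF orthogonal_projection_bounded[OF Q]] orthogonal_projection_idem[OF Q])
    then have "(norm (P (x - Q x)))\<^sup>2 \<le> 0"
      using le[unfolded op_le_def, rule_format, of "x - Q x"] by (simp add: orthogonal_projection_cinner P)
    then show ?thesis by (simp add: bounded_clinear_diff[OF orthogonal_projection_bounded[OF P]])
  qed
  then show "P (Q x) = P x" .
  show "Q (P x) = P x"
    by (rule cinner_eqI) (simp add: orthogonal_projection_sym[OF P] orthogonal_projection_sym[OF Q] PQ)
qed

lemma orthogonal_projection_leI:
  assumes P: "orthogonal_projection P" and Q: "orthogonal_projection Q" and QP: "\<And>x. Q (P x) = P x"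
  shows "op_le P Q"
  unfolding op_le_def
proof
  fix x
  have "P (Q x) = P x"
    by (rule cinner_eqI) (simp add: orthogonal_projection_sym[OF P] orthogonal_projection_sym[OF Q] QP)
  then have "norm (P x) \<le> norm (Q x)" by (metis orthogonal_projection_norm_le[OF P])
  then show "Re (cinner (P x) x) \<le> Re (cinner (Q x) x)"
    by (simp add: orthogonal_projection_cinner P Q)
qed

lemma selfadjoint_form_real:
  assumes "selfadjoint_op X" shows "cinner (X x) x = of_real (Re (cinner (X x) x))"
  using assms cinner_commute[of "X x" x] by (simp add: selfadjoint_op_iff complex_eq_iff)

text \<open>The kernel of twice the positive part of \<open>X - t\<close>: the range of the spectral
  projection for the half-line up to and including \<open>t\<close>, which matches right
  continuity.\<close>

definition spectral_subspace :: "('a::chilbert_space \<Rightarrow> 'a) \<Rightarrow> real \<Rightarrow> 'a set" where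
  "spectral_subspace X t = op_kernel (\<lambda>x. abs_op (\<lambda>x. X x - t *\<^sub>R x) x + (X x - t *\<^sub>R x))"

definition spectral_proj :: "('a::chilbert_space \<Rightarrow> 'a) \<Rightarrow> real \<Rightarrow> 'a \<Rightarrow> 'a" where
  "spectral_proj X t = orth_proj (spectral_subspace X t)"

context
  fixes X :: "'a::chilbert_space \<Rightarrow> 'a"
  assumes X: "selfadjoint_op X"
begin

lemma selfadjoint_shift: "selfadjoint_op (\<lambda>x. X x - t *\<^sub>R x)"
  using X by (auto simp: selfadjoint_op_iff cinner_simps
      intro!: bounded_clinear_diff_fun bounded_clinear_scaleR_fun)

lemma spectral_subspace_op: "bounded_clinear (\<lambda>x. abs_op (\<lambda>x. X x - t *\<^sub>R x) x + (X x - t *\<^sub>R x))"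
  using nonneg_op_bounded[OF nonneg_abs_op[OF selfadjoint_shift[of t]]] selfadjoint_shift[of t]
  by (auto simp: selfadjoint_op_iff intro: bounded_clinear_add_fun)

lemma csubspace_spectral_subspace: "csubspace (spectral_subspace X t)"
  unfolding spectral_subspace_def by (rule csubspace_kernel[OF spectral_subspace_op])

lemma closed_spectral_subspace: "closed (spectral_subspace X t)"
  unfolding spectral_subspace_def by (rule closed_kernel[OF spectral_subspace_op])

lemma spectral_subspace_invariant:
  assumes B: "bounded_clinear B" "\<And>x. B (X x) = X (B x)" and x: "x \<in> spectral_subspace X t"
  shows "B x \<in> spectral_subspace X t"
proof -
  define Z where "Z = (\<lambda>x. X x - t *\<^sub>R x)"
  have BZ: "B (Z y) = Z (B y)" for y
    by (simp add: Z_def bounded_clinear_imp[OF B(1)] B(2))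
  have "abs_op Z (B x) + Z (B x) = B (abs_op Z x + Z x)"
    unfolding bounded_clinear_add[OF B(1)] BZ
    by (subst abs_op_commute[OF selfadjoint_shift[of t, folded Z_def] B(1) BZ]) (rule refl)
  also have "\<dots> = B 0"
  proof -
    have "abs_op Z x + Z x = 0" using x by (simp add: spectral_subspace_def op_kernel_def Z_def)
    then show ?thesis by (rule arg_cong)
  qed
  also have "\<dots> = 0" by (rule bounded_clinear_zero[OF B(1)])
  finally show ?thesis by (simp add: spectral_subspace_def op_kernel_def Z_def)
qed

lemma spectral_subspace_form_le:
  assumes "x \<in> spectral_subspace X t"
  shows "Re (cinner (X x) x) \<le> t * (norm x)\<^sup>2"
proof -
  let ?Z = "\<lambda>x. X x - t *\<^sub>R x"
  have "abs_op ?Z x + ?Z x = 0" using assms by (simp add: spectral_subspace_def op_kernel_def)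
  then have "cinner (abs_op ?Z x + ?Z x) x = 0" by simp
  then have "Re (cinner (abs_op ?Z x) x) + Re (cinner (X x) x) - t * (norm x)\<^sup>2 = 0"
    by (simp add: cinner_simps cinner_self complex_eq_iff)
  then show ?thesis using nonneg_op_pos[OF nonneg_abs_op[OF selfadjoint_shift], of t x] by simp
qed

text \<open>With \<open>Z = X - t\<close> and \<open>W = \<bar>Z\<bar>\<close>, the complement lies
  in the closure of the range of \<open>W + Z\<close>, and
  \<open>(W - Z) (W + Z) = W\<^sup>2 - Z\<^sup>2 = 0\<close>. So \<open>W x = Z x\<close> there,
  which makes the form of \<open>Z\<close> nonnegative; if it vanished, \<open>x\<close> would be in
  the kernel of \<open>W + Z\<close> as well.\<close>

lemma spectral_subspace_form_gt:
  assumes x: "x \<in> ortho_compl (spectral_subspace X t)" and "x \<noteq> 0"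
  shows "t * (norm x)\<^sup>2 < Re (cinner (X x) x)"
proof -
  define Z where "Z = (\<lambda>x. X x - t *\<^sub>R x)"
  define W where "W = abs_op Z"
  have Z: "selfadjoint_op Z" unfolding Z_def by (rule selfadjoint_shift)
  have W: "nonneg_op W" unfolding W_def by (rule nonneg_abs_op[OF Z])
  have Zb: "bounded_clinear Z" and Wb: "bounded_clinear W"
    using Z W by (auto simp: selfadjoint_op_iff nonneg_op_iff)
  have ker: "spectral_subspace X t = op_kernel (\<lambda>x. W x + Z x)"
    by (simp add: spectral_subspace_def W_def Z_def)
  have "selfadjoint_op (\<lambda>x. W x + Z x)"
    using Z W by (simp add: selfadjoint_op_iff nonneg_op_iff bounded_clinear_add_fun cinner_simps)
  then have cl: "x \<in> closure (range (\<lambda>x. W x + Z x))"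
    using x unfolding ker by (rule closure_range_eq_ortho_compl_kernel)
  have comm: "Z (W y) = W (Z y)" for y
    unfolding W_def by (rule abs_op_commute[OF Z Zb]) simp
  have "W (W y + Z y) - Z (W y + Z y) = 0" for y
    using abs_op_square[OF Z, of y]
    by (simp add: bounded_clinear_add[OF Zb] bounded_clinear_add[OF Wb] comm flip: W_def)
  then have "range (\<lambda>x. W x + Z x) \<subseteq> op_kernel (\<lambda>x. W x - Z x)"
    by (auto simp: op_kernel_def)
  moreover have "closed (op_kernel (\<lambda>x. W x - Z x))"
    by (intro closed_kernel bounded_clinear_diff_fun Wb Zb)
  ultimately have "x \<in> op_kernel (\<lambda>x. W x - Z x)" using cl closure_minimal by blast
  then have WZ: "W x = Z x" by (simp add: op_kernel_def)
  have ge: "0 \<le> Re (cinner (Z x) x)" using nonneg_op_pos[OF W, of x] WZ by simp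
  have "Re (cinner (Z x) x) \<noteq> 0"
  proof
    assume "Re (cinner (Z x) x) = 0"
    then have "Re (cinner (W x) x) = 0" by (simp only: WZ)
    then have "W x = 0" by (rule nonneg_op_zero_form[OF W])
    then have "x \<in> spectral_subspace X t" using WZ by (simp add: ker op_kernel_def)
    then show False using x \<open>x \<noteq> 0\<close> ortho_compl_disjoint by blast
  qed
  then have "0 < Re (cinner (Z x) x)" using ge by simp
  then show ?thesis by (simp add: Z_def cinner_simps Re_cinner_self)
qed

lemma orthogonal_projection_spectral_proj: "orthogonal_projection (spectral_proj X t)"
  unfolding spectral_proj_def
  by (rule orthogonal_projection_orth_proj[OF csubspace_spectral_subspace closed_spectral_subspace])

text \<open>As \<open>B\<close> is symmetric, invariance of the spectral subspace passes to its
  orthogonal complement.\<close>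

lemma spectral_proj_commute:
  assumes B: "selfadjoint_op B" "\<And>x. B (X x) = X (B x)"
  shows "B (spectral_proj X t x) = spectral_proj X t (B x)"
proof -
  note LL = csubspace_spectral_subspace[of t] closed_spectral_subspace[of t]
  have Bb: "bounded_clinear B" and sym: "\<And>x y. cinner (B x) y = cinner x (B y)"
    using B by (auto simp: selfadjoint_op_iff)
  have inv: "B y \<in> spectral_subspace X t" if "y \<in> spectral_subspace X t" for y
    by (rule spectral_subspace_invariant[OF Bb B(2) that])
  have "spectral_proj X t (B x) = B (spectral_proj X t x)"
    unfolding spectral_proj_def
  proof (rule orth_proj_eqI[OF LL])
    show "B (orth_proj (spectral_subspace X t) x) \<in> spectral_subspace X t"
      by (rule inv[OF orth_proj_in[OF LL]])
    show "B x - B (orth_proj (spectral_subspace X t) x) \<in> ortho_compl (spectral_subspace X t)"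
      unfolding ortho_compl_def bounded_clinear_diff[OF Bb, symmetric]
      using orth_proj_orthogonal[OF LL] inv sym by auto
  qed
  then show ?thesis by simp
qed

lemma spectral_proj_commute_self: "spectral_proj X t (X x) = X (spectral_proj X t x)"
  using spectral_proj_commute[OF X] by simp

lemma spectral_proj_commute_spectral_proj:
  "spectral_proj X s (spectral_proj X t x) = spectral_proj X t (spectral_proj X s x)"
  by (rule spectral_proj_commute)
    (simp_all add: orthogonal_projection_selfadjoint orthogonal_projection_spectral_proj spectral_proj_commute_self)

lemma spectral_proj_form_le:
  assumes "spectral_proj X t x = x" shows "Re (cinner (X x) x) \<le> t * (norm x)\<^sup>2"
  using spectral_subspace_form_le[of x t] assms
    orth_proj_in[OF csubspace_spectral_subspace closed_spectral_subspace, of t x]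
  by (simp add: spectral_proj_def)

lemma spectral_proj_form_gt:
  assumes "spectral_proj X t x = 0" "x \<noteq> 0" shows "t * (norm x)\<^sup>2 < Re (cinner (X x) x)"
  using spectral_subspace_form_gt[of x t] assms
    orth_proj_compl[OF csubspace_spectral_subspace closed_spectral_subspace, of x t]
  by (simp add: spectral_proj_def)

lemma spectral_proj_diff: "spectral_proj X t (x - y) = spectral_proj X t x - spectral_proj X t y"
  by (rule bounded_clinear_diff[OF orthogonal_projection_bounded[OF orthogonal_projection_spectral_proj]])

lemma spectral_proj_idem: "spectral_proj X t (spectral_proj X t x) = spectral_proj X t x"
  by (rule orthogonal_projection_idem[OF orthogonal_projection_spectral_proj])

text \<open>A nonzero vector fixed by the projection at \<open>s\<close> and annihilated by the one
  at \<open>t\<close> would have its form both at most \<open>s\<close> and above \<open>t\<close>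
  times the squared norm. The strict inequality covers \<open>s = t\<close>.\<close>

lemma spectral_proj_mono:
  assumes "s \<le> t" shows "spectral_proj X t (spectral_proj X s x) = spectral_proj X s x"
proof (rule ccontr)
  define y where "y = spectral_proj X s x - spectral_proj X t (spectral_proj X s x)"
  assume "spectral_proj X t (spectral_proj X s x) \<noteq> spectral_proj X s x"
  then have y0: "y \<noteq> 0" by (simp add: y_def)
  have "spectral_proj X t y = 0" by (simp add: y_def spectral_proj_diff spectral_proj_idem)
  then have "t * (norm y)\<^sup>2 < Re (cinner (X y) y)" using y0 by (rule spectral_proj_form_gt)
  moreover have "spectral_proj X s y = y"
    by (simp add: y_def spectral_proj_diff spectral_proj_idem spectral_proj_commute_spectral_proj[of s t])
  then have "Re (cinner (X y) y) \<le> s * (norm y)\<^sup>2" by (rule spectral_proj_form_le)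
  moreover have "s * (norm y)\<^sup>2 \<le> t * (norm y)\<^sup>2" using assms by (simp add: mult_right_mono)
  ultimately show False by simp
qed

lemma spectral_proj_op_le: "s \<le> t \<Longrightarrow> op_le (spectral_proj X s) (spectral_proj X t)"
  by (intro orthogonal_projection_leI orthogonal_projection_spectral_proj spectral_proj_mono)

lemma spectral_proj_mono2:
  "s \<le> t \<Longrightarrow> spectral_proj X s (spectral_proj X t x) = spectral_proj X s x"
  using spectral_proj_mono[of s t x] by (simp only: spectral_proj_commute_spectral_proj[of s t x])

lemma norm_spectral_proj_diff:
  assumes "s \<le> t"
  shows "(norm (spectral_proj X t x - spectral_proj X s x))\<^sup>2 =
    (norm (spectral_proj X t x))\<^sup>2 - (norm (spectral_proj X s x))\<^sup>2"
  using orthogonal_projection_norm_split[OF orthogonal_projection_spectral_proj, of "spectral_proj X t x" s]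
  by (simp add: spectral_proj_mono2[OF assms])

lemma spectral_proj_norm_mono:
  assumes "s \<le> t" shows "norm (spectral_proj X s x) \<le> norm (spectral_proj X t x)"
proof (rule power2_le_imp_le)
  have "0 \<le> (norm (spectral_proj X t x))\<^sup>2 - (norm (spectral_proj X s x))\<^sup>2"
    unfolding norm_spectral_proj_diff[OF assms, symmetric] by (rule zero_le_power2)
  then show "(norm (spectral_proj X s x))\<^sup>2 \<le> (norm (spectral_proj X t x))\<^sup>2" by simp
qed simp

lemma form_bound:
  obtains K where "K > 0" "\<And>x. \<bar>Re (cinner (X x) x)\<bar> \<le> K * (norm x)\<^sup>2"
proof -
  obtain K where K: "K > 0" "\<And>x. norm (X x) \<le> K * norm x"
    using bounded_clinear_bound[of X] X unfolding selfadjoint_op_iff by blast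
  have "\<bar>Re (cinner (X x) x)\<bar> \<le> K * (norm x)\<^sup>2" for x
  proof -
    have "\<bar>Re (cinner (X x) x)\<bar> \<le> norm (X x) * norm x"
      using abs_Re_le_cmod cinner_cauchy_schwarz order_trans by blast
    also have "\<dots> \<le> K * norm x * norm x" by (intro mult_right_mono K) simp
    finally show ?thesis by (simp add: power2_eq_square)
  qed
  then show thesis using K that by blast
qed

text \<open>The inequality on the left is strict because \<open>- K\<close> may be an eigenvalue,
  and the projection at \<open>t\<close> includes the point \<open>t\<close>.\<close>

lemma spectral_proj_outside:
  assumes K: "\<And>x. \<bar>Re (cinner (X x) x)\<bar> \<le> K * (norm x)\<^sup>2"
  shows "t < - K \<Longrightarrow> spectral_proj X t x = 0" and "K \<le> t \<Longrightarrow> spectral_proj X t x = x"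
proof -
  assume t: "t < - K"
  let ?y = "spectral_proj X t x"
  have "Re (cinner (X ?y) ?y) \<le> t * (norm ?y)\<^sup>2" by (rule spectral_proj_form_le[OF spectral_proj_idem])
  then have "0 \<le> (t + K) * (norm ?y)\<^sup>2" using K[of ?y] by (simp add: algebra_simps)
  then show "?y = 0" using t by (simp add: zero_le_mult_iff)
next
  assume t: "K \<le> t"
  let ?y = "x - spectral_proj X t x"
  have "Re (cinner (X ?y) ?y) \<le> t * (norm ?y)\<^sup>2"
    using K[of ?y] mult_right_mono[OF t, of "(norm ?y)\<^sup>2"] by simp
  moreover have "spectral_proj X t ?y = 0" by (simp add: spectral_proj_diff spectral_proj_idem)
  ultimately have "?y = 0" using spectral_proj_form_gt[of t ?y] by linarith
  then show "spectral_proj X t x = x" by simp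
qed

text \<open>Along \<open>r n\<close> decreasing to \<open>t\<close> the squared norms of the
  projected vectors decrease, hence converge, and their differences are the squared distances; this
  gives a limit \<open>g\<close>. It is fixed by every later projection, and must be fixed by the
  one at \<open>t\<close> too. Monotonicity extends the limit from the sequence to all
  \<open>s\<close> on the right.\<close>

lemma spectral_proj_right_continuous: "((\<lambda>s. spectral_proj X s x) \<longlongrightarrow> spectral_proj X t x) (at_right t)"
proof -
  let ?E = "spectral_proj X"
  define r where "r n = t + 1 / real (Suc n)" for n
  have r: "t < r n" for n by (simp add: r_def)
  have rmono: "r n \<le> r m" if "m \<le> n" for m n
    using that by (simp add: r_def frac_le)
  have r_lim: "r \<longlonglongrightarrow> t"
    unfolding r_def using LIMSEQ_inverse_real_of_nat_add[of t] by (simp add: divide_inverse)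
  have "convergent (\<lambda>n. (norm (?E (r n) x))\<^sup>2)"
  proof (rule Bseq_mono_convergent[of "\<lambda>n. - (norm (?E (r n) x))\<^sup>2", THEN convergent_minus_iff[THEN iffD2]])
    show "Bseq (\<lambda>n. - (norm (?E (r n) x))\<^sup>2)"
      by (rule BseqI'[of _ "(norm x)\<^sup>2"])
        (simp add: power_mono orthogonal_projection_norm_le orthogonal_projection_spectral_proj)
    show "\<forall>m n. m \<le> n \<longrightarrow> - (norm (?E (r m) x))\<^sup>2 \<le> - (norm (?E (r n) x))\<^sup>2"
      by (simp add: power_mono spectral_proj_norm_mono rmono)
  qed
  then have C: "Cauchy (\<lambda>n. (norm (?E (r n) x))\<^sup>2)" by (simp add: Cauchy_convergent_iff)
  have "Cauchy (\<lambda>n. ?E (r n) x)"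
  proof (rule metric_CauchyI)
    fix e :: real assume e: "e > 0"
    obtain N where N: "\<And>i j. i \<ge> N \<Longrightarrow> j \<ge> N \<Longrightarrow>
        dist ((norm (?E (r i) x))\<^sup>2) ((norm (?E (r j) x))\<^sup>2) < e\<^sup>2"
      using metric_CauchyD[OF C, of "e\<^sup>2"] e by auto
    have *: "dist (?E (r i) x) (?E (r j) x) < e" if "N \<le> i" "i \<le> j" for i j
    proof -
      have "(norm (?E (r i) x - ?E (r j) x))\<^sup>2 < e\<^sup>2"
        using N[of i j] that by (simp add: norm_spectral_proj_diff rmono dist_real_def)
      then show ?thesis using e by (simp add: dist_norm power_less_imp_less_base)
    qed
    show "\<exists>N. \<forall>i\<ge>N. \<forall>j\<ge>N. dist (?E (r i) x) (?E (r j) x) < e"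
    proof (intro exI[of _ N] allI impI)
      fix i j assume "N \<le> i" "N \<le> j"
      then show "dist (?E (r i) x) (?E (r j) x) < e"
        using *[of i j] *[of j i] by (cases "i \<le> j") (auto simp: dist_commute)
    qed
  qed
  then obtain g where g: "(\<lambda>n. ?E (r n) x) \<longlonglongrightarrow> g" using Cauchy_convergent convergent_def by blast
  note bl = orthogonal_projection_bounded[OF orthogonal_projection_spectral_proj]
  have Eg: "?E s g = g" if s: "t < s" for s
  proof (rule LIMSEQ_unique[OF bounded_clinear_tendsto[OF bl g]])
    have "\<forall>\<^sub>F n in sequentially. r n < s" using order_tendstoD(2)[OF r_lim s] .
    then have "\<forall>\<^sub>F n in sequentially. ?E (r n) x = ?E s (?E (r n) x)"
      by (rule eventually_mono) (simp add: spectral_proj_mono)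
    then show "(\<lambda>n. ?E s (?E (r n) x)) \<longlonglongrightarrow> g" by (rule Lim_transform_eventually[OF g])
  qed
  \<comment> \<open>If nonzero, this vector has form strictly above \<open>t\<close> times its
    squared norm, but at most \<open>r n\<close> times it for every \<open>n\<close>.\<close>
  have "g - ?E t g = 0"
  proof (rule ccontr)
    let ?y = "g - ?E t g"
    assume y0: "?y \<noteq> 0"
    have "t * (norm ?y)\<^sup>2 < Re (cinner (X ?y) ?y)"
      using y0 by (intro spectral_proj_form_gt) (simp_all add: spectral_proj_diff spectral_proj_idem)
    moreover have "Re (cinner (X ?y) ?y) \<le> r n * (norm ?y)\<^sup>2" for n
      by (rule spectral_proj_form_le)
        (simp add: spectral_proj_diff Eg[OF r] spectral_proj_commute_spectral_proj[of "r n" t])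
    then have "Re (cinner (X ?y) ?y) \<le> t * (norm ?y)\<^sup>2"
      by (intro LIMSEQ_le_const[OF tendsto_mult[OF r_lim tendsto_const]]) blast
    ultimately show False by simp
  qed
  moreover have "?E t g = ?E t x"
  proof (rule LIMSEQ_unique[OF bounded_clinear_tendsto[OF bl g]])
    show "(\<lambda>n. ?E t (?E (r n) x)) \<longlonglongrightarrow> ?E t x"
      using r by (simp add: spectral_proj_mono2 less_imp_le)
  qed
  ultimately have lim: "(\<lambda>n. ?E (r n) x) \<longlonglongrightarrow> ?E t x" using g by simp
  show ?thesis
  proof (rule tendstoI)
    fix e :: real assume "e > 0"
    then obtain n where n: "dist (?E (r n) x) (?E t x) < e"
      using metric_LIMSEQ_D[OF lim] by blast
    have "dist (?E s x) (?E t x) < e" if "t < s" "s < r n" for s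
    proof -
      have "(norm (?E s x - ?E t x))\<^sup>2 \<le> (norm (?E (r n) x - ?E t x))\<^sup>2"
        using that r[of n] by (simp add: norm_spectral_proj_diff power_mono spectral_proj_norm_mono)
      then have "norm (?E s x - ?E t x) \<le> norm (?E (r n) x - ?E t x)" by (rule power2_le_imp_le) simp
      then show ?thesis using n by (simp add: dist_norm)
    qed
    then show "\<forall>\<^sub>F s in at_right t. dist (?E s x) (?E t x) < e"
      using r[of n] by (auto simp: eventually_at_right)
  qed
qed

lemma resolution_of_identity_spectral_proj: "resolution_of_identity (spectral_proj X)"
  unfolding resolution_of_identity_def
proof (intro conjI allI impI)
  obtain K where K: "K > 0" "\<And>x. \<bar>Re (cinner (X x) x)\<bar> \<le> K * (norm x)\<^sup>2" using form_bound by blast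
  fix x
  have "\<forall>\<^sub>F t in at_bot. spectral_proj X t x = 0"
    using eventually_gt_at_bot[of "- K"] spectral_proj_outside(1)[OF K(2)]
    by (auto simp: eventually_at_bot_dense)
  then show "((\<lambda>t. spectral_proj X t x) \<longlongrightarrow> 0) at_bot" by (rule tendsto_eventually)
  have "\<forall>\<^sub>F t in at_top. spectral_proj X t x = x"
    using eventually_ge_at_top[of K] by (rule eventually_mono) (rule spectral_proj_outside(2)[OF K(2)])
  then show "((\<lambda>t. spectral_proj X t x) \<longlongrightarrow> x) at_top" by (rule tendsto_eventually)
qed (rule orthogonal_projection_spectral_proj spectral_proj_op_le spectral_proj_right_continuous, assumption?)+

end

subsection \<open>Spectral integrals\<close>

context
  fixes E :: "real \<Rightarrow> 'a::chilbert_space \<Rightarrow> 'a"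
  assumes E: "resolution_of_identity E"
begin

lemma resolution_projection: "orthogonal_projection (E t)"
  using E by (simp add: resolution_of_identity_def)

lemma resolution_le: "s \<le> t \<Longrightarrow> op_le (E s) (E t)"
  using E by (simp add: resolution_of_identity_def)

lemma resolution_mono: "s \<le> t \<Longrightarrow> E t (E s x) = E s x"
  and resolution_mono2: "s \<le> t \<Longrightarrow> E s (E t x) = E s x"
  by (rule orthogonal_projection_le_imp[OF resolution_projection resolution_projection resolution_le], assumption)+

lemma resolution_add: "E t (x + y) = E t x + E t y"
  and resolution_diff: "E t (x - y) = E t x - E t y"
  by (rule bounded_clinear_add bounded_clinear_diff, rule orthogonal_projection_bounded[OF resolution_projection])+

lemma resolution_form: "Re (cinner (E t f) f) = (norm (E t f))\<^sup>2"
  by (simp add: orthogonal_projection_cinner[OF resolution_projection])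

lemma resolution_form_mono:
  assumes "s \<le> t" shows "(norm (E s f))\<^sup>2 \<le> (norm (E t f))\<^sup>2"
  using resolution_le[OF assms] by (simp add: op_le_def resolution_form)

lemma resolution_form_tendsto:
  shows "continuous (at_right a) (\<lambda>t. (norm (E t f))\<^sup>2)"
    and "((\<lambda>t. (norm (E t f))\<^sup>2) \<longlongrightarrow> 0) at_bot"
    and "((\<lambda>t. (norm (E t f))\<^sup>2) \<longlongrightarrow> (norm f)\<^sup>2) at_top"
proof -
  have lims: "((\<lambda>s. E s f) \<longlongrightarrow> E a f) (at_right a)" "((\<lambda>t. E t f) \<longlongrightarrow> 0) at_bot"
    "((\<lambda>t. E t f) \<longlongrightarrow> f) at_top"
    using E by (auto simp: resolution_of_identity_def)
  note * = lims[THEN tendsto_norm, THEN tendsto_power, of 2]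
  show "continuous (at_right a) (\<lambda>t. (norm (E t f))\<^sup>2)"
    using *(1) by (simp add: continuous_within)
  show "((\<lambda>t. (norm (E t f))\<^sup>2) \<longlongrightarrow> 0) at_bot" using *(2) by simp
  show "((\<lambda>t. (norm (E t f))\<^sup>2) \<longlongrightarrow> (norm f)\<^sup>2) at_top" by (rule *(3))
qed

lemma form_measure_eq: "form_measure E f = interval_measure (\<lambda>t. (norm (E t f))\<^sup>2)"
  by (simp add: form_measure_def resolution_form)

lemma finite_measure_form: "finite_measure (form_measure E f)"
  unfolding form_measure_eq
  using finite_borel_measure_interval_measure[OF resolution_form_mono resolution_form_tendsto]
  by (simp add: finite_borel_measure_def)

lemma sets_form_measure [measurable_cong]: "sets (form_measure E f) = sets borel"
  and space_form_measure: "space (form_measure E f) = UNIV"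
  by (simp_all add: form_measure_eq)

lemma measure_form_UNIV: "measure (form_measure E f) UNIV = (norm f)\<^sup>2"
  unfolding form_measure_eq measure_def
  by (subst interval_measure_UNIV[OF resolution_form_mono resolution_form_tendsto]) auto

lemma measure_form_Iic: "measure (form_measure E f) {..t} = (norm (E t f))\<^sup>2"
  unfolding form_measure_eq
  by (rule measure_interval_measure_Iic[OF resolution_form_mono resolution_form_tendsto(1,2)])

lemma measure_form_Ioc:
  "a \<le> b \<Longrightarrow> measure (form_measure E f) {a<..b} = (norm (E b f))\<^sup>2 - (norm (E a f))\<^sup>2"
  unfolding form_measure_eq
  by (rule measure_interval_measure_Ioc[OF _ resolution_form_mono resolution_form_tendsto(1)])

lemma AE_form_measure_le:
  assumes "E t f = f" shows "AE u in form_measure E f. u \<le> t"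
proof -
  interpret finite_measure "form_measure E f" by (rule finite_measure_form)
  have "measure (form_measure E f) (space (form_measure E f) - {..t}) =
      measure (form_measure E f) (space (form_measure E f)) - measure (form_measure E f) {..t}"
    by (rule finite_measure_compl) (simp add: sets_form_measure)
  then have "measure (form_measure E f) (- {..t}) = 0"
    by (simp add: space_form_measure measure_form_UNIV measure_form_Iic assms Compl_eq_Diff_UNIV)
  then have "- {..t} \<in> null_sets (form_measure E f)"
    by (simp add: null_sets_def sets_form_measure emeasure_eq_measure)
  then show ?thesis by (rule AE_I') auto
qed

lemma AE_form_measure_ge:
  assumes "E s f = 0" shows "AE u in form_measure E f. s \<le> u"
proof -
  interpret finite_measure "form_measure E f" by (rule finite_measure_form)
  have "measure (form_measure E f) {..s} = 0" by (simp add: measure_form_Iic assms)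
  then have "{..s} \<in> null_sets (form_measure E f)"
    by (simp add: null_sets_def sets_form_measure emeasure_eq_measure)
  then show ?thesis by (rule AE_I') auto
qed

lemma integrable_form_measure_bounded:
  fixes \<phi> :: "real \<Rightarrow> real"
  assumes "\<phi> \<in> borel_measurable borel" "AE u in form_measure E f. \<bar>\<phi> u\<bar> \<le> C"
  shows "integrable (form_measure E f) \<phi>"
proof -
  interpret finite_measure "form_measure E f" by (rule finite_measure_form)
  show ?thesis
    by (rule integrable_const_bound[of _ C]) (use assms in auto)
qed

end

text \<open>On an equidistant partition with step \<open>h\<close> the bounds sum to
  \<open>h * (F b - F a)\<close>, which tends to zero with \<open>h\<close>. It allows an integral
  to be identified from increments alone, without approximating the integrand.\<close>

lemma telescope_square_zero:
  fixes D F :: "real \<Rightarrow> real"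
  assumes ab: "a \<le> b"
    and D: "\<And>c d. a \<le> c \<Longrightarrow> c \<le> d \<Longrightarrow> d \<le> b \<Longrightarrow> \<bar>D d - D c\<bar> \<le> (d - c) * (F d - F c)"
  shows "D b = D a"
proof -
  have bound: "\<bar>D b - D a\<bar> \<le> (b - a) * (F b - F a) * inverse (real (Suc n))" for n
  proof -
    define h where "h = (b - a) / real (Suc n)"
    define p where "p i = a + real i * h" for i
    have h: "0 \<le> h" using ab by (simp add: h_def)
    have p0: "p 0 = a" and pn: "p (Suc n) = b" by (simp_all add: p_def h_def del: of_nat_Suc)
    have le: "a \<le> p i" for i using h by (simp add: p_def)
    have pS: "p (Suc i) = p i + h" for i by (simp add: p_def algebra_simps)
    have ub: "p i \<le> b" if "i \<le> Suc n" for i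
    proof -
      have "p i \<le> p (Suc n)" unfolding p_def using h that by (intro add_left_mono mult_right_mono) auto
      then show ?thesis by (simp add: pn)
    qed
    have "\<bar>D b - D a\<bar> = \<bar>\<Sum>i<Suc n. D (p (Suc i)) - D (p i)\<bar>"
      by (subst sum_lessThan_telescope) (simp add: p0 pn)
    also have "\<dots> \<le> (\<Sum>i<Suc n. \<bar>D (p (Suc i)) - D (p i)\<bar>)" by (rule sum_abs)
    also have "\<dots> \<le> (\<Sum>i<Suc n. h * (F (p (Suc i)) - F (p i)))"
    proof (rule sum_mono)
      fix i assume "i \<in> {..<Suc n}"
      then show "\<bar>D (p (Suc i)) - D (p i)\<bar> \<le> h * (F (p (Suc i)) - F (p i))"
        using D[of "p i" "p (Suc i)"] le[of i] ub[of "Suc i"] h by (simp add: pS)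
    qed
    also have "\<dots> = h * (F b - F a)"
      by (subst sum_distrib_left[symmetric], subst sum_lessThan_telescope) (simp add: p0 pn)
    finally show ?thesis by (simp add: h_def field_simps)
  qed
  have "(\<lambda>n. (b - a) * (F b - F a) * inverse (real (Suc n))) \<longlonglongrightarrow> (b - a) * (F b - F a) * 0"
    by (intro tendsto_mult tendsto_const LIMSEQ_inverse_real_of_nat)
  then have "\<bar>D b - D a\<bar> \<le> (b - a) * (F b - F a) * 0"
    by (rule LIMSEQ_le_const) (use bound in blast)
  then show ?thesis by simp
qed

text \<open>The form \<open>h t\<close> of \<open>X\<close> cut off at \<open>t\<close> and the
  integral \<open>H t\<close> up to \<open>t\<close> have increments over the interval from
  \<open>c\<close> to \<open>d\<close> that both lie between \<open>c\<close> and \<open>d\<close>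
  times the increment of \<open>F\<close>. Hence \<open>h - H\<close> is constant, and it vanishes
  at \<open>a\<close>.\<close>

lemma has_spectral_integral_spectral_proj:
  fixes X :: "'a::chilbert_space \<Rightarrow> 'a"
  assumes X: "selfadjoint_op X"
  shows "has_spectral_integral (spectral_proj X) (\<lambda>t. t) X"
  unfolding has_spectral_integral_def
proof (intro conjI allI)
  have Xb: "bounded_clinear X" and Xsym: "\<And>x y. cinner (X x) y = cinner x (X y)"
    using X by (auto simp: selfadjoint_op_iff)
  show "bounded_clinear X" by (rule Xb)
  fix f :: 'a
  let ?E = "spectral_proj X" and ?M = "form_measure (spectral_proj X) f"
  note res = resolution_of_identity_spectral_proj[OF X]
  obtain K where K: "K > 0" "\<And>x. \<bar>Re (cinner (X x) x)\<bar> \<le> K * (norm x)\<^sup>2"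
    using form_bound[OF X] by blast
  \<comment> \<open>Strictly below \<open>- K\<close>, so that the projection at \<open>a\<close> is
    zero.\<close>
  define a where "a = - K - 1"
  have Ea: "?E a f = 0" and EK: "?E K f = f"
    using spectral_proj_outside[OF X K(2)] by (auto simp: a_def)
  have aK: "a \<le> K" using K by (simp add: a_def)
  have AE: "AE u in ?M. a \<le> u" "AE u in ?M. u \<le> K"
    using AE_form_measure_ge[OF res Ea] AE_form_measure_le[OF res EK] by auto
  interpret finite_measure ?M by (rule finite_measure_form[OF res])
  show int: "integrable ?M (\<lambda>t. t)"
    by (rule integrable_form_measure_bounded[OF res, where C = "K + 1"])
      (use AE in \<open>auto simp: a_def\<close>)
  define h where "h t = Re (cinner (X (?E t f)) f)" for t
  define H where "H t = (LINT u|?M. indicator {a<..t} u * u)" for t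
  define F where "F t = (norm (?E t f))\<^sup>2" for t
  have meas: "{c<..d} \<in> sets ?M" for c d by (simp add: sets_form_measure[OF res])
  have intH: "integrable ?M (\<lambda>u. indicator {c<..d} u * u)" for c d
    using integrable_real_mult_indicator[OF meas int] by (simp add: mult.commute)
  have h_bounds: "c * (F d - F c) \<le> h d - h c \<and> h d - h c \<le> d * (F d - F c)" if "c \<le> d" for c d
  proof -
    let ?y = "?E d f - ?E c f"
    have Ey: "?E d ?y = ?y" "?E c ?y = 0"
      using that by (simp_all add: spectral_proj_diff[OF X] spectral_proj_idem[OF X]
          spectral_proj_mono[OF X] spectral_proj_mono2[OF X])
    have "cinner (X ?y) (?E d f) = cinner (X ?y) f"
      using Ey(1) by (metis orthogonal_projection_sym[OF orthogonal_projection_spectral_proj[OF X]]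
          spectral_proj_commute_self[OF X])
    moreover have "cinner (X ?y) (?E c f) = 0"
      by (metis Ey(2) Xb bounded_clinear_zero cinner_zero_left spectral_proj_commute_self[OF X]
        orthogonal_projection_sym[OF orthogonal_projection_spectral_proj[OF X]])
    ultimately have "h d - h c = Re (cinner (X ?y) ?y)"
      by (simp add: h_def cinner_diff_right bounded_clinear_diff[OF Xb] cinner_diff_left)
    moreover have "(norm ?y)\<^sup>2 = F d - F c"
      unfolding F_def by (rule norm_spectral_proj_diff[OF X that])
    moreover have "Re (cinner (X ?y) ?y) \<le> d * (norm ?y)\<^sup>2" by (rule spectral_proj_form_le[OF X Ey(1)])
    moreover have "c * (norm ?y)\<^sup>2 \<le> Re (cinner (X ?y) ?y)"
      using spectral_proj_form_gt[OF X Ey(2)] by (cases "?y = 0") (auto simp: bounded_clinear_zero[OF Xb])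
    ultimately show ?thesis by simp
  qed
  have H_bounds: "c * (F d - F c) \<le> H d - H c \<and> H d - H c \<le> d * (F d - F c)"
    if "a \<le> c" "c \<le> d" for c d
  proof -
    have "H d = (LINT u|?M. indicator {a<..c} u * u + indicator {c<..d} u * u)"
      unfolding H_def by (rule Bochner_Integration.integral_cong) (use that in \<open>auto simp: indicator_def\<close>)
    also have "\<dots> = H c + (LINT u|?M. indicator {c<..d} u * u)"
      unfolding H_def by (rule Bochner_Integration.integral_add[OF intH intH])
    finally have Hdc: "H d - H c = (LINT u|?M. indicator {c<..d} u * u)" by simp
    have ic: "integrable ?M (\<lambda>u. indicator {c<..d} u * k)" for k :: real
      using meas by (intro integrable_mult_left integrable_real_indicator) (auto simp: emeasure_eq_measure)
    have lc: "(LINT u|?M. indicator {c<..d} u * k) = k * (F d - F c)" for k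
      by (simp add: space_form_measure[OF res] measure_form_Ioc[OF res that(2)] F_def)
    have "(LINT u|?M. indicator {c<..d} u * c) \<le> (LINT u|?M. indicator {c<..d} u * u)"
      by (rule integral_mono[OF ic intH]) (auto simp: indicator_def)
    moreover have "(LINT u|?M. indicator {c<..d} u * u) \<le> (LINT u|?M. indicator {c<..d} u * d)"
      by (rule integral_mono[OF intH ic]) (auto simp: indicator_def)
    ultimately show ?thesis by (simp only: Hdc lc)
  qed
  have "h K - H K = h a - H a"
  proof (rule telescope_square_zero[OF aK, of "\<lambda>t. h t - H t" F])
    fix c d assume "a \<le> c" "c \<le> d" "d \<le> K"
    then show "\<bar>(h d - H d) - (h c - H c)\<bar> \<le> (d - c) * (F d - F c)"
      using h_bounds[of c d] H_bounds[of c d] unfolding left_diff_distrib abs_le_iff by linarith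
  qed
  moreover have "h a = 0" by (simp add: h_def Ea bounded_clinear_zero[OF Xb])
  moreover have "H a = 0" by (simp add: H_def)
  moreover have "h K = Re (cinner (X f) f)" by (simp add: h_def EK)
  moreover have "H K = (LINT u|?M. u)"
  proof -
    \<comment> \<open>\<open>H\<close> integrates over an interval open at \<open>a\<close>; the
      missing endpoint carries no mass.\<close>
    have "AE u in ?M. u \<noteq> a"
    proof -
      have "measure ?M {..a} = 0" by (simp add: measure_form_Iic[OF res] Ea)
      then have "{..a} \<in> null_sets ?M" by (simp add: null_sets_def sets_form_measure[OF res] emeasure_eq_measure)
      then show ?thesis by (rule AE_I') auto
    qed
    with AE have eq: "AE u in ?M. indicator {a<..K} u * u = u"
      by eventually_elim (auto simp: indicator_def)
    show ?thesis
      unfolding H_def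
      by (rule integral_cong_AE[OF borel_measurable_integrable[OF intH] borel_measurable_integrable[OF int] eq])
  qed
  ultimately show "cinner (X f) f = complex_of_real (LINT t|?M. t)"
    using selfadjoint_form_real[OF X, of f] by simp
qed

text \<open>\<open>spectral_proj\<close> serves as the witness for the choice. From here on the
  chosen family is used only through these two properties.\<close>

lemma spectral_family_spec:
  assumes "selfadjoint_op X"
  shows "resolution_of_identity (spectral_family X)"
    and "has_spectral_integral (spectral_family X) (\<lambda>t. t) X"
proof -
  have "resolution_of_identity (spectral_family X) \<and> has_spectral_integral (spectral_family X) (\<lambda>t. t) X"
    unfolding spectral_family_def
    by (rule someI[of _ "spectral_proj X"])
      (simp add: resolution_of_identity_spectral_proj has_spectral_integral_spectral_proj assms)
  then show "resolution_of_identity (spectral_family X)"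
    "has_spectral_integral (spectral_family X) (\<lambda>t. t) X" by auto
qed

subsection \<open>The spectral gap and the sign operator\<close>

text \<open>Polarisation with \<open>f + g\<close> and \<open>\<i> *\<^sub>C f + g\<close> shows
  that the sesquilinear difference is both antisymmetric and symmetric. It gives the uniqueness
  behind \<open>spectral_integral\<close>.\<close>

lemma clinear_eq_if_form_eq:
  assumes S: "bounded_clinear S" and T: "bounded_clinear T"
    and eq: "\<And>f. cinner (S f) f = cinner (T f) f"
  shows "S = T"
proof (intro ext cinner_eqI)
  fix f g
  define d where "d f g = cinner (S f) g - cinner (T f) g" for f g
  have add: "d (u + v) w = d u w + d v w" "d w (u + v) = d w u + d w v" for u v w
    by (simp_all add: d_def bounded_clinear_add[OF S] bounded_clinear_add[OF T] cinner_simps)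
  have scale: "d (c *\<^sub>C u) v = c * d u v" "d u (c *\<^sub>C v) = cnj c * d u v" for c u v
    by (simp_all add: d_def bounded_clinear_scaleC[OF S] bounded_clinear_scaleC[OF T] cinner_simps algebra_simps)
  have zero: "d u u = 0" for u by (simp add: d_def eq)
  have "d (f + g) (f + g) = d f f + d g g + (d f g + d g f)"
    by (simp only: add) (simp only: ac_simps)
  then have "d f g + d g f = 0" by (simp add: zero)
  moreover have "d (\<i> *\<^sub>C f + g) (\<i> *\<^sub>C f + g) = d (\<i> *\<^sub>C f) (\<i> *\<^sub>C f) + d g g + (\<i> * d f g - \<i> * d g f)"
    by (simp only: add scale(1)[of _ f g] scale(2)[of g _ f]) simp
  then have "\<i> * d f g - \<i> * d g f = 0" by (simp only: zero) simp
  then have "d f g = d g f" by simp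
  ultimately have "d f g = 0" by simp
  then show "cinner (S f) g = cinner (T f) g" by (simp add: d_def)
qed

lemma spectral_integral_eqI:
  assumes "has_spectral_integral E \<phi> T" shows "spectral_integral E \<phi> = T"
  unfolding spectral_integral_def
proof (rule the_equality)
  show "has_spectral_integral E \<phi> T" by (rule assms)
  fix S assume "has_spectral_integral E \<phi> S"
  then show "S = T"
    using assms unfolding has_spectral_integral_def by (intro clinear_eq_if_form_eq) auto
qed

section \<open>What a family representing a selfadjoint operator says about its form\<close>

context
  fixes E :: "real \<Rightarrow> 'a::chilbert_space \<Rightarrow> 'a" and X :: "'a \<Rightarrow> 'a"
  assumes E: "resolution_of_identity E" and int: "has_spectral_integral E (\<lambda>t. t) X"
    and X: "selfadjoint_op X"
begin

lemma spectral_form_integral: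
  "integrable (form_measure E f) (\<lambda>t. t)" "Re (cinner (X f) f) = (LINT t|form_measure E f. t)"
  using int by (auto simp: has_spectral_integral_def)

lemma spectral_form_le:
  assumes "E t f = f" shows "Re (cinner (X f) f) \<le> t * (norm f)\<^sup>2"
proof -
  interpret finite_measure "form_measure E f" by (rule finite_measure_form[OF E])
  have "(LINT u|form_measure E f. u) \<le> (LINT u|form_measure E f. t)"
    using AE_form_measure_le[OF E assms] by (intro integral_mono_AE spectral_form_integral) auto
  then show ?thesis
    by (simp add: spectral_form_integral space_form_measure[OF E] measure_form_UNIV[OF E] mult.commute)
qed

lemma spectral_form_ge:
  assumes "E s f = 0" shows "s * (norm f)\<^sup>2 \<le> Re (cinner (X f) f)"
proof -
  interpret finite_measure "form_measure E f" by (rule finite_measure_form[OF E])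
  have "(LINT u|form_measure E f. s) \<le> (LINT u|form_measure E f. u)"
    using AE_form_measure_ge[OF E assms] by (intro integral_mono_AE spectral_form_integral) auto
  then show ?thesis
    by (simp add: spectral_form_integral space_form_measure[OF E] measure_form_UNIV[OF E] mult.commute)
qed

text \<open>The measures attached to \<open>f + g\<close> and \<open>f - g\<close> agree, hence so do the quadratic forms of \<open>X\<close>.\<close>

lemma spectral_form_orthogonal:
  assumes f: "E s f = f" and g: "E s g = 0"
  shows "cinner (X f) g = 0"
proof -
  have Xb: "bounded_clinear X" and Xsym: "\<And>x y. cinner (X x) y = cinner x (X y)"
    using X by (auto simp: selfadjoint_op_iff)
  have Re0: "Re (cinner (X f) g) = 0" if f: "E s f = f" for f
  proof -
    \<comment> \<open>For \<open>t \<le> s\<close> the vector \<open>g\<close> drops out; for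
      \<open>t\<close> beyond \<open>s\<close> the vector \<open>f\<close> is fixed and orthogonal
      to \<open>E t g\<close>. The sign of \<open>g\<close> is invisible in both cases.\<close>
    have "(norm (E t (f + g)))\<^sup>2 = (norm (E t (f - g)))\<^sup>2" for t
    proof (cases "t \<le> s")
      case True
      have "E t g = E t (E s g)" by (simp add: resolution_mono2[OF E True])
      also have "\<dots> = 0" by (simp add: g bounded_clinear_zero[OF orthogonal_projection_bounded[OF resolution_projection[OF E]]])
      finally show ?thesis by (simp add: resolution_add[OF E] resolution_diff[OF E])
    next
      case False
      then have st: "s \<le> t" by simp
      have Ef: "E t f = f" using resolution_mono[OF E st, of f] f by simp
      have "cinner f (E t g) = cinner (E t f) g"
        by (simp add: orthogonal_projection_sym[OF resolution_projection[OF E]])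
      also have "\<dots> = cinner (E s f) g" by (simp add: Ef f)
      also have "\<dots> = 0" by (simp add: orthogonal_projection_sym[OF resolution_projection[OF E]] g)
      finally show ?thesis
        by (simp add: resolution_add[OF E] resolution_diff[OF E] Ef norm_add_sq norm_diff_sq)
    qed
    then have "form_measure E (f + g) = form_measure E (f - g)"
      by (simp add: form_measure_eq[OF E])
    then have "Re (cinner (X (f + g)) (f + g)) = Re (cinner (X (f - g)) (f - g))"
      by (simp add: spectral_form_integral)
    then show ?thesis
      using Re_cinner_commute[of "X f" g] Xsym[of g f]
      by (simp add: bounded_clinear_add[OF Xb] bounded_clinear_diff[OF Xb] cinner_simps)
  qed
  have "E s (\<i> *\<^sub>C f) = \<i> *\<^sub>C f"
    by (simp add: f bounded_clinear_scaleC[OF orthogonal_projection_bounded[OF resolution_projection[OF E]]])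
  from Re0[OF this] have "Re (\<i> * cinner (X f) g) = 0"
    by (simp add: bounded_clinear_scaleC[OF Xb] cinner_scaleC_left)
  with Re0[OF f] show ?thesis by (rule complex_eqI_Re_rotate)
qed

text \<open>The form of \<open>X\<close> does not couple the range of \<open>E s\<close> with its
  complement; using this once with \<open>f\<close> and once with \<open>y\<close> in the range
  gives commutation.\<close>

lemma spectral_commute: "X (E s f) = E s (X f)"
proof -
  have Xb: "bounded_clinear X" and Xsym: "\<And>x y. cinner (X x) y = cinner x (X y)"
    using X by (auto simp: selfadjoint_op_iff)
  note sym = orthogonal_projection_sym[OF resolution_projection[OF E]]
  note idem = orthogonal_projection_idem[OF resolution_projection[OF E]]
  have E0: "E s (y - E s y) = 0" for y by (simp add: resolution_diff[OF E] idem)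
  show ?thesis
  proof (rule cinner_eqI)
    fix y
    have "cinner (X (E s f)) (y - E s y) = 0"
      by (rule spectral_form_orthogonal[OF idem E0])
    then have "cinner (X (E s f)) y = cinner (X (E s f)) (E s y)" by (simp add: cinner_diff_right)
    moreover have "cinner (X (E s y)) (f - E s f) = 0"
      by (rule spectral_form_orthogonal[OF idem E0])
    then have "cinner (f - E s f) (X (E s y)) = 0" by (simp add: cinner_eq_zero_commute[of "f - E s f"])
    then have "cinner (X (E s f)) (E s y) = cinner (X f) (E s y)"
      by (simp add: cinner_diff_left Xsym)
    ultimately show "cinner (X (E s f)) y = cinner (E s (X f)) y" by (simp add: sym)
  qed
qed

text \<open>On the range of \<open>P = E t - E s\<close> the operator \<open>X - s\<close> is
  nonnegative with norm at most \<open>t - s\<close>, so \<open>X - z\<close> has norm at most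
  \<open>2 * (t - s)\<close> there. Being below \<open>c\<close>, this is compatible with the lower
  bound only if \<open>P\<close> vanishes.\<close>

lemma spectral_locally_constant:
  assumes c: "\<And>f. c * norm f \<le> norm (X f - z *\<^sub>R f)"
    and st: "s \<le> z" "z \<le> t" "2 * (t - s) < c"
  shows "E s f = E t f"
proof -
  have Xb: "bounded_clinear X" and Xsym: "\<And>x y. cinner (X x) y = cinner x (X y)"
    using X by (auto simp: selfadjoint_op_iff)
  have "s \<le> t" using st by simp
  define P where "P g = E t g - E s g" for g
  note Eb = orthogonal_projection_bounded[OF resolution_projection[OF E]]
  note Esym = orthogonal_projection_sym[OF resolution_projection[OF E]]
  note Eidem = orthogonal_projection_idem[OF resolution_projection[OF E]]
  have EP: "E t (P g) = P g" "E s (P g) = 0" for g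
    by (simp_all add: P_def resolution_diff[OF E] resolution_mono[OF E \<open>s \<le> t\<close>]
        resolution_mono2[OF E \<open>s \<le> t\<close>] Eidem)
  have P: "orthogonal_projection P"
    unfolding orthogonal_projection_def selfadjoint_op_iff
  proof (intro conjI allI ext)
    show "bounded_clinear P" unfolding P_def by (intro bounded_clinear_diff_fun Eb)
    show "cinner (P x) y = cinner x (P y)" for x y by (simp add: P_def cinner_simps Esym)
    show "(P \<circ> P) x = P x" for x using EP[of x] by (simp add: P_def[of "P x"])
  qed
  have XP: "X (P g) = P (X g)" for g
    by (simp add: P_def bounded_clinear_diff[OF Xb] spectral_commute)
  define T where "T g = X (P g) - s *\<^sub>R P g" for g
  have form: "Re (cinner (T g) g) = Re (cinner (X (P g)) (P g)) - s * (norm (P g))\<^sup>2" for g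
  proof -
    have "cinner (X (P g)) g = cinner (X (P g)) (P g)"
      by (metis XP orthogonal_projection_idem[OF P] orthogonal_projection_sym[OF P])
    then show ?thesis by (simp add: T_def cinner_simps orthogonal_projection_cinner[OF P])
  qed
  have "nonneg_op T"
    unfolding nonneg_op_iff
  proof (intro conjI allI)
    show "bounded_clinear T"
      unfolding T_def
      by (rule bounded_clinear_diff_fun[OF bounded_clinear_comp[OF Xb] bounded_clinear_scaleR_fun])
        (rule orthogonal_projection_bounded[OF P])+
    show "cinner (T x) y = cinner x (T y)" for x y
      by (simp add: T_def cinner_simps Xsym orthogonal_projection_sym[OF P] XP)
    show "0 \<le> Re (cinner (T x) x)" for x
      using spectral_form_ge[OF EP(2)] by (simp add: form)
  qed
  moreover have "Re (cinner (T g) g) \<le> (t - s) * (norm g)\<^sup>2" for g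
  proof -
    have "Re (cinner (T g) g) \<le> (t - s) * (norm (P g))\<^sup>2"
      using spectral_form_le[OF EP(1), of g] by (simp add: form left_diff_distrib)
    also have "\<dots> \<le> (t - s) * (norm g)\<^sup>2"
      using \<open>s \<le> t\<close> by (intro mult_left_mono power_mono orthogonal_projection_norm_le[OF P]) auto
    finally show ?thesis .
  qed
  ultimately have Tn: "norm (T g) \<le> (t - s) * norm g" for g by (rule nonneg_op_norm_bound)
  have "X (P f) - z *\<^sub>R P f = T (P f) - (z - s) *\<^sub>R P f"
    by (simp add: T_def orthogonal_projection_idem[OF P] scaleR_diff_left)
  then have "norm (X (P f) - z *\<^sub>R P f) \<le> norm (T (P f)) + (z - s) * norm (P f)"
    using norm_triangle_ineq4[of "T (P f)" "(z - s) *\<^sub>R P f"] st by simp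
  also have "\<dots> \<le> (t - s) * norm (P f) + (t - s) * norm (P f)"
    using st by (intro add_mono Tn mult_right_mono) auto
  finally have "c * norm (P f) \<le> (t - s) * norm (P f) + (t - s) * norm (P f)"
    using c[of "P f"] by (rule order_trans[rotated])
  then have "0 \<le> (2 * (t - s) - c) * norm (P f)" by (simp add: algebra_simps)
  then have "P f = 0" using st by (simp add: zero_le_mult_iff)
  then show ?thesis by (simp add: P_def)
qed

lemma resolvent_bounded_below:
  assumes "complex_of_real z \<in> resolvent_set X"
  obtains c where "c > 0" "\<And>f. c * norm f \<le> norm (X f - z *\<^sub>R f)"
proof -
  obtain R where R: "bounded_clinear R" "\<And>x. R (X x - z *\<^sub>R x) = x"
    using assms by (auto simp: resolvent_set_def scaleC_of_real)
  obtain K where K: "K > 0" "\<And>x. norm (R x) \<le> K * norm x" using bounded_clinear_bound[OF R(1)] by blast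
  have "1 / K * norm f \<le> norm (X f - z *\<^sub>R f)" for f
    using K(2)[of "X f - z *\<^sub>R f"] K(1) by (simp add: R(2) field_simps)
  then show thesis using K(1) by (intro that[of "1 / K"]) auto
qed

text \<open>The lower bound \<open>c\<close> depends on the point and may degenerate at the ends of
  the gap, so local constancy is combined with connectedness. The radius \<open>c / 2\<close> is
  what the local lemma requires.\<close>

lemma spectral_constant_on_gap:
  assumes gap: "complex_of_real ` {a<..<b} \<subseteq> resolvent_set X"
    and s: "s \<in> {a<..<b}" and t: "t \<in> {a<..<b}"
  shows "E s f = E t f"
proof (rule connected_local_const[of "{a<..<b}" s t "\<lambda>s. E s f", OF _ s t])
  show "\<forall>z\<in>{a<..<b}. \<forall>\<^sub>F w in at z within {a<..<b}. E z f = E w f"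
  proof
    fix z assume z: "z \<in> {a<..<b}"
    then obtain c where c: "c > 0" "\<And>f. c * norm f \<le> norm (X f - z *\<^sub>R f)"
      using gap resolvent_bounded_below[of z] by blast
    have "E z f = E w f" if "dist w z < c / 2" for w
    proof (cases "z \<le> w")
      case True
      then show ?thesis
        using that by (intro spectral_locally_constant[OF c(2)]) (auto simp: dist_real_def)
    next
      case False
      then have "E w f = E z f"
        using that by (intro spectral_locally_constant[OF c(2)]) (auto simp: dist_real_def)
      then show ?thesis ..
    qed
    then show "\<forall>\<^sub>F w in at z within {a<..<b}. E z f = E w f"
      unfolding eventually_at using c(1) by (intro exI[of _ "c / 2"]) auto
  qed
qed auto

end

text \<open>The spectral projection of the open negative half-line. The midpoint of the gap is an
  arbitrary choice there; evaluating below zero keeps a possible eigenvalue 0 out, and the distance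
  \<delta>/2 becomes the constant of uniform negativity.\<close>

definition neg_proj :: "real \<Rightarrow> ('a::chilbert_space \<Rightarrow> 'a) \<Rightarrow> 'a \<Rightarrow> 'a" where
  "neg_proj \<delta> X = spectral_family X (- \<delta> / 2)"

section \<open>The projection below the gap and the sign\<close>

context
  fixes X :: "'a::chilbert_space \<Rightarrow> 'a" and \<delta> :: real
  assumes X: "selfadjoint_op X" and \<delta>: "\<delta> > 0"
    and gap: "complex_of_real ` {-\<delta><..<0} \<subseteq> resolvent_set X"
begin

lemma neg_proj_projection: "orthogonal_projection (neg_proj \<delta> X)"
  unfolding neg_proj_def by (rule resolution_projection[OF spectral_family_spec(1)[OF X]])

lemma neg_proj_commute: "X (neg_proj \<delta> X f) = neg_proj \<delta> X (X f)"
  unfolding neg_proj_def by (rule spectral_commute[OF spectral_family_spec[OF X] X])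

lemma neg_proj_form_neg:
  "neg_proj \<delta> X f = f \<Longrightarrow> Re (cinner (X f) f) \<le> - (\<delta> / 2) * (norm f)\<^sup>2"
  unfolding neg_proj_def using spectral_form_le[OF spectral_family_spec[OF X] X, of "- \<delta> / 2"] by simp

lemma spectral_family_gap: "s \<in> {-\<delta><..<0} \<Longrightarrow> spectral_family X s f = neg_proj \<delta> X f"
  unfolding neg_proj_def
  by (rule spectral_constant_on_gap[OF spectral_family_spec[OF X] X gap]) (use \<delta> in auto)

text \<open>With \<open>Suc n\<close> instead, the first term would be \<open>- \<delta>\<close>,
  which is outside the open gap.\<close>

lemma gap_sequence: "- \<delta> * inverse (real (Suc (Suc n))) \<in> {-\<delta><..<0}"
proof -
  define i where "i = inverse (real (Suc (Suc n)))"
  have "0 < i" "i < 1" by (simp_all add: i_def field_simps)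
  then show ?thesis unfolding i_def[symmetric] using mult_strict_left_mono[of i 1 \<delta>] \<delta> by simp
qed

text \<open>The family may jump at 0, so it is evaluated at points of the gap tending to 0; it
  equals the same projection at all of them.\<close>

lemma neg_proj_form_nonneg:
  assumes "neg_proj \<delta> X f = 0" shows "0 \<le> Re (cinner (X f) f)"
proof -
  have "- \<delta> * inverse (real (Suc (Suc n))) * (norm f)\<^sup>2 \<le> Re (cinner (X f) f)" for n
    by (intro spectral_form_ge[OF spectral_family_spec[OF X] X])
      (simp only: spectral_family_gap[OF gap_sequence] assms)
  moreover have "(\<lambda>n. - \<delta> * inverse (real (Suc (Suc n))) * (norm f)\<^sup>2) \<longlonglongrightarrow> - \<delta> * 0 * (norm f)\<^sup>2"
    by (intro tendsto_intros LIMSEQ_Suc[OF LIMSEQ_inverse_real_of_nat])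
  ultimately have "- \<delta> * 0 * (norm f)\<^sup>2 \<le> Re (cinner (X f) f)"
    by (intro LIMSEQ_le_const2) auto
  then show ?thesis by simp
qed

text \<open>The negative half-line is an increasing union of closed half-lines ending in the gap,
  all of the same mass. The point 0 is excluded because its sign is counted as 1.\<close>

lemma measure_form_negative:
  "measure (form_measure (spectral_family X) f) {..<0} = (norm (neg_proj \<delta> X f))\<^sup>2"
proof -
  note res = spectral_family_spec(1)[OF X]
  let ?M = "form_measure (spectral_family X) f"
  interpret finite_measure ?M by (rule finite_measure_form[OF res])
  define r where "r n = - \<delta> * inverse (real (Suc (Suc n)))" for n
  have r: "r n \<in> {-\<delta><..<0}" for n unfolding r_def by (rule gap_sequence)
  have r_lim: "r \<longlonglongrightarrow> 0"
    unfolding r_def using tendsto_mult[OF tendsto_const[of "- \<delta>"] LIMSEQ_Suc[OF LIMSEQ_inverse_real_of_nat]] by simp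
  have "(\<lambda>n. measure ?M {..r n}) \<longlonglongrightarrow> measure ?M (\<Union>n. {..r n})"
  proof (rule finite_Lim_measure_incseq)
    show "range (\<lambda>n. {..r n}) \<subseteq> sets ?M" by (auto simp: sets_form_measure[OF res])
    show "incseq (\<lambda>n. {..r n})"
    proof (rule incseq_SucI)
      fix n
      have "inverse (real (Suc (Suc (Suc n)))) \<le> inverse (real (Suc (Suc n)))"
        by (intro le_imp_inverse_le) auto
      then have "r n \<le> r (Suc n)" unfolding r_def using \<delta> by simp
      then show "{..r n} \<le> {..r (Suc n)}" by auto
    qed
  qed
  also have "(\<Union>n. {..r n}) = {..<0}"
  proof
    show "(\<Union>n. {..r n}) \<subseteq> {..<0}" using r by (auto intro: le_less_trans)
    show "{..<0} \<subseteq> (\<Union>n. {..r n})"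
    proof
      fix x :: real assume "x \<in> {..<0}"
      then have "\<forall>\<^sub>F n in sequentially. x < r n" using order_tendstoD(1)[OF r_lim] by simp
      then obtain n where "x < r n" by (auto simp: eventually_sequentially)
      then show "x \<in> (\<Union>n. {..r n})" by (auto intro: less_imp_le)
    qed
  qed
  finally show ?thesis
    by (simp add: measure_form_Iic[OF res] spectral_family_gap[OF r] LIMSEQ_const_iff)
qed

lemma sign_op_eq: "sign_op X = (\<lambda>f. f - 2 *\<^sub>R neg_proj \<delta> X f)"
  unfolding sign_op_def
proof (rule spectral_integral_eqI, unfold has_spectral_integral_def, intro conjI allI)
  note res = spectral_family_spec(1)[OF X]
  note P = neg_proj_projection
  show "bounded_clinear (\<lambda>f. f - 2 *\<^sub>R neg_proj \<delta> X f)"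
    by (intro bounded_clinear_diff_fun bounded_clinear_scaleR_fun bounded_clinear_id
        orthogonal_projection_bounded[OF P])
  fix f
  let ?M = "form_measure (spectral_family X) f"
  interpret finite_measure ?M by (rule finite_measure_form[OF res])
  show "integrable ?M (\<lambda>t::real. if t \<ge> 0 then 1 else - 1 :: real)"
    by (rule integrable_form_measure_bounded[OF res, where C = 1]) auto
  have neg: "{..<0} \<in> sets ?M" by (simp add: sets_form_measure[OF res])
  have "(LINT t|?M. (if t \<ge> 0 then 1 else - 1)) = (LINT t|?M. 1 - 2 * indicator {..<0::real} t :: real)"
    by (rule Bochner_Integration.integral_cong) (auto simp: indicator_def)
  also have "\<dots> = measure ?M UNIV - 2 * measure ?M {..<0}"
    using neg by (subst Bochner_Integration.integral_diff)
      (auto simp: space_form_measure[OF res] emeasure_eq_measure)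
  also have "\<dots> = (norm f)\<^sup>2 - 2 * (norm (neg_proj \<delta> X f))\<^sup>2"
    by (simp add: measure_form_UNIV[OF res] measure_form_negative)
  finally show "cinner (f - 2 *\<^sub>R neg_proj \<delta> X f) f = complex_of_real (LINT t|?M. (if t \<ge> 0 then 1 else - 1))"
    by (simp add: cinner_simps cinner_self orthogonal_projection_cinner[OF P])
qed

end

subsection \<open>Maximal uniformly negative subspaces\<close>

lemma selfadjoint_form_add:
  assumes A: "selfadjoint_op A" and orth: "cinner (A x) y = 0"
  shows "Re (cinner (A (x + y)) (x + y)) = Re (cinner (A x) x) + Re (cinner (A y) y)"
    and "Re (cinner (A (x - y)) (x - y)) = Re (cinner (A x) x) + Re (cinner (A y) y)"
proof -
  have Ab: "bounded_clinear A" and sym: "\<And>x y. cinner (A x) y = cinner x (A y)"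
    using A by (auto simp: selfadjoint_op_iff)
  have "cinner (A y) x = 0" using orth by (simp add: sym cinner_eq_zero_commute[of y])
  then show "Re (cinner (A (x + y)) (x + y)) = Re (cinner (A x) x) + Re (cinner (A y) y)"
    "Re (cinner (A (x - y)) (x - y)) = Re (cinner (A x) x) + Re (cinner (A y) y)"
    by (simp_all add: bounded_clinear_add[OF Ab] bounded_clinear_diff[OF Ab]
        cinner_add_left cinner_add_right cinner_diff_left cinner_diff_right orth)
qed

definition form_compl :: "('a::chilbert_space \<Rightarrow> 'a) \<Rightarrow> 'a set \<Rightarrow> 'a set" where
  "form_compl A M = {x. \<forall>v\<in>M. cinner (A x) v = 0}"

lemma csubspace_form_compl:
  assumes "bounded_clinear A" shows "csubspace (form_compl A M)"
  by (simp add: csubspace_def form_compl_def bounded_clinear_zero[OF assms] bounded_clinear_add[OF assms]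
      bounded_clinear_scaleC[OF assms] cinner_add_left cinner_scaleC_left)

lemma csubspace_closure:
  fixes M :: "'a::chilbert_space set"
  assumes M: "csubspace M" shows "csubspace (closure M)"
  unfolding csubspace_def
proof (intro conjI ballI allI)
  show "0 \<in> closure M" using csubspace_zero[OF M] closure_subset by blast
  fix x assume "x \<in> closure M"
  then obtain u where u: "\<And>n. u n \<in> M" "u \<longlonglongrightarrow> x" unfolding closure_sequential by blast
  { fix y assume "y \<in> closure M"
    then obtain v where v: "\<And>n. v n \<in> M" "v \<longlonglongrightarrow> y" unfolding closure_sequential by blast
    show "x + y \<in> closure M"
      unfolding closure_sequential
      by (intro exI[of _ "\<lambda>n. u n + v n"] conjI allI csubspace_add[OF M] u v tendsto_add) }
  fix c
  show "c *\<^sub>C x \<in> closure M"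
    unfolding closure_sequential
    by (intro exI[of _ "\<lambda>n. c *\<^sub>C u n"] conjI allI csubspace_scaleC[OF M] u
        bounded_clinear_tendsto[OF bounded_clinear_scaleC_map u(2)])
qed

lemma uniformly_negative_closure:
  assumes A: "bounded_clinear A" and M: "uniformly_negative A M"
  shows "uniformly_negative A (closure M)"
proof -
  obtain \<nu> where sub: "csubspace M" and \<nu>: "\<nu> > 0"
    and neg: "\<And>f. f \<in> M \<Longrightarrow> Re (cinner (A f) f) \<le> - \<nu> * (norm f)\<^sup>2"
    using M by (auto simp: uniformly_negative_def)
  have "Re (cinner (A x) x) \<le> - \<nu> * (norm x)\<^sup>2" if "x \<in> closure M" for x
  proof -
    from that obtain u where u: "\<And>n. u n \<in> M" "u \<longlonglongrightarrow> x" unfolding closure_sequential by blast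
    show ?thesis
    proof (rule LIMSEQ_le)
      show "(\<lambda>n. Re (cinner (A (u n)) (u n))) \<longlonglongrightarrow> Re (cinner (A x) x)"
        by (intro tendsto_intros tendsto_cinner bounded_clinear_tendsto[OF A] u(2))
      show "(\<lambda>n. - \<nu> * (norm (u n))\<^sup>2) \<longlonglongrightarrow> - \<nu> * (norm x)\<^sup>2"
        by (intro tendsto_intros u(2))
    qed (use neg u(1) in blast)
  qed
  then show ?thesis
    unfolding uniformly_negative_def using \<nu> csubspace_closure[OF sub] by blast
qed

context
  fixes A :: "'a::chilbert_space \<Rightarrow> 'a" and M :: "'a set"
  assumes A: "selfadjoint_op A" and M: "maximal_uniformly_negative A M"
begin

lemma maximal_uniformly_negative_csubspace: "csubspace M"
  using M by (simp add: maximal_uniformly_negative_def uniformly_negative_def)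

lemma maximal_uniformly_negative_bound:
  obtains \<nu> where "\<nu> > 0" "\<And>f. f \<in> M \<Longrightarrow> Re (cinner (A f) f) \<le> - \<nu> * (norm f)\<^sup>2"
  using M by (auto simp: maximal_uniformly_negative_def uniformly_negative_def)

lemma maximal_uniformly_negative_closed: "closure M = M"
proof -
  have "bounded_clinear A" using A by (simp add: selfadjoint_op_iff)
  then have "uniformly_negative A (closure M)"
    using M by (intro uniformly_negative_closure) (auto simp: maximal_uniformly_negative_def)
  then show ?thesis using M closure_subset unfolding maximal_uniformly_negative_def by blast
qed

text \<open>On \<open>M\<close> the form of \<open>- A\<close> is an inner product equivalent to the
  given one, so \<open>h\<close> has an \<open>A\<close>-orthogonal projection to the closure of
  \<open>V\<close>; this stays in \<open>M\<close> because \<open>M\<close> is closed.\<close>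

lemma maximal_uniformly_negative_riesz:
  assumes V: "csubspace V" "V \<subseteq> M"
  obtains s where "s \<in> closure V" "s \<in> M" "\<And>v. v \<in> V \<Longrightarrow> cinner (A (h - s)) v = 0"
proof -
  have Ab: "bounded_clinear A" and sym: "\<And>x y. cinner (A x) y = cinner x (A y)"
    using A by (auto simp: selfadjoint_op_iff)
  obtain \<nu> where \<nu>: "\<nu> > 0" "\<And>f. f \<in> M \<Longrightarrow> Re (cinner (A f) f) \<le> - \<nu> * (norm f)\<^sup>2"
    using maximal_uniformly_negative_bound by blast
  have "\<exists>s\<in>closure V. \<forall>v\<in>V. - cinner v (A h) = cinner v (- A s)"
  proof (rule riesz_form[where \<nu> = \<nu> and C = "norm (A h)" and G = "\<lambda>x. - A x"])
    show "bounded_clinear (\<lambda>x. - A x)" using bounded_clinear_diff_fun[OF bounded_clinear_const_zero Ab] by simp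
    show "\<nu> * (norm v)\<^sup>2 \<le> Re (cinner (- A v) v)" if "v \<in> V" for v
      using \<nu>(2)[of v] V that by (auto simp: cinner_minus_left)
    show "cmod (- cinner v (A h)) \<le> norm (A h) * norm v" for v
      using cinner_cauchy_schwarz_right[of v "A h"] by simp
  qed (use V \<nu> in \<open>simp_all add: cinner_simps sym\<close>)
  then obtain s where s: "s \<in> closure V" and eq: "\<And>v. v \<in> V \<Longrightarrow> cinner v (A h) = cinner v (A s)"
    by (auto simp: cinner_minus_right)
  have "s \<in> M" using s closure_mono[OF V(2)] maximal_uniformly_negative_closed by blast
  moreover have "cinner (A (h - s)) v = 0" if "v \<in> V" for v
  proof -
    have "cinner v (A (h - s)) = 0" using eq[OF that] by (simp add: bounded_clinear_diff[OF Ab] cinner_diff_right)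
    then show ?thesis by (subst cinner_eq_zero_commute)
  qed
  ultimately show thesis using s that by blast
qed

text \<open>If the form were negative at \<open>f\<close>, then \<open>M\<close> together with the
  line through \<open>f\<close> would be uniformly negative: the form splits, and
  \<open>(norm (g + m))\<^sup>2\<close> is at most twice the sum of squares, whence the constant
  \<open>\<mu> / 2\<close>. By maximality \<open>f\<close> is in \<open>M\<close>, hence
  \<open>A\<close>-orthogonal to itself, a contradiction.\<close>

lemma maximal_uniformly_negative_compl_nonneg:
  assumes f: "f \<in> form_compl A M"
  shows "0 \<le> Re (cinner (A f) f)"
proof (rule ccontr)
  assume "\<not> 0 \<le> Re (cinner (A f) f)"
  then have neg: "Re (cinner (A f) f) < 0" by simp
  have Ab: "bounded_clinear A" using A by (simp add: selfadjoint_op_iff)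
  have f0: "f \<noteq> 0" using neg by auto
  note sub = maximal_uniformly_negative_csubspace
  obtain \<nu> where \<nu>: "\<nu> > 0" "\<And>f. f \<in> M \<Longrightarrow> Re (cinner (A f) f) \<le> - \<nu> * (norm f)\<^sup>2"
    using maximal_uniformly_negative_bound by blast
  define \<kappa> where "\<kappa> = - Re (cinner (A f) f) / (norm f)\<^sup>2"
  define \<mu> where "\<mu> = min \<nu> \<kappa>"
  have \<kappa>: "\<kappa> > 0" "Re (cinner (A f) f) = - \<kappa> * (norm f)\<^sup>2"
    using neg f0 by (auto simp: \<kappa>_def field_simps)
  have \<mu>: "\<mu> > 0" "\<mu> \<le> \<nu>" "\<mu> \<le> \<kappa>" using \<nu> \<kappa> by (auto simp: \<mu>_def)
  define N where "N = {m + c *\<^sub>C f |m c. m \<in> M}"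
  have "csubspace N"
    unfolding csubspace_def
  proof (intro conjI ballI allI)
    show "0 \<in> N" unfolding N_def using csubspace_zero[OF sub] by (auto intro!: exI[of _ 0])
    fix x assume "x \<in> N"
    then obtain m c where x: "x = m + c *\<^sub>C f" "m \<in> M" by (auto simp: N_def)
    { fix y assume "y \<in> N"
      then obtain m' c' where y: "y = m' + c' *\<^sub>C f" "m' \<in> M" by (auto simp: N_def)
      have "x + y = (m + m') + (c + c') *\<^sub>C f" by (simp add: x y scaleC_add_left)
      then show "x + y \<in> N" unfolding N_def using csubspace_add[OF sub x(2) y(2)] by blast }
    fix d
    have "d *\<^sub>C x = d *\<^sub>C m + (d * c) *\<^sub>C f" by (simp add: x scaleC_add_right scaleC_scaleC)
    then show "d *\<^sub>C x \<in> N" unfolding N_def using csubspace_scaleC[OF sub x(2)] by blast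
  qed
  moreover have "Re (cinner (A x) x) \<le> - (\<mu> / 2) * (norm x)\<^sup>2" if "x \<in> N" for x
  proof -
    from that obtain m c where x: "x = c *\<^sub>C f + m" and m: "m \<in> M"
      unfolding N_def by (auto simp: add.commute)
    let ?g = "c *\<^sub>C f"
    have "cinner (A ?g) m = 0"
      using f m by (simp add: form_compl_def bounded_clinear_scaleC[OF Ab] cinner_scaleC_left)
    then have eq: "Re (cinner (A x) x) = Re (cinner (A ?g) ?g) + Re (cinner (A m) m)"
      unfolding x by (rule selfadjoint_form_add(1)[OF A])
    have "cinner (A ?g) ?g = of_real ((cmod c)\<^sup>2) * cinner (A f) f"
      unfolding complex_norm_square by (simp add: bounded_clinear_scaleC[OF Ab] cinner_scaleC_left cinner_scaleC_right mult_ac)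
    then have "Re (cinner (A ?g) ?g) = (cmod c)\<^sup>2 * Re (cinner (A f) f)"
      by (simp only: times_complex.sel Re_complex_of_real Im_complex_of_real)
    also have "\<dots> = - \<kappa> * (norm ?g)\<^sup>2" by (simp add: \<kappa>(2) norm_scaleC power_mult_distrib)
    also have "\<dots> \<le> - \<mu> * (norm ?g)\<^sup>2" using \<mu> by (simp add: mult_right_mono)
    finally have 1: "Re (cinner (A ?g) ?g) \<le> - \<mu> * (norm ?g)\<^sup>2" .
    have "Re (cinner (A m) m) \<le> - \<nu> * (norm m)\<^sup>2" by (rule \<nu>(2)[OF m])
    also have "\<dots> \<le> - \<mu> * (norm m)\<^sup>2" using \<mu> by (simp add: mult_right_mono)
    finally have 2: "Re (cinner (A m) m) \<le> - \<mu> * (norm m)\<^sup>2" .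
    have "0 \<le> (norm (?g - m))\<^sup>2" by simp
    then have "(norm x)\<^sup>2 \<le> 2 * ((norm ?g)\<^sup>2 + (norm m)\<^sup>2)"
      unfolding x norm_add_sq norm_diff_sq by simp
    then have "(\<mu> / 2) * (norm x)\<^sup>2 \<le> (\<mu> / 2) * (2 * ((norm ?g)\<^sup>2 + (norm m)\<^sup>2))"
      using \<mu> by (intro mult_left_mono) auto
    then show ?thesis using 1 2 eq by (simp add: algebra_simps)
  qed
  ultimately have "uniformly_negative A N"
    unfolding uniformly_negative_def using \<mu>(1) by (intro conjI exI[of _ "\<mu> / 2"]) auto
  moreover have "m = m + 0 *\<^sub>C f" for m by simp
  then have "M \<subseteq> N" unfolding N_def by blast
  ultimately have "N = M" using M by (auto simp: maximal_uniformly_negative_def)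
  moreover have "f = 0 + 1 *\<^sub>C f" by simp
  then have "f \<in> N" unfolding N_def using csubspace_zero[OF sub] by blast
  ultimately have "cinner (A f) f = 0" using f by (auto simp: form_compl_def)
  then show False using neg by simp
qed

text \<open>Under the last hypothesis the \<open>A\<close>-orthogonal projection of \<open>M0\<close> to \<open>M\<close> has dense range. A vector
  \<open>h\<close> that is \<open>A\<close>-orthogonal to \<open>M0\<close> is therefore, up to an element of \<open>M0\<close> and a small error in \<open>M\<close>,
  \<open>A\<close>-orthogonal to \<open>M\<close>.\<close>

lemma form_compl_nonneg_transfer:
  assumes M0: "csubspace M0" and M0_neg: "\<And>m. m \<in> M0 \<Longrightarrow> Re (cinner (A m) m) \<le> 0"
    and orth: "\<And>m. m \<in> M \<Longrightarrow> m \<in> form_compl A M0 \<Longrightarrow> 0 \<le> Re (cinner (A m) m)"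
    and h: "h \<in> form_compl A M0"
  shows "0 \<le> Re (cinner (A h) h)"
proof -
  have Ab: "bounded_clinear A" and sym: "\<And>x y. cinner (A x) y = cinner x (A y)"
    using A by (auto simp: selfadjoint_op_iff)
  note sub = maximal_uniformly_negative_csubspace
  note csub = csubspace_form_compl[OF Ab, of M]
  obtain K where K: "K > 0" "\<And>x. norm (A x) \<le> K * norm x" using bounded_clinear_bound[OF Ab] by blast
  obtain \<nu> where \<nu>: "\<nu> > 0" "\<And>f. f \<in> M \<Longrightarrow> Re (cinner (A f) f) \<le> - \<nu> * (norm f)\<^sup>2"
    using maximal_uniformly_negative_bound by blast
  have proj: "\<exists>m\<in>M. x - m \<in> form_compl A M" for x
    unfolding form_compl_def mem_Collect_eq
    by (rule maximal_uniformly_negative_riesz[OF sub subset_refl, of x]) blast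
  obtain m where m: "m \<in> M" "h - m \<in> form_compl A M" using proj by blast
  \<comment> \<open>The \<open>A\<close>-orthogonal projections to \<open>M\<close> of the vectors
    of \<open>M0\<close>.\<close>
  define V where "V = {v \<in> M. \<exists>m0\<in>M0. m0 - v \<in> form_compl A M}"
  have V: "csubspace V"
    unfolding csubspace_def
  proof (intro conjI ballI allI)
    show "0 \<in> V" using csubspace_zero[OF sub] csubspace_zero[OF M0] csubspace_zero[OF csub]
      unfolding V_def by (auto intro!: bexI[of _ 0])
    fix x assume "x \<in> V"
    then obtain x0 where x: "x \<in> M" "x0 \<in> M0" "x0 - x \<in> form_compl A M" by (auto simp: V_def)
    { fix y assume "y \<in> V"
      then obtain y0 where y: "y \<in> M" "y0 \<in> M0" "y0 - y \<in> form_compl A M" by (auto simp: V_def)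
      have "(x0 + y0) - (x + y) \<in> form_compl A M"
        using csubspace_add[OF csub x(3) y(3)] by (simp add: algebra_simps)
      then show "x + y \<in> V"
        unfolding V_def using csubspace_add[OF sub x(1) y(1)] csubspace_add[OF M0 x(2) y(2)] by blast }
    fix c
    have "c *\<^sub>C x0 - c *\<^sub>C x \<in> form_compl A M"
      using csubspace_scaleC[OF csub x(3), of c] by (simp add: scaleC_diff_right)
    then show "c *\<^sub>C x \<in> V"
      unfolding V_def using csubspace_scaleC[OF sub x(1)] csubspace_scaleC[OF M0 x(2)] by blast
  qed
  have "V \<subseteq> M" by (auto simp: V_def)
  obtain s where s: "s \<in> closure V" "s \<in> M" "\<And>v. v \<in> V \<Longrightarrow> cinner (A (m - s)) v = 0"
    using maximal_uniformly_negative_riesz[OF V \<open>V \<subseteq> M\<close>, of m] by blast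
  have ms: "m - s \<in> M" by (rule csubspace_diff[OF sub m(1) s(2)])
  \<comment> \<open>\<open>m0\<close> differs from its projection \<open>v\<close> in
    \<open>V\<close> by something \<open>A\<close>-orthogonal to \<open>M\<close>, and
    \<open>m - s\<close> is \<open>A\<close>-orthogonal to \<open>v\<close>. The hypothesis
    \<open>orth\<close> then clashes with negativity on \<open>M\<close>, so \<open>m = s\<close>
    and \<open>m\<close> is a limit of points of \<open>V\<close>.\<close>
  have "cinner (A (m - s)) m0 = 0" if m0: "m0 \<in> M0" for m0
  proof -
    obtain v where v: "v \<in> M" "m0 - v \<in> form_compl A M" using proj by blast
    then have "v \<in> V" using m0 by (auto simp: V_def)
    have "cinner (A (m0 - v)) (m - s) = 0" using v(2) ms by (simp add: form_compl_def)
    then have "cinner (A (m - s)) (m0 - v) = 0"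
      by (simp add: sym[of "m - s"] cinner_eq_zero_commute[of "m - s"])
    then show ?thesis using s(3)[OF \<open>v \<in> V\<close>] by (simp add: cinner_diff_right)
  qed
  then have "0 \<le> Re (cinner (A (m - s)) (m - s))"
    by (intro orth ms) (simp add: form_compl_def)
  then have "\<nu> * (norm (m - s))\<^sup>2 \<le> 0" using \<nu>(2)[OF ms] by simp
  then have "m = s" using \<nu>(1) by (simp add: mult_le_0_iff)
  then obtain v where v: "\<And>n. v n \<in> V" "v \<longlonglongrightarrow> m" using s(1) unfolding closure_sequential by blast
  have "- (K * (norm (m - v n))\<^sup>2) \<le> Re (cinner (A h) h)" for n
  proof -
    obtain m0 where m0: "m0 \<in> M0" "m0 - v n \<in> form_compl A M" and vM: "v n \<in> M"
      using v(1)[of n] by (auto simp: V_def)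
    \<comment> \<open>\<open>h - m0 = ?p + ?r\<close> is an \<open>A\<close>-orthogonal splitting in
      which only \<open>?r\<close> is small. The norm of \<open>m0\<close> is not controlled as
      \<open>n\<close> grows, but \<open>m0\<close> enters only through its form, which has the
      favourable sign.\<close>
    let ?p = "(h - m) - (m0 - v n)" and ?r = "m - v n"
    have p: "?p \<in> form_compl A M" by (rule csubspace_diff[OF csub m(2) m0(2)])
    have r: "?r \<in> M" by (rule csubspace_diff[OF sub m(1) vM])
    have "Re (cinner (A (h - m0)) (h - m0)) = Re (cinner (A (?p + ?r)) (?p + ?r))"
      by (simp add: algebra_simps)
    also have "\<dots> = Re (cinner (A ?p) ?p) + Re (cinner (A ?r) ?r)"
      by (rule selfadjoint_form_add(1)[OF A]) (use p r in \<open>simp add: form_compl_def\<close>)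
    finally have e1: "Re (cinner (A (h - m0)) (h - m0)) = Re (cinner (A ?p) ?p) + Re (cinner (A ?r) ?r)" .
    have e2: "Re (cinner (A (h - m0)) (h - m0)) = Re (cinner (A h) h) + Re (cinner (A m0) m0)"
      by (rule selfadjoint_form_add(2)[OF A]) (use h m0 in \<open>simp add: form_compl_def\<close>)
    have "\<bar>Re (cinner (A ?r) ?r)\<bar> \<le> norm (A ?r) * norm ?r"
      using abs_Re_le_cmod cinner_cauchy_schwarz order_trans by blast
    also have "\<dots> \<le> K * norm ?r * norm ?r" by (intro mult_right_mono K) simp
    also have "\<dots> = K * (norm ?r)\<^sup>2" by (simp add: power2_eq_square)
    finally have "- (K * (norm ?r)\<^sup>2) \<le> Re (cinner (A ?r) ?r)" by linarith
    then show ?thesis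
      using e1 e2 maximal_uniformly_negative_compl_nonneg[OF p] M0_neg[OF m0(1)] by linarith
  qed
  moreover have "(\<lambda>n. - (K * (norm (m - v n))\<^sup>2)) \<longlonglongrightarrow> - (K * (norm (m - m))\<^sup>2)"
    by (intro tendsto_intros v(2))
  ultimately have "- (K * (norm (m - m))\<^sup>2) \<le> Re (cinner (A h) h)"
    by (intro LIMSEQ_le_const2) auto
  then show ?thesis by simp
qed

end

subsection \<open>Completions of the block operator\<close>

lemma block_op_apply: "block_op A11 A12 A21 A22 (x, y) = (A11 x + A12 y, A21 x + A22 y)"
  by (simp add: block_op_def)

lemma cinner_Pair: "cinner (a, b) (c, d) = cinner a c + cinner b d"
  by (simp add: cinner_prod_def)

lemma scaleC_Pair: "c *\<^sub>C (a, b) = (c *\<^sub>C a, c *\<^sub>C b)"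
  by (simp add: scaleC_prod_def)

lemma block_op_selfadjoint:
  assumes X: "selfadjoint_op X" and B: "bounded_clinear B" and D: "selfadjoint_op D"
  shows "selfadjoint_op (block_op X B (cadjoint B) D)"
proof -
  have Xb: "bounded_clinear X" and Xs: "\<And>x y. cinner (X x) y = cinner x (X y)"
    and Db: "bounded_clinear D" and Ds: "\<And>x y. cinner (D x) y = cinner x (D y)"
    using X D by (auto simp: selfadjoint_op_iff)
  note Cb = bounded_clinear_cadjoint[OF B]
  have eq: "block_op X B (cadjoint B) D = (\<lambda>p. (X (fst p) + B (snd p), cadjoint B (fst p) + D (snd p)))"
    by (auto simp: block_op_def)
  show ?thesis
    unfolding selfadjoint_op_iff
  proof (intro conjI allI)
    show "bounded_clinear (block_op X B (cadjoint B) D)"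
      unfolding bounded_clinear_def eq
    proof (intro conjI allI)
      show "bounded_linear (\<lambda>p. (X (fst p) + B (snd p), cadjoint B (fst p) + D (snd p)))"
        by (intro bounded_linear_Pair bounded_linear_add
            bounded_linear_compose[OF bounded_clinear_bounded[OF Xb] bounded_linear_fst]
            bounded_linear_compose[OF bounded_clinear_bounded[OF B] bounded_linear_snd]
            bounded_linear_compose[OF bounded_clinear_bounded[OF Cb] bounded_linear_fst]
            bounded_linear_compose[OF bounded_clinear_bounded[OF Db] bounded_linear_snd])
    qed (simp add: scaleC_prod_def bounded_clinear_scaleC[OF Xb] bounded_clinear_scaleC[OF B]
        bounded_clinear_scaleC[OF Cb] bounded_clinear_scaleC[OF Db] scaleC_add_right)
    show "cinner (block_op X B (cadjoint B) D p) q = cinner p (block_op X B (cadjoint B) D q)" for p q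
      unfolding eq cinner_prod_def
      by (simp add: cinner_add_left cinner_add_right Xs Ds cadjoint_cinner[OF B] cadjoint_cinner_right[OF B])
  qed
qed

lemma block_op_form:
  assumes B: "bounded_clinear B"
  shows "Re (cinner (block_op X B (cadjoint B) D (x, y)) (x, y)) =
    Re (cinner (X x) x) + 2 * Re (cinner (B y) x) + Re (cinner (D y) y)"
  using cadjoint_cinner_right[OF B, of x y] Re_cinner_commute[of x "B y"]
  by (simp add: block_op_apply cinner_Pair cinner_add_left)

section \<open>Polar decomposition of the given corner and the generalized inverse\<close>

context
  fixes X :: "'a::chilbert_space \<Rightarrow> 'a" and \<delta> :: real
  assumes X: "selfadjoint_op X" and \<delta>: "\<delta> > 0"
    and gap: "complex_of_real ` {-\<delta><..<0} \<subseteq> resolvent_set X"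
begin

private abbreviation (input) "P \<equiv> neg_proj \<delta> X"
private abbreviation (input) "J \<equiv> sign_op X"
private abbreviation (input) "R \<equiv> op_sqrt (abs_op X)"

private lemmas P_proj = neg_proj_projection[OF X \<delta> gap]
private lemmas P_comm = neg_proj_commute[OF X \<delta> gap]
private lemmas P_bounded = orthogonal_projection_bounded[OF P_proj]
private lemmas P_sym = orthogonal_projection_sym[OF P_proj]
private lemmas P_idem = orthogonal_projection_idem[OF P_proj]
private lemmas J_apply = sign_op_eq[OF X \<delta> gap, THEN fun_cong]

private lemma X_bounded: "bounded_clinear X" and X_sym: "cinner (X x) y = cinner x (X y)"
  using X by (auto simp: selfadjoint_op_iff)

lemma sign_op_selfadjoint: "selfadjoint_op J"
  unfolding selfadjoint_op_iff
proof (intro conjI allI)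
  show "bounded_clinear J"
    unfolding sign_op_eq[OF X \<delta> gap]
    by (rule bounded_clinear_diff_fun[OF bounded_clinear_id bounded_clinear_scaleR_fun[OF P_bounded]])
  show "cinner (J x) y = cinner x (J y)" for x y
    by (simp add: J_apply cinner_diff_left cinner_diff_right cinner_scaleR_left cinner_scaleR_right P_sym)
qed

private lemma J_bounded: "bounded_clinear J" and J_sym: "cinner (J x) y = cinner x (J y)"
  using sign_op_selfadjoint by (auto simp: selfadjoint_op_iff)

lemma sign_op_involution: "J (J x) = x"
  by (simp add: J_apply bounded_clinear_diff[OF P_bounded] bounded_clinear_scaleR[OF P_bounded] P_idem
      bounded_clinear_add[OF P_bounded] scaleR_2)

lemma neg_proj_sign_op: "P (J x) = - P x"
  by (simp add: J_apply bounded_clinear_diff[OF P_bounded] bounded_clinear_scaleR[OF P_bounded] P_idem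
      bounded_clinear_add[OF P_bounded] scaleR_2)

lemma sign_op_commute: "J (X x) = X (J x)"
  by (simp add: J_apply bounded_clinear_diff[OF X_bounded] bounded_clinear_scaleR[OF X_bounded] P_comm)

text \<open>By uniqueness of nonnegative roots it suffices that \<open>J X\<close> is nonnegative
  with square \<open>X\<^sup>2\<close>. Its form is that of \<open>X\<close> on the kernel of
  \<open>P\<close> and that of \<open>- X\<close> on the range, without cross terms.\<close>

lemma abs_op_eq_sign_op: "abs_op X = (\<lambda>x. J (X x))"
proof (rule abs_op_eqI[OF X])
  show "nonneg_op (\<lambda>x. J (X x))"
    unfolding nonneg_op_iff
  proof (intro conjI allI)
    show "bounded_clinear (\<lambda>x. J (X x))" by (rule bounded_clinear_comp[OF J_bounded X_bounded])
    show "cinner (J (X x)) y = cinner x (J (X y))" for x y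
      by (simp only: J_sym X_sym sign_op_commute)
    show "0 \<le> Re (cinner (J (X x)) x)" for x
    proof -
      let ?p = "P x" and ?q = "x - P x"
      have Pq: "P ?q = 0" by (simp add: bounded_clinear_diff[OF P_bounded] P_idem)
      have "cinner (X ?p) ?q = cinner (X (P ?p)) ?q" by (simp add: P_idem)
      also have "\<dots> = cinner (X ?p) (P ?q)" by (simp only: P_comm P_sym)
      finally have pq: "cinner (X ?p) ?q = 0" by (simp add: Pq)
      then have qp: "cinner (X ?q) ?p = 0"
        by (metis X_sym cinner_eq_zero_commute)
      have "J x = ?q - ?p" by (simp add: J_apply scaleR_2)
      then have "cinner (J (X x)) x = cinner (X (?q + ?p)) (?q - ?p)"
        by (simp add: J_sym)
      also have "\<dots> = cinner (X ?q) ?q - cinner (X ?p) ?p"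
        unfolding bounded_clinear_add[OF X_bounded] cinner_add_left cinner_diff_right[of _ ?q ?p] pq qp
        by simp
      finally have "Re (cinner (J (X x)) x) = Re (cinner (X ?q) ?q) - Re (cinner (X ?p) ?p)" by simp
      moreover have "0 \<le> Re (cinner (X ?q) ?q)" by (rule neg_proj_form_nonneg[OF X \<delta> gap Pq])
      moreover have "Re (cinner (X ?p) ?p) \<le> - (\<delta> / 2) * (norm ?p)\<^sup>2"
        by (rule neg_proj_form_neg[OF X \<delta> gap P_idem])
      moreover have "0 \<le> (\<delta> / 2) * (norm ?p)\<^sup>2" using \<delta> by simp
      ultimately show ?thesis by simp
    qed
  qed
  show "J (X (J (X x))) = X (X x)" for x
    by (simp only: sign_op_commute[symmetric] sign_op_involution)
qed

lemma nonneg_sqrt_abs_op: "nonneg_op R"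
  by (rule nonneg_op_sqrt[OF nonneg_abs_op[OF X]])

private lemmas R_bounded = nonneg_op_bounded[OF nonneg_sqrt_abs_op]
private lemmas R_sym = nonneg_op_sym[OF nonneg_sqrt_abs_op]

lemma sqrt_abs_op_selfadjoint: "selfadjoint_op R"
  using nonneg_sqrt_abs_op by (simp add: nonneg_op_def)

lemma sqrt_abs_op_square: "R (R x) = J (X x)"
  using op_sqrt_square[OF nonneg_abs_op[OF X], of x] by (simp add: abs_op_eq_sign_op)

lemma sqrt_abs_op_polar: "X x = J (R (R x))"
  by (simp add: sqrt_abs_op_square sign_op_involution)

lemma sqrt_abs_op_commute:
  assumes "bounded_clinear B" "\<And>x. B (X x) = X (B x)" shows "B (R x) = R (B x)"
  by (rule op_sqrt_commute[OF nonneg_abs_op[OF X] assms(1) abs_op_commute[OF X assms]])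

lemma sqrt_abs_op_neg_proj: "P (R x) = R (P x)"
  by (rule sqrt_abs_op_commute[OF P_bounded]) (simp add: P_comm)

lemma sqrt_abs_op_sign_op: "J (R x) = R (J x)"
  by (rule sqrt_abs_op_commute[OF J_bounded sign_op_commute])

lemma form_sqrt_abs_op: "cinner (X x) y = cinner (J (R x)) (R y)"
  by (simp only: sqrt_abs_op_polar[of x] sqrt_abs_op_sign_op R_sym)

lemma norm_sqrt_abs_op: "(norm (R x))\<^sup>2 = Re (cinner (X x) (J x))"
proof -
  have "cinner (X x) (J x) = cinner (R x) (R x)"
    by (simp only: form_sqrt_abs_op J_sym sqrt_abs_op_sign_op[symmetric] sign_op_involution)
  then show ?thesis by (simp add: Re_cinner_self)
qed

lemma sqrt_abs_op_eq_0_iff: "R x = 0 \<longleftrightarrow> X x = 0"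
proof
  assume "R x = 0"
  then show "X x = 0"
    by (simp add: sqrt_abs_op_polar bounded_clinear_zero[OF R_bounded] bounded_clinear_zero[OF J_bounded])
next
  assume "X x = 0"
  then show "R x = 0" using norm_sqrt_abs_op[of x] by simp
qed

lemma kernel_sqrt_abs_op: "op_kernel R = op_kernel X"
  by (simp add: op_kernel_def sqrt_abs_op_eq_0_iff)

text \<open>On the range of \<open>P\<close> the sign is \<open>- 1\<close>, so the squared norm of
  \<open>R x\<close> is minus the form of \<open>X\<close>.\<close>

lemma sqrt_abs_op_bounded_below:
  assumes "P x = x" shows "(\<delta> / 2) * (norm x)\<^sup>2 \<le> (norm (R x))\<^sup>2"
proof -
  have "J x = - x" by (simp add: J_apply assms scaleR_2)
  then show ?thesis
    using neg_proj_form_neg[OF X \<delta> gap assms] by (simp add: norm_sqrt_abs_op cinner_minus_right)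
qed

lemma sqrt_abs_op_neg_proj_inj:
  assumes "P x = x" "R x = 0" shows "x = 0"
proof -
  have "(\<delta> / 2) * (norm x)\<^sup>2 \<le> 0" using sqrt_abs_op_bounded_below[OF assms(1)] assms(2) by simp
  then show ?thesis using \<delta> by (simp add: mult_le_0_iff)
qed

text \<open>\<open>- X\<close> is coercive on the range of \<open>P\<close>, so its compression can
  be inverted there. For \<open>b = B y\<close> the solution gives the correction of
  \<open>(0, y)\<close> that makes it \<open>A\<close>-orthogonal to the negative subspace.\<close>

lemma neg_proj_solve:
  obtains x where "P x = x" "P (X x + b) = 0"
proof -
  have V: "csubspace (range P)" by (rule csubspace_range[OF P_bounded])
  have fix_P: "P v = v" if "v \<in> range P" for v using that P_idem by auto
  have "\<exists>s\<in>closure (range P). \<forall>v\<in>range P. cinner v b = cinner v (- X s)"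
  proof (rule riesz_form[where \<nu> = "\<delta> / 2" and C = "norm b" and G = "\<lambda>x. - X x", OF V])
    show "bounded_clinear (\<lambda>x. - X x)" using bounded_clinear_diff_fun[OF bounded_clinear_const_zero X_bounded] by simp
    show "\<delta> / 2 * (norm v)\<^sup>2 \<le> Re (cinner (- X v) v)" if "v \<in> range P" for v
      using neg_proj_form_neg[OF X \<delta> gap fix_P[OF that]] by (simp add: cinner_minus_left)
  qed (use \<delta> in \<open>simp_all add: cinner_minus_left cinner_minus_right X_sym cinner_add_left cinner_scaleC_left
    cinner_cauchy_schwarz_right\<close>)
  then obtain s where s: "s \<in> closure (range P)" and eq: "\<And>y. cinner (P y) b = cinner (P y) (- X s)"
    by auto
  have "range P \<subseteq> op_kernel (\<lambda>x. P x - x)" by (simp add: op_kernel_def image_subset_iff P_idem)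
  then have "s \<in> op_kernel (\<lambda>x. P x - x)"
    using s closure_minimal[OF _ closed_kernel[OF bounded_clinear_diff_fun[OF P_bounded bounded_clinear_id]]]
    by blast
  then have "P s = s" by (simp add: op_kernel_def)
  moreover have "P (X s + b) = 0"
  proof (rule cinner_eqI2)
    fix y
    have "cinner y (P (X s + b)) = cinner (P y) (X s + b)" by (simp only: P_sym)
    then show "cinner y (P (X s + b)) = cinner y 0"
      using eq[of y] by (simp add: cinner_add_right cinner_minus_right)
  qed
  ultimately show thesis by (rule that)
qed

lemma sqrt_abs_op_inj:
  assumes "x \<in> ortho_compl (op_kernel X)" "y \<in> ortho_compl (op_kernel X)" "R x = R y"
  shows "x = y"
proof -
  have "R (x - y) = 0" using assms by (simp add: bounded_clinear_diff[OF R_bounded])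
  then have "x - y \<in> op_kernel X" by (simp add: op_kernel_def sqrt_abs_op_eq_0_iff)
  moreover have "x - y \<in> ortho_compl (op_kernel X)"
    by (rule csubspace_diff[OF csubspace_ortho_compl assms(1,2)])
  ultimately have "x - y = 0" by (rule ortho_compl_disjoint)
  then show ?thesis by simp
qed

text \<open>Removing the kernel part of any preimage of \<open>b\<close> gives the required value.
  It is the only one: the kernel summand \<open>k\<close> allowed by the definition equals
  \<open>R (x - y)\<close> and satisfies \<open>R k = 0\<close>, so \<open>k = 0\<close> by symmetry
  of \<open>R\<close>.\<close>

lemma
  assumes "b \<in> range R"
  shows mp_inv_sqrt_abs_in: "mp_inv_sqrt_abs X b \<in> ortho_compl (op_kernel X)"
    and mp_inv_sqrt_abs_inverse: "R (mp_inv_sqrt_abs X b) = b"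
proof -
  let ?K = "op_kernel X"
  have K: "csubspace ?K" "closed ?K" by (rule csubspace_kernel[OF X_bounded], rule closed_kernel[OF X_bounded])
  obtain x0 where x0: "b = R x0" using assms by auto
  define x where "x = x0 - orth_proj ?K x0"
  have x: "x \<in> ortho_compl ?K" unfolding x_def by (rule orth_proj_compl[OF K])
  have "X (orth_proj ?K x0) = 0" using orth_proj_in[OF K, of x0] by (simp add: op_kernel_def)
  then have "R (orth_proj ?K x0) = 0" by (simp add: sqrt_abs_op_eq_0_iff)
  then have Rx: "R x = b" by (simp add: x_def x0 bounded_clinear_diff[OF R_bounded])
  have "mp_inv_sqrt_abs X b = x"
    unfolding mp_inv_sqrt_abs_def
  proof (rule the_equality)
    show "x \<in> ortho_compl ?K \<and> (\<exists>k\<in>?K. b = R x + k)"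
      using x Rx csubspace_zero[OF K(1)] by (auto intro!: bexI[of _ 0])
    fix y assume "y \<in> ortho_compl ?K \<and> (\<exists>k\<in>?K. b = R y + k)"
    then obtain k where y: "y \<in> ortho_compl ?K" and k: "k \<in> ?K" "b = R y + k" by blast
    have kR: "k = R (x - y)" using k(2) Rx by (simp add: bounded_clinear_diff[OF R_bounded])
    have "R k = 0" using k(1) by (simp add: op_kernel_def sqrt_abs_op_eq_0_iff)
    moreover have "cinner k k = cinner (x - y) (R k)" by (subst (1) kR) (rule R_sym)
    ultimately have "k = 0" by (simp add: cinner_self_zero)
    then have "R x = R y" using k(2) Rx by simp
    then show "y = x" using sqrt_abs_op_inj[OF x y] by simp
  qed
  then show "mp_inv_sqrt_abs X b \<in> ortho_compl (op_kernel X)" "R (mp_inv_sqrt_abs X b) = b"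
    using x Rx by auto
qed

lemma mp_inv_sqrt_abs_closure: "b \<in> range R \<Longrightarrow> mp_inv_sqrt_abs X b \<in> closure (range R)"
  using mp_inv_sqrt_abs_in
  by (intro closure_range_eq_ortho_compl_kernel[OF sqrt_abs_op_selfadjoint]) (simp add: kernel_sqrt_abs_op)

text \<open>\<open>J\<close> commutes with \<open>X\<close>, so it preserves the kernel and the
  orthogonal complement. This supplies the approximations of \<open>J (S y)\<close> by vectors
  \<open>R x\<close>.\<close>

lemma sign_op_closure_range:
  assumes "w \<in> ortho_compl (op_kernel X)" shows "J w \<in> closure (range R)"
proof (rule closure_range_eq_ortho_compl_kernel[OF sqrt_abs_op_selfadjoint])
  have "cinner (J w) k = 0" if "X k = 0" for k
  proof -
    have "X (J k) = 0" using that by (simp add: sign_op_commute[symmetric] bounded_clinear_zero[OF J_bounded])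
    then show ?thesis using assms by (simp add: J_sym ortho_compl_def op_kernel_def)
  qed
  then show "J w \<in> ortho_compl (op_kernel R)"
    by (simp add: ortho_compl_def op_kernel_def sqrt_abs_op_eq_0_iff)
qed

text \<open>Boundedness is a closed graph argument: \<open>\<langle>S y, R x\<rangle> = \<langle>B y, x\<rangle>\<close> is bounded in \<open>y\<close> for each \<open>x\<close>.\<close>

lemma bounded_clinear_mp_inv_comp:
  fixes B :: "'b::chilbert_space \<Rightarrow> 'a"
  assumes B: "bounded_clinear B" and range: "range B \<subseteq> range R"
  shows "bounded_clinear (mp_inv_sqrt_abs X \<circ> B)"
proof -
  define S where "S = mp_inv_sqrt_abs X \<circ> B"
  have Bin: "B y \<in> range R" for y using range by blast
  have S_in: "S y \<in> ortho_compl (op_kernel X)" for y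
    unfolding S_def comp_def by (rule mp_inv_sqrt_abs_in[OF Bin])
  have RS: "R (S y) = B y" for y
    unfolding S_def comp_def by (rule mp_inv_sqrt_abs_inverse[OF Bin])
  have S_cl: "S y \<in> closure (range R)" for y
    unfolding S_def comp_def by (rule mp_inv_sqrt_abs_closure[OF Bin])
  have S_form: "cinner (B y) x = cinner (S y) (R x)" for x y
    unfolding RS[symmetric] by (rule R_sym)
  \<comment> \<open>The functionals are normalised by \<open>norm (R x) \<le> 1\<close> because
    \<open>norm (S y)\<close> is then a bound at each \<open>y\<close>, although the vectors
    \<open>x\<close> themselves may be unbounded.\<close>
  have "\<exists>C. \<forall>f\<in>{\<lambda>y. cinner (B y) x |x. norm (R x) \<le> 1}. \<forall>y. norm (f y) \<le> C * norm y"
  proof (rule uniform_boundedness)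
    fix f assume "f \<in> {\<lambda>y. cinner (B y) x |x. norm (R x) \<le> 1}"
    then obtain x where f: "f = (\<lambda>y. cinner (B y) x)" by blast
    show "bounded_linear f"
      unfolding f
      by (rule bounded_linear_compose[OF bounded_bilinear.bounded_linear_left[OF bounded_bilinear_cinner]
            bounded_clinear_bounded[OF B]])
  next
    fix y
    have "norm (cinner (B y) x) \<le> norm (S y)" if "norm (R x) \<le> 1" for x
    proof -
      have "norm (cinner (B y) x) \<le> norm (S y) * norm (R x)"
        unfolding S_form by (rule cinner_cauchy_schwarz)
      also have "\<dots> \<le> norm (S y) * 1" by (intro mult_left_mono that) simp
      finally show ?thesis by simp
    qed
    then show "\<exists>C. \<forall>f\<in>{\<lambda>y. cinner (B y) x |x. norm (R x) \<le> 1}. norm (f y) \<le> C"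
      by (intro exI[of _ "norm (S y)"]) auto
  qed
  then obtain C where "\<forall>f\<in>{\<lambda>y. cinner (B y) x |x. norm (R x) \<le> 1}. \<forall>y. norm (f y) \<le> C * norm y" ..
  then have C: "cmod (cinner (B y) x) \<le> C * norm y" if "norm (R x) \<le> 1" for x y
    using that by auto
  have C': "cmod (cinner (S y) (R x)) \<le> C * norm y * norm (R x)" for x y
  proof (cases "R x = 0")
    case False
    define r where "r = inverse (norm (R x))"
    have r: "0 < r" "r * norm (R x) = 1" using False by (auto simp: r_def)
    have "cmod (cinner (B y) (r *\<^sub>R x)) \<le> C * norm y"
      by (rule C) (use r in \<open>simp add: bounded_clinear_scaleR[OF R_bounded]\<close>)
    then have "r * cmod (cinner (S y) (R x)) \<le> C * norm y"
      using r by (simp add: cinner_scaleR_right norm_mult S_form)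
    then have "norm (R x) * (r * cmod (cinner (S y) (R x))) \<le> norm (R x) * (C * norm y)"
      by (rule mult_left_mono) simp
    moreover have "norm (R x) * (r * cmod (cinner (S y) (R x))) = (r * norm (R x)) * cmod (cinner (S y) (R x))"
      by (simp only: mult_ac)
    ultimately have "cmod (cinner (S y) (R x)) \<le> norm (R x) * (C * norm y)" unfolding r(2) by simp
    then show ?thesis by (simp only: mult_ac)
  qed simp
  have bound: "norm (S y) \<le> C * norm y" for y
  proof -
    \<comment> \<open>\<open>S y\<close> lies only in the closure of the range of \<open>R\<close>,
      so \<open>C'\<close> is tested along an approximating sequence.\<close>
    obtain u where "\<And>n. u n \<in> range R" and u: "u \<longlonglongrightarrow> S y"
      using S_cl[of y] unfolding closure_sequential by blast
    then have "cmod (cinner (S y) (u n)) \<le> C * norm y * norm (u n)" for n using C' by (metis rangeE)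
    then have "cmod (cinner (S y) (S y)) \<le> C * norm y * norm (S y)"
      by (intro LIMSEQ_le[OF tendsto_norm[OF tendsto_cinner[OF tendsto_const u]]
            tendsto_mult[OF tendsto_const tendsto_norm[OF u]]]) blast
    then have "norm (S y) * norm (S y) \<le> (C * norm y) * norm (S y)"
      by (simp only: cinner_self norm_of_real) (simp add: power2_eq_square)
    moreover have "0 \<le> C * norm y" using C[of 0 y] by (simp add: bounded_clinear_zero[OF R_bounded])
    ultimately show ?thesis by (cases "S y = 0") auto
  qed
  have "bounded_clinear S"
  proof (rule bounded_clinearI[OF _ _ bound])
    show "S (x + y) = S x + S y" for x y
      by (rule sqrt_abs_op_inj[OF S_in csubspace_add[OF csubspace_ortho_compl S_in S_in]])
        (simp add: bounded_clinear_add[OF R_bounded] bounded_clinear_add[OF B] RS)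
    show "S (c *\<^sub>C x) = c *\<^sub>C S x" for c x
      by (rule sqrt_abs_op_inj[OF S_in csubspace_scaleC[OF csubspace_ortho_compl S_in]])
        (simp add: bounded_clinear_scaleC[OF R_bounded] bounded_clinear_scaleC[OF B] RS)
  qed
  then show ?thesis by (simp add: S_def)
qed

section \<open>The form of a completion\<close>

context
  fixes B :: "'b::chilbert_space \<Rightarrow> 'a" and D :: "'b \<Rightarrow> 'b"
  assumes B: "bounded_clinear B" and D: "selfadjoint_op D"
begin

private abbreviation (input) "A \<equiv> block_op X B (cadjoint B) D"
private abbreviation (input) "M0 \<equiv> {(x, 0 :: 'b) |x. P x = x}"

private lemma A_selfadjoint: "selfadjoint_op A"
  by (rule block_op_selfadjoint[OF X B D])

private lemma A_form: "Re (cinner (A (x, y)) (x, y)) =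
    Re (cinner (X x) x) + 2 * Re (cinner (B y) x) + Re (cinner (D y) y)"
  by (rule block_op_form[OF B])

text \<open>Since \<open>J\<close> is a symmetric involution, the cross terms of the square in
  \<open>R x + J w\<close> are \<open>cinner (R x) w\<close> and its conjugate, which are those of
  \<open>B y\<close> with \<open>x\<close>. Any preimage \<open>w\<close> of \<open>B y\<close> will
  do.\<close>

lemma block_op_form_square:
  assumes w: "R w = B y"
  shows "Re (cinner (A (x, y)) (x, y)) = Re (cinner (J (R x + J w)) (R x + J w)) +
    Re (cinner (D y) y) - Re (cinner (J w) w)"
proof -
  have "cinner (B y) x = cinner w (R x)" unfolding w[symmetric] by (rule R_sym)
  moreover have "cinner (X x) x = cinner (J (R x)) (R x)" by (rule form_sqrt_abs_op)
  moreover have "cinner (J (R x + J w)) (R x + J w) =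
      cinner (J (R x)) (R x) + cinner (R x) w + cinner w (R x) + cinner (J w) w"
    by (simp add: bounded_clinear_add[OF J_bounded] sign_op_involution cinner_add_left
        cinner_add_right J_sym)
  ultimately show ?thesis using Re_cinner_commute[of w "R x"] by (simp add: A_form)
qed

lemma block_op_compl_iff: "(x, y) \<in> form_compl A M0 \<longleftrightarrow> P (X x + B y) = 0"
proof
  assume *: "(x, y) \<in> form_compl A M0"
  show "P (X x + B y) = 0"
  proof (rule cinner_eqI)
    fix z
    have "(P z, 0) \<in> M0" by (simp add: P_idem)
    then have "cinner (A (x, y)) (P z, 0) = 0" using * unfolding form_compl_def by blast
    then show "cinner (P (X x + B y)) z = cinner 0 z"
      by (simp add: block_op_apply cinner_Pair P_sym)
  qed
next
  assume *: "P (X x + B y) = 0"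
  have "cinner (X x + B y) v = 0" if "P v = v" for v
    using * P_sym[of "X x + B y" v] that by simp
  then show "(x, y) \<in> form_compl A M0"
    by (auto simp: form_compl_def block_op_apply cinner_Pair)
qed

lemma csubspace_block_neg: "csubspace M0"
  by (auto simp: csubspace_def scaleC_Pair zero_prod_def bounded_clinear_zero[OF P_bounded]
      bounded_clinear_add[OF P_bounded] bounded_clinear_scaleC[OF P_bounded])

lemma block_neg_form:
  assumes "m \<in> M0" shows "Re (cinner (A m) m) \<le> - (\<delta> / 2) * (norm m)\<^sup>2"
proof -
  obtain x where "m = (x, 0)" "P x = x" using assms by blast
  then show ?thesis
    using neg_proj_form_neg[OF X \<delta> gap, of x] selfadjoint_op_iff[of D] D
    by (simp add: A_form bounded_clinear_zero[OF B] norm_Pair)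
qed

text \<open>\<open>X x + B y = R (J (R x) + w)\<close>; \<open>P\<close> passes through
  \<open>R\<close>, which is injective on the range of \<open>P\<close>, and
  \<open>P J = - P\<close>. The conclusion says that \<open>P\<close> annihilates
  \<open>R x + J w\<close>, the vector in the completed square.\<close>

lemma neg_proj_solution:
  assumes w: "R w = B y" and sol: "P (X x + B y) = 0"
  shows "P (R x) = P w"
proof -
  have "X x + B y = R (J (R x) + w)"
    by (simp only: sqrt_abs_op_polar[of x] sqrt_abs_op_sign_op
        w[symmetric] bounded_clinear_add[OF R_bounded])
  then have "R (P (J (R x) + w)) = 0" using sol by (simp add: sqrt_abs_op_neg_proj)
  then have "P (J (R x) + w) = 0"
    by (rule sqrt_abs_op_neg_proj_inj[OF P_idem])
  then show ?thesis
    by (simp add: bounded_clinear_add[OF P_bounded] neg_proj_sign_op)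
qed

text \<open>A vector of a uniformly negative extension \<open>N\<close> is corrected within the
  negative subspace to become \<open>A\<close>-orthogonal to it. The completed square shows that the
  form is nonnegative there, so the corrected vector is zero and the original one was in the
  subspace already.\<close>

lemma condition_Max_if_form_le:
  assumes S: "\<And>y. R (S y) = B y" and le: "\<And>y. Re (cinner (J (S y)) (S y)) \<le> Re (cinner (D y) y)"
  shows "condition_Max A"
proof -
  have neg: "uniformly_negative A M0"
    unfolding uniformly_negative_def
    using csubspace_block_neg block_neg_form \<delta> by (intro conjI exI[of _ "\<delta> / 2"]) auto
  have "N = M0" if N: "uniformly_negative A N" and "M0 \<subseteq> N" for N
  proof (rule antisym[OF _ \<open>M0 \<subseteq> N\<close>], rule subsetI)
    obtain \<nu> where sub: "csubspace N" and \<nu>: "\<nu> > 0"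
      and Nneg: "\<And>f. f \<in> N \<Longrightarrow> Re (cinner (A f) f) \<le> - \<nu> * (norm f)\<^sup>2"
      using N by (auto simp: uniformly_negative_def)
    fix n assume n: "n \<in> N"
    obtain a y where ay: "n = (a, y)" by (cases n)
    obtain z where z: "P z = z" "P (X z + (X a + B y)) = 0"
      using neg_proj_solve by blast
    let ?x = "a + z" and ?w = "S y"
    have "(z, 0) \<in> N" using z(1) \<open>M0 \<subseteq> N\<close> by blast
    then have xN: "(?x, y) \<in> N" using csubspace_add[OF sub n] by (force simp: ay)
    have "P (X ?x + B y) = 0" using z(2) by (simp add: bounded_clinear_add[OF X_bounded] algebra_simps)
    then have "P (R ?x) = P ?w" by (rule neg_proj_solution[OF S])
    then have "P (R ?x + J ?w) = 0"
      by (simp add: bounded_clinear_add[OF P_bounded] neg_proj_sign_op)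
    then have J_fix: "J (R ?x + J ?w) = R ?x + J ?w" by (simp add: J_apply)
    have "0 \<le> Re (cinner (A (?x, y)) (?x, y))"
      using le[of y] zero_le_power2[of "norm (R ?x + J ?w)"]
      unfolding block_op_form_square[OF S] J_fix Re_cinner_self by linarith
    then have "\<nu> * (norm (?x, y))\<^sup>2 \<le> 0" using Nneg[OF xN] by simp
    then have "(?x, y) = 0" using \<nu> by (simp add: mult_le_0_iff)
    then have "y = 0" "a = - z" by (auto simp: zero_prod_def eq_neg_iff_add_eq_0)
    then show "n \<in> M0" using z(1) by (simp add: ay bounded_clinear_minus[OF P_bounded])
  qed
  then have "maximal_uniformly_negative A M0"
    unfolding maximal_uniformly_negative_def using neg by blast
  then show ?thesis unfolding condition_Max_def by (intro exI[of _ M0]) auto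
qed

context
  assumes Max: "condition_Max A"
begin

text \<open>This is where it matters that \<open>M\<close> is inside the first summand: for
  \<open>(u, 0)\<close> in \<open>M\<close> that is \<open>A\<close>-orthogonal to the negative
  subspace, \<open>P (X u) = 0\<close>, hence \<open>P u = 0\<close>, and the form of
  \<open>X\<close> is nonnegative at \<open>u\<close>.\<close>

lemma condition_Max_form_nonneg:
  assumes "P (X x + B y) = 0" shows "0 \<le> Re (cinner (A (x, y)) (x, y))"
proof -
  obtain M where M1: "M \<subseteq> UNIV \<times> {0}" and M: "maximal_uniformly_negative A M"
    using Max by (auto simp: condition_Max_def)
  show ?thesis
  proof (rule form_compl_nonneg_transfer[OF A_selfadjoint M csubspace_block_neg])
    show "Re (cinner (A m) m) \<le> 0" if "m \<in> M0" for m
    proof -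
      have "0 \<le> (\<delta> / 2) * (norm m)\<^sup>2" using \<delta> by simp
      then show ?thesis using block_neg_form[OF that] by simp
    qed
    show "(x, y) \<in> form_compl A M0" using assms by (simp only: block_op_compl_iff)
    fix m assume "m \<in> M" and m: "m \<in> form_compl A M0"
    then obtain u where u: "m = (u, 0)" using M1 by blast
    have "P (X u) = 0"
      using m unfolding u block_op_compl_iff by (simp add: bounded_clinear_zero[OF B])
    then have "R (R (P u)) = 0"
      by (simp add: sqrt_abs_op_square P_comm bounded_clinear_zero[OF J_bounded])
    then have "R (P u) = 0"
      by (rule sqrt_abs_op_neg_proj_inj[rotated]) (simp add: sqrt_abs_op_neg_proj P_idem)
    then have "P u = 0" by (rule sqrt_abs_op_neg_proj_inj[OF P_idem])
    then show "0 \<le> Re (cinner (A m) m)"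
      using neg_proj_form_nonneg[OF X \<delta> gap, of u] D
      by (simp add: u A_form bounded_clinear_zero[OF B])
  qed
qed

lemma condition_Max_range: "B y \<in> range R"
proof -
  obtain z where z: "P z = z" "P (X z + B y) = 0" using neg_proj_solve by blast
  define c where "c = Re (cinner (A (z, y)) (z, y))"
  have c: "0 \<le> c" unfolding c_def by (rule condition_Max_form_nonneg[OF z(2)])
  have bound: "cmod (cinner (B y) x) \<le> sqrt c * norm (R x)" if Px: "P x = 0" for x
  proof -
    let ?k = "(cmod (cinner (B y) x))\<^sup>2"
    have PX: "P (X v) = 0" if "P v = 0" for v
      using that by (simp add: P_comm[symmetric] bounded_clinear_zero[OF X_bounded])
    \<comment> \<open>Adding a \<open>v\<close> annihilated by \<open>P\<close> to \<open>z\<close>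
      keeps the constraint, and the cross term with \<open>z\<close> vanishes. The result is a
      quadratic inequality in \<open>v\<close> with constant term \<open>c\<close>.\<close>
    have quad: "0 \<le> Re (cinner (X v) v) + 2 * Re (cinner (B y) v) + c" if Pv: "P v = 0" for v
    proof -
      have "P (X (v + z) + B y) = P (X v) + P (X z + B y)"
        by (simp add: bounded_clinear_add[OF X_bounded] bounded_clinear_add[OF P_bounded])
      then have "P (X (v + z) + B y) = 0" using PX[OF Pv] z(2) by simp
      then have "0 \<le> Re (cinner (A (v + z, y)) (v + z, y))" by (rule condition_Max_form_nonneg)
      moreover have "cinner (X v) z = cinner (P (X v)) z" unfolding P_sym z(1) ..
      then have "cinner (X v) z = 0" using PX[OF Pv] by simp
      then have "Re (cinner (X (v + z)) (v + z)) = Re (cinner (X v) v) + Re (cinner (X z) z)"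
        by (rule selfadjoint_form_add(1)[OF X])
      ultimately show ?thesis by (simp add: A_form c_def cinner_add_right)
    qed
    have "?k \<le> c * (norm (R x))\<^sup>2"
    proof (rule nonneg_quadratic_bound[OF c])
      fix t :: real
      \<comment> \<open>This phase turns the linear term into \<open>- 2 * t * ?k\<close>, as the
        discriminant lemma expects.\<close>
      define a where "a = - (of_real t * cinner (B y) x)"
      have Pv: "P (a *\<^sub>C x) = 0" by (simp add: bounded_clinear_scaleC[OF P_bounded] Px)
      have "J (a *\<^sub>C x) = a *\<^sub>C x" by (simp add: J_apply Pv)
      then have "Re (cinner (X (a *\<^sub>C x)) (a *\<^sub>C x)) = (norm (R (a *\<^sub>C x)))\<^sup>2"
        using norm_sqrt_abs_op[of "a *\<^sub>C x"] by simp
      also have "\<dots> = t\<^sup>2 * ?k * (norm (R x))\<^sup>2"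
        by (simp add: bounded_clinear_scaleC[OF R_bounded] norm_scaleC a_def norm_mult power_mult_distrib)
      finally have 1: "Re (cinner (X (a *\<^sub>C x)) (a *\<^sub>C x)) = t\<^sup>2 * ?k * (norm (R x))\<^sup>2" .
      have "cinner (B y) (a *\<^sub>C x) = of_real (- t * ?k)"
        unfolding cinner_scaleC_right of_real_mult complex_norm_square by (simp add: a_def mult_ac)
      then have 2: "Re (cinner (B y) (a *\<^sub>C x)) = - t * ?k" by (simp only: Re_complex_of_real)
      show "0 \<le> c - 2 * t * ?k + t\<^sup>2 * ?k * (norm (R x))\<^sup>2"
        using quad[OF Pv] unfolding 1 2 by simp
    qed simp_all
    then have "?k \<le> (sqrt c * norm (R x))\<^sup>2" using c by (simp add: power_mult_distrib)
    then show ?thesis by (rule power2_le_imp_le) (use c in simp)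
  qed
  \<comment> \<open>The first summand bounds the part in the range of \<open>P\<close>, by the lower
    bound for \<open>R\<close> there; the second is the discriminant bound on the kernel of
    \<open>P\<close>.\<close>
  define K where "K = norm (B y) * sqrt (2 / \<delta>) + sqrt c"
  have "cmod (cinner x (B y)) \<le> K * norm (R x)" for x
  proof -
    let ?p = "P x" and ?q = "x - P x"
    have "(norm ?p)\<^sup>2 \<le> (2 / \<delta>) * (norm (R ?p))\<^sup>2"
      using sqrt_abs_op_bounded_below[OF P_idem, of x] \<delta> by (simp add: field_simps)
    also have "\<dots> = (sqrt (2 / \<delta>) * norm (R ?p))\<^sup>2" using \<delta> by (simp add: power_mult_distrib)
    finally have "norm ?p \<le> sqrt (2 / \<delta>) * norm (R ?p)" by (rule power2_le_imp_le) (use \<delta> in simp)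
    also have "\<dots> \<le> sqrt (2 / \<delta>) * norm (R x)"
      unfolding sqrt_abs_op_neg_proj[symmetric]
      by (rule mult_left_mono[OF orthogonal_projection_norm_le[OF P_proj]]) (use \<delta> in simp)
    finally have p: "norm ?p \<le> sqrt (2 / \<delta>) * norm (R x)" .
    have "R ?q = R x - P (R x)" by (simp add: bounded_clinear_diff[OF R_bounded] sqrt_abs_op_neg_proj)
    moreover have "norm (R x - P (R x)) \<le> norm (R x)"
      by (rule power2_le_imp_le) (use orthogonal_projection_norm_split[OF P_proj, of "R x"] in simp_all)
    ultimately have q: "norm (R ?q) \<le> norm (R x)" by simp
    have "P ?q = 0" by (simp add: bounded_clinear_diff[OF P_bounded] P_idem)
    then have "cmod (cinner (B y) ?q) \<le> sqrt c * norm (R ?q)" by (rule bound)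
    also have "\<dots> \<le> sqrt c * norm (R x)" by (rule mult_left_mono[OF q]) (use c in simp)
    finally have 1: "cmod (cinner (B y) ?q) \<le> sqrt c * norm (R x)" .
    have "cmod (cinner (B y) ?p) \<le> norm (B y) * norm ?p" by (rule cinner_cauchy_schwarz)
    also have "\<dots> \<le> norm (B y) * (sqrt (2 / \<delta>) * norm (R x))" by (rule mult_left_mono[OF p]) simp
    finally have 2: "cmod (cinner (B y) ?p) \<le> norm (B y) * (sqrt (2 / \<delta>) * norm (R x))" .
    have "cmod (cinner x (B y)) = cmod (cinner (B y) ?p + cinner (B y) ?q)"
      by (simp add: norm_cinner_commute[of x] cinner_diff_right)
    also have "\<dots> \<le> cmod (cinner (B y) ?p) + cmod (cinner (B y) ?q)" by (rule norm_triangle_ineq)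
    also have "\<dots> \<le> norm (B y) * (sqrt (2 / \<delta>) * norm (R x)) + sqrt c * norm (R x)"
      by (rule add_mono[OF 2 1])
    also have "\<dots> = K * norm (R x)" by (simp only: K_def distrib_right mult.assoc)
    finally show ?thesis .
  qed
  then show ?thesis by (rule range_if_form_bounded[OF sqrt_abs_op_selfadjoint])
qed

text \<open>Nonnegativity under the constraint is evaluated where the square is negligible, that is
  along \<open>R (v n)\<close> tending to \<open>- J w\<close>.\<close>

lemma condition_Max_form_le:
  assumes w: "R w = B y" and w_in: "w \<in> ortho_compl (op_kernel X)"
  shows "Re (cinner (J w) w) \<le> Re (cinner (D y) y)"
proof -
  obtain z where z: "P z = z" "P (X z + B y) = 0" using neg_proj_solve by blast
  have Rz: "R z = P w"
    using neg_proj_solution[OF w z(2)] by (simp add: sqrt_abs_op_neg_proj z(1))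
  have "J w \<in> closure (range R)" by (rule sign_op_closure_range[OF w_in])
  then obtain u where "\<And>n. u n \<in> range R" and u: "u \<longlonglongrightarrow> J w" unfolding closure_sequential by blast
  then have "\<forall>n. \<exists>x. u n = R x" by blast
  then obtain x where x: "\<And>n. u n = R (x n)" by metis
  \<comment> \<open>The component in the range of \<open>P\<close> is hit exactly by
    \<open>R z = P w\<close>; the other one is approximated by vectors annihilated by
    \<open>P\<close>, which leave the constraint intact.\<close>
  define v where "v n = z - (x n - P (x n))" for n
  have Rv: "R (v n) = P w - (u n - P (u n))" for n
    by (simp add: v_def bounded_clinear_diff[OF R_bounded] Rz x sqrt_abs_op_neg_proj)
  have Pv: "P (X (v n) + B y) = 0" for n
  proof -
    have "P (X (v n) + B y) = P (X z + B y) - (P (X (x n)) - P (X (P (x n))))"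
      by (simp add: v_def bounded_clinear_diff[OF X_bounded] bounded_clinear_diff[OF P_bounded]
          bounded_clinear_add[OF P_bounded])
    also have "\<dots> = 0" by (simp add: z(2) P_comm P_idem)
    finally show ?thesis .
  qed
  let ?f = "\<lambda>r. Re (cinner (J (r + J w)) (r + J w)) + Re (cinner (D y) y) - Re (cinner (J w) w)"
  have "0 \<le> ?f (R (v n))" for n
    using condition_Max_form_nonneg[OF Pv] unfolding block_op_form_square[OF w] .
  moreover have "(\<lambda>n. R (v n)) \<longlonglongrightarrow> P w - (J w - P (J w))"
    unfolding Rv by (intro tendsto_intros bounded_clinear_tendsto[OF P_bounded] u)
  then have lim: "(\<lambda>n. R (v n)) \<longlonglongrightarrow> - J w" by (simp add: neg_proj_sign_op)
  have "(\<lambda>n. ?f (R (v n))) \<longlonglongrightarrow> ?f (- J w)"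
    by (intro tendsto_intros tendsto_cinner bounded_clinear_tendsto[OF J_bounded] lim)
  ultimately have "0 \<le> ?f (- J w)" by (intro LIMSEQ_le_const) auto
  then show ?thesis by simp
qed

end

end

end

theorem theorem2p2:
  fixes A11 :: "'h1::chilbert_space \<Rightarrow> 'h1"
    and A12 :: "'h2::chilbert_space \<Rightarrow> 'h1"
    and A21 :: "'h1 \<Rightarrow> 'h2"
    and J :: "'h1 \<Rightarrow> 'h1"
    and S :: "'h2 \<Rightarrow> 'h1"
    and \<delta> :: real
  assumes "selfadjoint_op A11"
    and "bounded_clinear A12"
    and "A21 = cadjoint A12"
    and "\<delta> > 0"
    and "complex_of_real ` {-\<delta><..<0} \<subseteq> resolvent_set A11"
    and J_eq: "J = sign_op A11"
    and S_eq: "S = mp_inv_sqrt_abs A11 \<circ> A12"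
  shows "((\<exists>A22 A. selfadjoint_op A22 \<and> A = block_op A11 A12 A21 A22 \<and>
            bounded_clinear A \<and> condition_Max A)
           \<longleftrightarrow> range A12 \<subseteq> range (op_sqrt (abs_op A11))) \<and>
         (range A12 \<subseteq> range (op_sqrt (abs_op A11)) \<longrightarrow>
           range A12 \<subseteq> mp_inv_sqrt_abs_dom A11 \<and> bounded_clinear S \<and>
           cadjoint S \<circ> J \<circ> S \<in> solution_set A11 A12 A21 \<and>
           (\<forall>A22 \<in> solution_set A11 A12 A21. op_le (cadjoint S \<circ> J \<circ> S) A22) \<and>
           solution_set A11 A12 A21 =
             {A22. bounded_clinear A22 \<and>
               (\<exists>Y. nonneg_op Y \<and> A22 = (\<lambda>x. (cadjoint S \<circ> J \<circ> S) x + Y x))})"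
proof -
  have X: "selfadjoint_op A11" and B: "bounded_clinear A12" and \<delta>: "\<delta> > 0"
    and gap: "complex_of_real ` {-\<delta><..<0} \<subseteq> resolvent_set A11"
    and A21: "A21 = cadjoint A12"
    by (fact assms)+
  let ?R = "op_sqrt (abs_op A11)" and ?T = "cadjoint S \<circ> J \<circ> S"
  let ?sol = "solution_set A11 A12 A21"
  have sol_range: "range A12 \<subseteq> range ?R" if "D \<in> ?sol" for D
    using that condition_Max_range[OF X \<delta> gap B] by (auto simp: solution_set_def A21)
  have block_bounded: "bounded_clinear (block_op A11 A12 A21 D)" if "selfadjoint_op D" for D
    using block_op_selfadjoint[OF X B that] by (simp add: A21 selfadjoint_op_iff)
  \<comment> \<open>Proved before the equivalence, whose backward direction takes \<open>?T\<close>
    as the completing entry.\<close>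
  have ii: "range A12 \<subseteq> mp_inv_sqrt_abs_dom A11 \<and> bounded_clinear S \<and> ?T \<in> ?sol \<and>
      (\<forall>A22\<in>?sol. op_le ?T A22) \<and>
      ?sol = {A22. bounded_clinear A22 \<and> (\<exists>Y. nonneg_op Y \<and> A22 = (\<lambda>x. ?T x + Y x))}"
    if range: "range A12 \<subseteq> range ?R"
  proof -
    have in_range: "A12 y \<in> range ?R" for y using range by blast
    have RS: "?R (S y) = A12 y" and S_in: "S y \<in> ortho_compl (op_kernel A11)" for y
      unfolding S_eq comp_def
      by (rule mp_inv_sqrt_abs_inverse[OF X \<delta> gap in_range], rule mp_inv_sqrt_abs_in[OF X \<delta> gap in_range])
    have S: "bounded_clinear S"
      unfolding S_eq by (rule bounded_clinear_mp_inv_comp[OF X \<delta> gap B range])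
    have Jb: "bounded_clinear J" and Js: "\<And>x y. cinner (J x) y = cinner x (J y)"
      using sign_op_selfadjoint[OF X \<delta> gap] by (auto simp: selfadjoint_op_iff J_eq)
    have T_form: "cinner (?T x) y = cinner (J (S x)) (S y)" for x y
      by (simp add: cadjoint_cinner_right[OF S])
    have T_sym: "cinner (?T x) y = cinner x (?T y)" for x y
      by (simp only: T_form Js) (simp add: cadjoint_cinner[OF S])
    have T_bounded: "bounded_clinear ?T"
      unfolding comp_def
      by (rule bounded_clinear_comp[OF bounded_clinear_cadjoint[OF S] bounded_clinear_comp[OF Jb S]])
    have T: "selfadjoint_op ?T" unfolding selfadjoint_op_iff using T_bounded T_sym by blast
    \<comment> \<open>All claims about the solution set follow from this criterion: reflexivity puts
      \<open>?T\<close> into it, the criterion itself makes \<open>?T\<close> smallest, and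
      \<open>Y = D - ?T\<close> describes the interval.\<close>
    have sol_iff: "D \<in> ?sol \<longleftrightarrow> op_le ?T D" if D: "selfadjoint_op D" for D
    proof
      assume "D \<in> ?sol"
      then have "condition_Max (block_op A11 A12 (cadjoint A12) D)" by (simp add: solution_set_def A21)
      from condition_Max_form_le[OF X \<delta> gap B D this RS S_in] show "op_le ?T D"
        unfolding op_le_def T_form unfolding J_eq by blast
    next
      assume "op_le ?T D"
      then have "Re (cinner (sign_op A11 (S y)) (S y)) \<le> Re (cinner (D y) y)" for y
        unfolding op_le_def T_form unfolding J_eq by blast
      then have "condition_Max (block_op A11 A12 (cadjoint A12) D)"
        by (rule condition_Max_if_form_le[OF X \<delta> gap B D RS])
      then show "D \<in> ?sol" using D by (simp add: solution_set_def A21)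
    qed
    have sol_selfadjoint: "selfadjoint_op D" if "D \<in> ?sol" for D
      using that by (simp add: solution_set_def)
    have dom: "range A12 \<subseteq> mp_inv_sqrt_abs_dom A11"
    proof
      fix b assume "b \<in> range A12"
      then obtain x where "b = ?R x + 0" using range by auto
      moreover have "0 \<in> op_kernel A11"
        using X by (intro csubspace_zero csubspace_kernel) (simp add: selfadjoint_op_iff)
      ultimately show "b \<in> mp_inv_sqrt_abs_dom A11" unfolding mp_inv_sqrt_abs_dom_def by blast
    qed
    have "?sol = {A22. bounded_clinear A22 \<and> (\<exists>Y. nonneg_op Y \<and> A22 = (\<lambda>x. ?T x + Y x))}"
    proof (intro set_eqI iffI)
      fix D assume D: "D \<in> ?sol"
      then have Db: "bounded_clinear D" and Ds: "\<And>x y. cinner (D x) y = cinner x (D y)"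
        using sol_selfadjoint by (auto simp: selfadjoint_op_iff)
      have "op_le ?T D" using D sol_iff sol_selfadjoint by blast
      then have "nonneg_op (\<lambda>x. D x - ?T x)"
        unfolding nonneg_op_iff op_le_def
        by (intro conjI allI bounded_clinear_diff_fun Db T_bounded)
          (simp_all only: cinner_diff_left cinner_diff_right Ds T_sym minus_complex.sel diff_ge_0_iff_ge)
      moreover have "D = (\<lambda>x. ?T x + (D x - ?T x))" by simp
      ultimately show "D \<in> {A22. bounded_clinear A22 \<and> (\<exists>Y. nonneg_op Y \<and> A22 = (\<lambda>x. ?T x + Y x))}"
        using Db by blast
    next
      fix D assume "D \<in> {A22. bounded_clinear A22 \<and> (\<exists>Y. nonneg_op Y \<and> A22 = (\<lambda>x. ?T x + Y x))}"
      then obtain Y where Db: "bounded_clinear D" and Y: "nonneg_op Y" and D: "D = (\<lambda>x. ?T x + Y x)"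
        by blast
      have "selfadjoint_op D"
        unfolding selfadjoint_op_iff using Db
        by (auto simp only: D cinner_add_left cinner_add_right T_sym nonneg_op_sym[OF Y])
      moreover have "op_le ?T D"
        unfolding op_le_def D using nonneg_op_pos[OF Y] by (simp only: cinner_add_left plus_complex.sel) simp
      ultimately show "D \<in> ?sol" by (simp only: sol_iff)
    qed
    moreover have "?T \<in> ?sol" using sol_iff[OF T] by (simp only: op_le_def) blast
    moreover have "\<forall>A22\<in>?sol. op_le ?T A22" using sol_iff sol_selfadjoint by blast
    ultimately show ?thesis using dom S by blast
  qed
  have "(\<exists>A22 A. selfadjoint_op A22 \<and> A = block_op A11 A12 A21 A22 \<and> bounded_clinear A \<and> condition_Max A)
      \<longleftrightarrow> range A12 \<subseteq> range ?R"
  proof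
    assume "\<exists>A22 A. selfadjoint_op A22 \<and> A = block_op A11 A12 A21 A22 \<and> bounded_clinear A \<and> condition_Max A"
    then obtain A22 where "A22 \<in> ?sol" by (auto simp: solution_set_def)
    then show "range A12 \<subseteq> range ?R" by (rule sol_range)
  next
    assume "range A12 \<subseteq> range ?R"
    then have "?T \<in> ?sol" using ii by blast
    then have "selfadjoint_op ?T" "condition_Max (block_op A11 A12 A21 ?T)"
      unfolding solution_set_def mem_Collect_eq by blast+
    then show "\<exists>A22 A. selfadjoint_op A22 \<and> A = block_op A11 A12 A21 A22 \<and> bounded_clinear A \<and> condition_Max A"
      using block_bounded by blast
  qed
  with ii show ?thesis by blast
qed

end
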